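(* For each integer $n\ge 1$, let $e(n)$ be the maximum number of edges of a triangle-free matchstick graph on $n$ vertices. Then \[ 2n-\sqrt{2}\,\sqrt{n}-O(1)\;\le\; e(n)\;\le\; 2n-\frac{\sqrt{2}}{5}\sqrt{n}, \] where the upper bound holds for every $n\ge 1$, and the lower bound means that there is an absolute constant $K$ such that $e(n)\ge 2n-\sqrt{2}\,\sqrt{n}-K$ for every $n\ge 1$.
   Context: A matchstick graph is a finite simple graph drawn in the plane so that its vertices are distinct points and its edges are pairwise non-crossing straight-line segments of unit length (two edges may meet only at a common endpoint, and no edge passes through a vertex other than its endpoints). Not every pair of vertices at unit distance needs to be joined by an edge. Triangle-free means that the graph contains no cycle of length $3$. *)

theory Defs
  imports "HOL-Analysis.Analysis"
begin

definition simple_graph :: "'a set \<Rightarrow> 'a set set \<Rightarrow> bool" where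
  "simple_graph V E \<longleftrightarrow> finite V \<and> (\<forall>e\<in>E. \<exists>u\<in>V. \<exists>v\<in>V. u \<noteq> v \<and> e = {u, v})"

definition triangle_free :: "'a set set \<Rightarrow> bool" where
  "triangle_free E \<longleftrightarrow>
     \<not> (\<exists>a b c. a \<noteq> b \<and> b \<noteq> c \<and> a \<noteq> c \<and> {a, b} \<in> E \<and> {b, c} \<in> E \<and> {a, c} \<in> E)"

text \<open>
  Since the vertices of a drawing are distinct points and the edges are straight, the graph is
  identified with its drawing: vertices are points of the plane, and the edge \<open>{u, v}\<close> is drawn as
  the closed segment from \<open>u\<close> to \<open>v\<close>, which is \<open>convex hull {u, v}\<close>.
\<close>

definition matchstick_graph :: "(real ^ 2) set \<Rightarrow> (real ^ 2) set set \<Rightarrow> bool" where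
  "matchstick_graph V E \<longleftrightarrow>
     simple_graph V E \<and>
     (\<forall>u v. {u, v} \<in> E \<longrightarrow> dist u v = 1) \<and>
     (\<forall>e\<in>E. \<forall>w\<in>V. w \<in> convex hull e \<longrightarrow> w \<in> e) \<and>
     (\<forall>e\<in>E. \<forall>f\<in>E. e \<noteq> f \<longrightarrow> convex hull e \<inter> convex hull f \<subseteq> e \<inter> f)"

definition edge_counts :: "nat \<Rightarrow> nat set" where
  "edge_counts n = {card E |V E. matchstick_graph V E \<and> triangle_free E \<and> card V = n}"

definition max_edges :: "nat \<Rightarrow> nat" where
  "max_edges n = Max (edge_counts n)"

text \<open>The maximum is attained: the set of edge counts is finite and nonempty.\<close>

lemma finite_edge_counts: "finite (edge_counts n)"
proof -
  have "edge_counts n \<subseteq> {..2 ^ n}"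
  proof
    fix m assume "m \<in> edge_counts n"
    then obtain V E where VE: "m = card E" "matchstick_graph V E" "card V = n"
      by (auto simp: edge_counts_def)
    have "finite V" "E \<subseteq> Pow V"
      using VE(2) by (fastforce simp: matchstick_graph_def simple_graph_def)+
    then show "m \<in> {..2 ^ n}"
      using VE card_mono[of "Pow V" E] by (simp add: card_Pow)
  qed
  then show ?thesis
    using finite_subset by blast
qed

lemma edge_counts_nonempty: "edge_counts n \<noteq> {}"
proof -
  have "infinite (UNIV :: (real ^ 2) set)"
    by (rule infinite_UNIV_char_0)
  then obtain V :: "(real ^ 2) set" where "finite V" "card V = n"
    using infinite_arbitrarily_large by blast
  then have "card ({} :: (real ^ 2) set set) \<in> edge_counts n"
    unfolding edge_counts_def matchstick_graph_def simple_graph_def triangle_free_def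
    by blast
  then show ?thesis by blast
qed

end

theory Submission imports Defs
begin

text \<open>
  Upper bound. A graph with \<open>n\<close> vertices and \<open>e\<close> edges has \<open>2e\<close> sides of edges. Call a side free if
  no rhombic face lies along it, and let \<open>L\<close> be the number of free sides. Two estimates are played
  off against each other.

  \<^item> Free sides cost edges: \<open>10e + L + 10 \<le> 20n\<close> (\<open>edges_free_darts_vertices\<close>). Extend the graph to
    a maximal plane straight-line graph on the same vertices, so that its bounded faces are triangles
    (\<open>left_triangle_exists\<close>). With respect to a generic direction every triangle has a middle vertex,
    and a vertex is the middle one of at most one triangle to its left and of at most one to its
    right; sides without a triangle use up such places as well (\<open>card_triangles_hull_darts\<close>). A
    triangle has at most two sides in the graph, as the graph has no triangles. If it has two, then
    it is compensated by the triangle across its third side, unless that one also has two; but then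
    both together form a rhombus (\<open>rhombus_from_triangles\<close>). The extreme non-rhombic face is the
    pentagon, five sides for three triangles, and this is where the factor \<open>1/5\<close> comes from.

  \<^item> Few free sides allow few edges: \<open>4e \<le> L\<^sup>2 + L\<close> (\<open>card_edges_le_free_darts\<close>). Rhombi that share
    sides of one direction line up in strips. A strip advances monotonically, so it stops at a free
    side, and two strips cross at most once (\<open>strips_cross_once\<close>). Hence a rhombus is determined by
    the free sides at which the two strips through it stop.

  If \<open>e\<close> exceeded \<open>2n - s/5\<close> with \<open>s = sqrt (2n)\<close>, then the first estimate would give \<open>L < 2s - 10\<close>,
  and the second would turn this into \<open>4e < (2s - 10)(2s - 9)\<close>, a contradiction since \<open>s > 5\<close>.

  Lower bound. A centrally symmetric polygon with \<open>2m\<close> unit sides of \<open>m\<close> directions is tiled by rhombi;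
  the tiling has \<open>1 + m(m+1)/2\<close> vertices and \<open>m\<^sup>2\<close> edges. It is the image of a triangular part of the
  square grid under a map which sends the grid point \<open>(i, j)\<close> to the sum of the directions from \<open>i\<close> up
  to \<open>j\<close>. That edges do not cross follows from the injectivity of this map (\<open>zono_inj\<close>), which holds
  because the directions only turn left. Numbers of vertices between two values are reached by adding
  a part of the next row, where all vertices but the first one contribute two edges each.
\<close>

section \<open>Vectors of the plane\<close>

text \<open>Positive if and only if the vector \<open>b\<close> points to the left of \<open>a\<close>.\<close>

definition cross2 :: "real ^ 2 \<Rightarrow> real ^ 2 \<Rightarrow> real" where
  "cross2 a b = a$1 * b$2 - a$2 * b$1"

lemma cross2_simps [simp]:
  "cross2 (x + y) z = cross2 x z + cross2 y z"
  "cross2 (x - y) z = cross2 x z - cross2 y z"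
  "cross2 (- x) z = - cross2 x z"
  "cross2 (k *\<^sub>R x) z = k * cross2 x z"
  "cross2 z (x + y) = cross2 z x + cross2 z y"
  "cross2 z (x - y) = cross2 z x - cross2 z y"
  "cross2 z (- x) = - cross2 z x"
  "cross2 z (k *\<^sub>R x) = k * cross2 z x"
  "cross2 x x = 0" "cross2 0 x = 0" "cross2 x 0 = 0"
  by (auto simp: cross2_def algebra_simps)

lemma cross2_commute: "cross2 a b = - cross2 b a"
  by (simp add: cross2_def)

lemma continuous_on_cross2 [continuous_intros]:
  "continuous_on S f \<Longrightarrow> continuous_on S g \<Longrightarrow> continuous_on S (\<lambda>x. cross2 (f x) (g x))"
  unfolding cross2_def by (intro continuous_intros)

lemma cross2_decomp: "cross2 a b *\<^sub>R p = cross2 p b *\<^sub>R a + cross2 a p *\<^sub>R b"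
  by (simp add: vec_eq_iff forall_2 cross2_def algebra_simps)

lemma cross2_eq_0_parallel:
  assumes "cross2 a b = 0" "a \<noteq> 0"
  obtains k where "b = k *\<^sub>R a"
proof -
  have "(a \<bullet> a) *\<^sub>R b = (a \<bullet> b) *\<^sub>R a"
    using assms(1) by (simp add: vec_eq_iff forall_2 cross2_def inner_vec_def sum_2 algebra_simps)
  moreover have "a \<bullet> a \<noteq> 0" using assms(2) by simp
  ultimately have "b = (1 / (a \<bullet> a)) *\<^sub>R ((a \<bullet> b) *\<^sub>R a)"
    by (metis scaleR_scaleR scaleR_one nonzero_eq_divide_eq)
  then show thesis using that by (metis scaleR_scaleR)
qed

text \<open>The first coordinate of \<open>p\<close> with respect to the origin \<open>u\<close> and the basis \<open>a\<close>, \<open>b\<close>, by Cramer's rule.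
  The second coordinate is \<open>crd b a u p\<close>, since exchanging the two vectors negates both determinants.\<close>

definition crd :: "real ^ 2 \<Rightarrow> real ^ 2 \<Rightarrow> real ^ 2 \<Rightarrow> real ^ 2 \<Rightarrow> real" where
  "crd a b u p = cross2 (p - u) b / cross2 a b"

lemma crd_affine: "crd a b u ((1 - s) *\<^sub>R x + s *\<^sub>R y) = (1 - s) * crd a b u x + s * crd a b u y"
  unfolding crd_def by (simp add: add_divide_distrib diff_divide_distrib algebra_simps)

lemma crd_comb:
  assumes "cross2 a b \<noteq> 0"
  shows "crd a b u (u + s *\<^sub>R a + t *\<^sub>R b) = s" "crd b a u (u + s *\<^sub>R a + t *\<^sub>R b) = t"
  using assms cross2_commute[of a b] unfolding crd_def by (simp_all add: algebra_simps)

lemma crd_decomp: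
  assumes "cross2 a b \<noteq> 0"
  shows "p = u + crd a b u p *\<^sub>R a + crd b a u p *\<^sub>R b"
proof -
  have "cross2 a b *\<^sub>R (p - u) = cross2 (p - u) b *\<^sub>R a + cross2 a (p - u) *\<^sub>R b"
    by (rule cross2_decomp)
  then have "p - u = (cross2 (p - u) b *\<^sub>R a + cross2 a (p - u) *\<^sub>R b) /\<^sub>R cross2 a b"
    using assms by (metis scaleR_scaleR left_inverse scaleR_one)
  also have "\<dots> = crd a b u p *\<^sub>R a + crd b a u p *\<^sub>R b"
  proof -
    have "crd b a u p = cross2 a (p - u) / cross2 a b"
      unfolding crd_def cross2_commute[of "p - u" a] cross2_commute[of b a] using assms by (simp add: field_simps)
    then show ?thesis by (simp only: crd_def scaleR_right_distrib scaleR_scaleR divide_inverse mult.commute)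
  qed
  finally show ?thesis by (simp add: algebra_simps)
qed

text \<open>A segment that leaves a region bounded by two lines crosses one of them at a point that is not yet
  beyond the other. The numbers are the values of the two linear functions at the start and at the
  end of the segment. In this form the lemma lets an edge exit from a triangle through a known side.\<close>

lemma two_linear_exit:
  fixes A0 A1 B0 B1 :: real
  assumes "0 < A0" "0 < B0" "A1 < 0 \<or> B1 < 0"
  obtains s where "0 < s" "s < 1"
    "((1 - s) * A0 + s * A1 = 0 \<and> 0 \<le> (1 - s) * B0 + s * B1) \<or>
     ((1 - s) * B0 + s * B1 = 0 \<and> 0 \<le> (1 - s) * A0 + s * A1)"
proof -
  have one: "\<exists>s. 0 < s \<and> s < 1 \<and> (1 - s) * A0 + s * A1 = 0 \<and> 0 \<le> (1 - s) * B0 + s * B1"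
    if "0 < A0" "0 < B0" "A1 < 0" "A0 * B1 \<ge> A1 * B0" for A0 A1 B0 B1 :: real
  proof (intro exI[of _ "A0 / (A0 - A1)"] conjI)
    have "1 - A0 / (A0 - A1) = - A1 / (A0 - A1)" using that by (simp add: field_simps)
    then have "(1 - A0 / (A0 - A1)) * B0 + A0 / (A0 - A1) * B1 = (A0 * B1 - A1 * B0) / (A0 - A1)"
      by (simp add: diff_divide_distrib)
    then show "0 \<le> (1 - A0 / (A0 - A1)) * B0 + A0 / (A0 - A1) * B1" using that by simp
  qed (use that in \<open>auto simp: field_simps\<close>)
  consider "A1 < 0" "A0 * B1 \<ge> A1 * B0" | "B1 < 0" "B0 * A1 \<ge> B1 * A0"
  proof (cases "A1 < 0 \<and> A0 * B1 \<ge> A1 * B0")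
    case False
    have "B1 < 0"
    proof (rule ccontr)
      assume "\<not> B1 < 0"
      then have "A1 < 0" "A0 * B1 \<ge> 0" "A1 * B0 \<le> 0"
        using assms by (auto simp: mult_le_0_iff)
      then show False using False by linarith
    qed
    moreover have "B0 * A1 \<ge> B1 * A0"
    proof (cases "A1 < 0")
      case True then show ?thesis using False by (simp add: mult.commute)
    next
      case False
      then have "B0 * A1 \<ge> 0" "B1 * A0 \<le> 0" using assms \<open>B1 < 0\<close> by (auto simp: mult_le_0_iff)
      then show ?thesis by linarith
    qed
    ultimately show thesis using that by blast
  qed (use that in blast)
  then show thesis
    using one[of A0 B0 A1 B1] one[of B0 A0 B1 A1] assms that by cases blast+
qed

lemma same_ray_cases:
  fixes a b y q :: "'a::real_vector"
  assumes "q \<in> closed_segment a y" "q \<in> closed_segment a b" "q \<noteq> a"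
  shows "y \<in> closed_segment a b \<or> b \<in> closed_segment a y"
proof -
  from assms obtain s t where st: "q = (1 - s) *\<^sub>R a + s *\<^sub>R y" "0 \<le> s" "s \<le> 1"
      "q = (1 - t) *\<^sub>R a + t *\<^sub>R b" "0 \<le> t" "t \<le> 1"
    unfolding in_segment by blast
  then have pos: "0 < s" "0 < t" using assms(3) by (auto simp: less_le)
  have eq: "s *\<^sub>R (y - a) = t *\<^sub>R (b - a)"
    using st(1,4) by (simp add: algebra_simps)
  show ?thesis
  proof (cases "t \<le> s")
    case True
    have "y - a = (t / s) *\<^sub>R (b - a)"
      using arg_cong[OF eq, of "\<lambda>x. (1/s) *\<^sub>R x"] pos by simp
    then have "y = (1 - t / s) *\<^sub>R a + (t / s) *\<^sub>R b" by (simp add: algebra_simps)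
    then show ?thesis using True pos unfolding in_segment by (intro disjI1 exI[of _ "t / s"]) auto
  next
    case False
    have "b - a = (s / t) *\<^sub>R (y - a)"
      using arg_cong[OF eq, of "\<lambda>x. (1/t) *\<^sub>R x"] pos by simp
    then have "b = (1 - s / t) *\<^sub>R a + (s / t) *\<^sub>R y" by (simp add: algebra_simps)
    then show ?thesis using False pos unfolding in_segment by (intro disjI2 exI[of _ "s / t"]) auto
  qed
qed

lemma in_segment_from:
  fixes p u a :: "'a::real_vector"
  shows "0 \<le> t \<Longrightarrow> t \<le> 1 \<Longrightarrow> u + t *\<^sub>R (a - u) \<in> closed_segment u a"
  unfolding in_segment by (rule exI[of _ t]) (simp add: algebra_simps)

lemma in_triangle_iff:
  assumes "cross2 (v - u) (w - u) \<noteq> 0"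
  shows "p \<in> convex hull {u, v, w} \<longleftrightarrow>
    0 \<le> crd (v - u) (w - u) u p \<and> 0 \<le> crd (w - u) (v - u) u p \<and>
    crd (v - u) (w - u) u p + crd (w - u) (v - u) u p \<le> 1"
    (is "?L \<longleftrightarrow> ?R")
proof
  assume ?L
  then obtain x y z where *: "0 \<le> x" "0 \<le> y" "0 \<le> z" "x + y + z = 1"
      "p = x *\<^sub>R u + y *\<^sub>R v + z *\<^sub>R w"
    unfolding convex_hull_3 by auto
  then have x: "x = 1 - y - z" by simp
  have "p = u + y *\<^sub>R (v - u) + z *\<^sub>R (w - u)" using *(5) unfolding x by (simp add: algebra_simps)
  then show ?R using crd_comb[OF assms, of u y z] * by simp
next
  assume R: ?R
  let ?y = "crd (v - u) (w - u) u p" and ?z = "crd (w - u) (v - u) u p"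
  have "p = u + ?y *\<^sub>R (v - u) + ?z *\<^sub>R (w - u)" by (rule crd_decomp[OF assms])
  then have "p = (1 - ?y - ?z) *\<^sub>R u + ?y *\<^sub>R v + ?z *\<^sub>R w" by (simp add: algebra_simps)
  then show ?L unfolding convex_hull_3 using R
    by (intro CollectI exI[of _ "1 - ?y - ?z"] exI[of _ ?y] exI[of _ ?z]) auto
qed

section \<open>Plane straight-line graphs\<close>

locale plane_graph =
  fixes V :: "(real ^ 2) set" and E :: "(real ^ 2) set set"
  assumes graph: "simple_graph V E"
    and vertex_on_edge: "\<And>e x. e \<in> E \<Longrightarrow> x \<in> V \<Longrightarrow> x \<in> convex hull e \<Longrightarrow> x \<in> e"
    and edges_meet: "\<And>e f x. e \<in> E \<Longrightarrow> f \<in> E \<Longrightarrow> e \<noteq> f \<Longrightarrow>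
      x \<in> convex hull e \<Longrightarrow> x \<in> convex hull f \<Longrightarrow> x \<in> e \<and> x \<in> f"
begin

lemma finite_V [simp]: "finite V"
  using graph by (simp add: simple_graph_def)

lemma edgeE:
  assumes "e \<in> E" obtains u v where "e = {u, v}" "u \<noteq> v" "u \<in> V" "v \<in> V"
  using graph assms unfolding simple_graph_def by metis

lemma edge_in_V: "{u, v} \<in> E \<Longrightarrow> u \<in> V" "{u, v} \<in> E \<Longrightarrow> v \<in> V" "{u, v} \<in> E \<Longrightarrow> u \<noteq> v"
  by (metis doubleton_eq_iff edgeE)+

lemma edge_sub_V: "e \<in> E \<Longrightarrow> e \<subseteq> V"
  by (metis edgeE empty_subsetI insert_subset)

lemma finite_E [simp]: "finite E"
  by (rule finite_subset[of _ "Pow V"]) (use edge_sub_V in auto)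

lemma hull_edge: "convex hull {u, v} = closed_segment u (v :: real ^ 2)"
  by (simp add: segment_convex_hull)

text \<open>If the two edges had different lengths, then the end of the shorter one would lie inside the longer
  one. The vector \<open>k\<close> expresses that \<open>a\<close> and \<open>b\<close> lie on the same side of \<open>u\<close>.\<close>

lemma same_direction_edges:
  assumes "{u, a} \<in> E" "{u, b} \<in> E" "cross2 (a - u) (b - u) = 0"
    and "0 < cross2 k (a - u)" "0 < cross2 k (b - u)"
  shows "a = b"
proof -
  have "a - u \<noteq> 0" using assms(4) by auto
  then obtain l where l: "b - u = l *\<^sub>R (a - u)" using assms(3) cross2_eq_0_parallel by blast
  then have lpos: "0 < l" using assms(4,5) by (metis cross2_simps(8) zero_less_mult_pos2)
  show ?thesis
  proof (cases "l \<le> 1")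
    case True
    have "b = u + l *\<^sub>R (a - u)" using l by (simp add: algebra_simps)
    then have "b \<in> closed_segment u a" using True lpos in_segment_from[of l u a] by simp
    then have "b \<in> {u, a}" using vertex_on_edge[OF assms(1), of b] edge_in_V(2)[OF assms(2)] by (simp add: hull_edge)
    then show ?thesis using edge_in_V(3)[OF assms(2)] by auto
  next
    case False
    have "a = u + (1 / l) *\<^sub>R (b - u)" using l lpos by simp
    then have "a \<in> closed_segment u b" using False lpos in_segment_from[of "1 / l" u b] by simp
    then have "a \<in> {u, b}" using vertex_on_edge[OF assms(2), of a] edge_in_V(2)[OF assms(1)] by (simp add: hull_edge)
    then show ?thesis using edge_in_V(3)[OF assms(1)] by auto
  qed
qed

lemma nearest_vertex:
  assumes "z \<in> V" "z \<noteq> u"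
  obtains z' where "z' \<in> V" "z' \<noteq> u" "z' \<in> closed_segment u z" "V \<inter> open_segment u z' = {}"
proof -
  let ?S = "{x \<in> V. x \<noteq> u \<and> x \<in> closed_segment u z}"
  have "finite ?S" "?S \<noteq> {}" using assms by auto
  then obtain z' where z': "z' \<in> ?S" "\<And>x. x \<in> ?S \<Longrightarrow> \<not> dist u x < dist u z'"
    using ex_min_if_finite[of "dist u ` ?S"] by (fastforce)
  have "x \<notin> open_segment u z'" if "x \<in> V" for x
  proof
    assume x: "x \<in> open_segment u z'"
    then have "dist u x < dist u z'" using dist_in_open_segment[OF x]
      by (simp add: dist_commute)
    moreover have "x \<in> closed_segment u z"
      using x z'(1) by (metis (no_types, lifting) ends_in_segment(1) mem_Collect_eq open_closed_segment
          subset_closed_segment subset_eq)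
    moreover have "x \<noteq> u" using x by (auto simp: open_segment_def)
    ultimately show False using z'(2) that by blast
  qed
  then show thesis using that[of z'] z'(1) by blast
qed

text \<open>An edge on a line through the vertex \<open>u\<close> cannot contain \<open>u\<close> inside, so it lies on one side of \<open>u\<close>, and
  the end which is nearer to \<open>u\<close> precedes every other point \<open>q\<close> of the edge.\<close>

lemma collinear_edge:
  assumes "e \<in> E" "u \<in> V" "u \<notin> e" "q \<in> convex hull e" "\<And>x. x \<in> e \<Longrightarrow> cross2 (q - u) (x - u) = 0"
  obtains x where "x \<in> e" "x \<in> closed_segment u q" "x \<noteq> u"
proof -
  obtain a b where e: "e = {a, b}" using edgeE[OF assms(1)] by metis
  have uq: "q \<noteq> u" using vertex_on_edge[OF assms(1,2)] assms(3,4) by auto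
  from assms(4) e obtain s where s: "q = (1 - s) *\<^sub>R a + s *\<^sub>R b" "0 \<le> s" "s \<le> 1"
    by (auto simp: hull_edge in_segment)
  have "cross2 (q - u) (a - u) = 0" "cross2 (q - u) (b - u) = 0" using assms(5) e by auto
  then obtain l m where lm: "a - u = l *\<^sub>R (q - u)" "b - u = m *\<^sub>R (q - u)"
    using cross2_eq_0_parallel[of "q - u"] uq by (metis eq_iff_diff_eq_0)
  have "q - u = (1 - s) *\<^sub>R (a - u) + s *\<^sub>R (b - u)" using s(1) by (simp add: algebra_simps)
  also have "\<dots> = ((1 - s) * l + s * m) *\<^sub>R (q - u)" by (simp add: lm algebra_simps)
  finally have "(1 - s) * l + s * m = 1" using uq
    by (metis eq_iff_diff_eq_0 scaleR_cancel_right scaleR_one)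
  then have "l \<le> 1 \<or> m \<le> 1"
    using convex_bound_lt[of "- l" "- 1" "- m" "1 - s" s] s(2,3) by fastforce
  then obtain x k where x: "x \<in> e" "x - u = k *\<^sub>R (q - u)" "k \<le> 1" using e lm by auto
  have k: "0 < k"
  proof (rule ccontr)
    assume "\<not> 0 < k"
    define t where "t = - k / (1 - k)"
    have t: "0 \<le> t" "t \<le> 1" "(1 - t) * k + t = 0"
      using \<open>\<not> 0 < k\<close> by (auto simp: t_def field_simps)
    have "(1 - t) *\<^sub>R (x - u) + t *\<^sub>R (q - u) = ((1 - t) * k + t) *\<^sub>R (q - u)"
      unfolding x(2) by (simp add: algebra_simps)
    then have "u = (1 - t) *\<^sub>R x + t *\<^sub>R q" unfolding t(3) by (simp add: algebra_simps)
    then have "u \<in> closed_segment x q" unfolding in_segment using t by blast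
    also have "closed_segment x q \<subseteq> convex hull e"
      using x(1) assms(4) by (simp add: closed_segment_subset hull_inc)
    finally show False using vertex_on_edge[OF assms(1,2)] assms(3) by blast
  qed
  have "x = u + k *\<^sub>R (q - u)" using x(2) by (simp add: algebra_simps)
  then show thesis using that[of x] in_segment_from[of k u q] x k uq by simp
qed

end

section \<open>Maximal plane graphs\<close>

locale maximal_plane_graph = plane_graph +
  assumes maximal: "\<And>a b. a \<in> V \<Longrightarrow> b \<in> V \<Longrightarrow> a \<noteq> b \<Longrightarrow> plane_graph V (insert {a, b} E) \<Longrightarrow> {a, b} \<in> E"

lemma (in plane_graph) maximal_extension:
  obtains F where "E \<subseteq> F" "maximal_plane_graph V F"
proof -
  let ?S = "{F. E \<subseteq> F \<and> plane_graph V F}"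
  have sub: "?S \<subseteq> Pow (Pow V)" using plane_graph.edge_sub_V by blast
  have "finite ?S" by (rule finite_subset[OF sub]) simp
  moreover have "E \<in> ?S" using plane_graph_axioms by simp
  ultimately obtain F where F: "F \<in> ?S" "\<And>F'. F' \<in> ?S \<Longrightarrow> F \<subseteq> F' \<Longrightarrow> F = F'"
    using finite_has_maximal2[of ?S E] by auto
  have "maximal_plane_graph V F"
    unfolding maximal_plane_graph_def maximal_plane_graph_axioms_def
  proof (intro conjI allI impI)
    show "plane_graph V F" using F(1) by simp
    fix a b assume "plane_graph V (insert {a, b} F)"
    then have "insert {a, b} F \<in> ?S" using F(1) by auto
    then have "F = insert {a, b} F" by (rule F(2)) auto
    then show "{a, b} \<in> F" by blast
  qed
  moreover have "E \<subseteq> F" using F(1) by simp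
  ultimately show thesis by (rule that[rotated])
qed

context maximal_plane_graph begin

text \<open>Every edge of a maximal plane graph is obtained from this criterion. Edges through an end of the new
  segment need no attention: if they overlapped with it, one of the two would contain a vertex inside.\<close>

lemma unblocked_edge:
  assumes V: "a \<in> V" "b \<in> V" "a \<noteq> b"
    and free: "V \<inter> open_segment a b = {}"
    and unblocked: "\<And>e. e \<in> E \<Longrightarrow> a \<notin> e \<Longrightarrow> b \<notin> e \<Longrightarrow> convex hull e \<inter> open_segment a b = {}"
  shows "{a, b} \<in> E"
proof -
  have share: "{a, b} = e" if "e \<in> E" "a \<in> e" "q \<in> convex hull e" "q \<in> open_segment a b" "b \<in> V"
    "V \<inter> open_segment a b = {}" for a b e q
  proof -
    obtain y where e: "e = {a, y}" "y \<in> V"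
    proof (rule edgeE[OF \<open>e \<in> E\<close>])
      fix v w assume "e = {v, w}" "v \<in> V" "w \<in> V"
      then show thesis using \<open>a \<in> e\<close> that[of v] that[of w] by (auto simp: insert_commute)
    qed
    have q: "q \<in> closed_segment a y" "q \<in> closed_segment a b" "q \<noteq> a"
      using that e by (auto simp: hull_edge open_segment_def)
    from same_ray_cases[OF q] show ?thesis
    proof
      assume "y \<in> closed_segment a b"
      then have "y \<in> {a, b}" using that e by (auto simp: open_segment_def)
      then show ?thesis using e edge_in_V(3) \<open>e \<in> E\<close> by auto
    next
      assume "b \<in> closed_segment a y"
      then have "b \<in> e" using vertex_on_edge[OF \<open>e \<in> E\<close> \<open>b \<in> V\<close>] e by (simp add: hull_edge)
      then show ?thesis using e \<open>q \<in> open_segment a b\<close> by (auto simp: open_segment_def)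
    qed
  qed
  have meet: "x \<in> e \<and> x \<in> {a, b}"
    if e: "e \<in> E" "e \<noteq> {a, b}" and x: "x \<in> convex hull e" "x \<in> closed_segment a b" for e x
  proof (cases "x \<in> open_segment a b")
    case True
    then have "a \<in> e \<or> b \<in> e" using unblocked e x by blast
    then show ?thesis
      using share[OF e(1) _ x(1) True V(2) free] share[OF e(1) _ x(1), of b a] True V free e(2)
      by (auto simp: open_segment_commute insert_commute)
  next
    case False
    then have "x \<in> {a, b}" using x(2) by (auto simp: open_segment_def)
    then show ?thesis using vertex_on_edge[OF e(1) _ x(1)] V by auto
  qed
  have "plane_graph V (insert {a, b} E)"
  proof
    show "simple_graph V (insert {a, b} E)"
      using graph V unfolding simple_graph_def by blast
    show "x \<in> e" if "e \<in> insert {a, b} E" "x \<in> V" "x \<in> convex hull e" for e x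
      using that vertex_on_edge free by (auto simp: hull_edge open_segment_def)
    show "x \<in> e \<and> x \<in> f" if "e \<in> insert {a, b} E" "f \<in> insert {a, b} E" "e \<noteq> f"
      "x \<in> convex hull e" "x \<in> convex hull f" for e f x
    proof -
      from that(1-3) consider "e \<in> E" "f \<in> E" | "e = {a, b}" "f \<in> E" | "f = {a, b}" "e \<in> E" by blast
      then show ?thesis
      proof cases
        case 1
        then show ?thesis using edges_meet that(3-5) by blast
      next
        case 2
        then have "f \<noteq> {a, b}" "x \<in> closed_segment a b" using that(3,4) by (simp_all add: hull_edge)
        then show ?thesis using meet[OF 2(2) _ that(5)] 2(1) by simp
      next
        case 3
        then have "e \<noteq> {a, b}" "x \<in> closed_segment a b" using that(3,5) by (simp_all add: hull_edge)
        then show ?thesis using meet[OF 3(2) _ that(4)] 3(1) by simp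
      qed
    qed
  qed
  then show ?thesis using maximal V by blast
qed

text \<open>Visibility. Let \<open>z'\<close> be a vertex in the half plane, and suppose that edges block the view from \<open>u\<close> to
  it. Let \<open>c\<close> be the first blocking point, on an edge \<open>e\<close> with an end \<open>y\<close> in the half plane. Among the
  vertices in the triangle \<open>u c y\<close> consider one that is seen from \<open>u\<close> under the smallest angle against
  the ray through \<open>c\<close>. An edge that blocks the view to this vertex would enter the part of the triangle
  under smaller angles. There is no vertex there in which it could end, and it cannot leave this part
  either, as the segment from \<open>u\<close> to \<open>c\<close> is not blocked before \<open>c\<close> and the third side lies on \<open>e\<close>.\<close>

lemma edge_into_half_plane:
  assumes u: "u \<in> V" and "z \<in> V" "0 < cross2 k (z - u)"
  obtains w where "{u, w} \<in> E" "0 < cross2 k (w - u)"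
proof -
  have "z \<noteq> u" using assms(3) by auto
  then obtain z' where z': "z' \<in> V" "z' \<noteq> u" "z' \<in> closed_segment u z" "V \<inter> open_segment u z' = {}"
    using nearest_vertex[OF assms(2)] by metis
  have kseg: "0 < cross2 k (x - u)" if "x \<in> closed_segment u y" "x \<noteq> u" "0 < cross2 k (y - u)" for x y
  proof -
    from that(1) obtain s where s: "x = (1 - s) *\<^sub>R u + s *\<^sub>R y" "0 \<le> s" "s \<le> 1" unfolding in_segment by blast
    then have "x - u = s *\<^sub>R (y - u)" by (simp add: algebra_simps)
    moreover have "0 < s" using s(1,2) that(2) by (cases "s = 0") auto
    ultimately show ?thesis using that(3) by (metis cross2_simps(8) mult_pos_pos)
  qed
  have kz': "0 < cross2 k (z' - u)" by (rule kseg[OF z'(3,2) assms(3)])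
  \<comment> \<open>the points that block the view from \<open>u\<close>\<close>
  define K where "K = (\<Union>e \<in> {e \<in> E. u \<notin> e}. convex hull e)"
  have KI: "x \<in> K" if "e \<in> E" "u \<notin> e" "x \<in> convex hull e" for x e using that by (auto simp: K_def)
  have "compact K" unfolding K_def
    using finite_subset[OF edge_sub_V finite_V]
    by (intro compact_UN finite_imp_compact_convex_hull) simp_all
  have uK: "u \<notin> K" unfolding K_def using vertex_on_edge[OF _ u] by blast
  show thesis
  proof (cases "K \<inter> open_segment u z' = {}")
    case True
    then have "{u, z'} \<in> E" using unblocked_edge[of u z'] u z' KI by blast
    then show thesis using that kz' by blast
  next
    case False
    then obtain c0 where c0: "c0 \<in> K" "c0 \<in> open_segment u z'" by blast
    have "compact (K \<inter> closed_segment u z')" by (rule compact_Int[OF \<open>compact K\<close>]) (rule compact_segment)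
    moreover have "K \<inter> closed_segment u z' \<noteq> {}" using c0 by (auto simp: open_segment_def)
    ultimately obtain c where cc: "c \<in> K \<inter> closed_segment u z'"
      and cmin: "\<And>x. x \<in> K \<inter> closed_segment u z' \<Longrightarrow> dist u c \<le> dist u x"
      by (meson distance_attains_inf compact_imp_closed)
    then have c: "c \<in> K" "c \<in> closed_segment u z'" by auto
    have "c \<noteq> z'" using cmin[of c0] c0 dist_in_open_segment[OF c0(2)] by (auto simp: dist_commute open_segment_def)
    moreover have cu: "c \<noteq> u" using c uK by auto
    ultimately have copen: "c \<in> open_segment u z'" using c(2) by (simp add: open_segment_def)
    have cV: "c \<notin> V" using copen z'(4) by blast
    have sub: "closed_segment u c \<subseteq> closed_segment u z'" using c(2) by (simp add: subset_closed_segment)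
    have z'_beyond: "z' \<notin> closed_segment u c"
      using dist_in_open_segment[OF copen] dist_in_closed_segment[of z' u c] by (auto simp: dist_commute)
    have before: "x \<notin> K" if "x \<in> closed_segment u c" "x \<noteq> c" for x
    proof
      assume "x \<in> K"
      then have "dist u c \<le> dist u x" using cmin that(1) sub by blast
      moreover have "x \<in> open_segment u c" using that \<open>x \<in> K\<close> uK by (auto simp: open_segment_def)
      ultimately show False using dist_in_open_segment[of x u c] by (simp add: dist_commute)
    qed
    have kc: "0 < cross2 k (c - u)" by (rule kseg[OF c(2) cu kz'])
    obtain e where e: "e \<in> E" "u \<notin> e" "c \<in> convex hull e" using c(1) by (auto simp: K_def)
    have "\<exists>x y. e = {x, y} \<and> 0 < cross2 k (y - u)"
    proof -
      obtain x y where xy: "e = {x, y}" using edgeE[OF e(1)] by metis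
      then obtain s where s: "c = (1 - s) *\<^sub>R x + s *\<^sub>R y" "0 \<le> s" "s \<le> 1"
        using e(3) unfolding xy hull_edge in_segment by blast
      then have "c - u = (1 - s) *\<^sub>R (x - u) + s *\<^sub>R (y - u)" by (simp add: algebra_simps)
      then have "cross2 k (c - u) = (1 - s) * cross2 k (x - u) + s * cross2 k (y - u)"
        by (metis cross2_simps(5,8))
      then have "0 < cross2 k (x - u) \<or> 0 < cross2 k (y - u)" using kc s(2,3)
        mult_nonneg_nonpos[of "1 - s" "cross2 k (x - u)"] mult_nonneg_nonpos[of s "cross2 k (y - u)"] by linarith
      then show ?thesis using xy by (metis insert_commute)
    qed
    then obtain x y where xy: "e = {x, y}" and ky: "0 < cross2 k (y - u)" by blast
    have yV: "y \<in> V" and yc: "y \<noteq> c" and yu: "y \<noteq> u" using edge_sub_V[OF e(1)] xy cV e(2) by auto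
    define D where "D = cross2 (c - u) (y - u)"
    have D: "D \<noteq> 0"
    proof
      assume D0: "D = 0"
      obtain s where s: "c = (1 - s) *\<^sub>R x + s *\<^sub>R y" "0 \<le> s" "s \<le> 1"
        using e(3) unfolding xy hull_edge in_segment by blast
      then have "s \<noteq> 1" using yc by auto
      have "c - u = (1 - s) *\<^sub>R (x - u) + s *\<^sub>R (y - u)" using s(1) by (simp add: algebra_simps)
      then have "cross2 (c - u) (c - u) = (1 - s) * cross2 (c - u) (x - u) + s * D"
        unfolding D_def by (metis cross2_simps(5,8))
      then have "cross2 (c - u) (x - u) = 0" using D0 \<open>s \<noteq> 1\<close> by simp
      then have "cross2 (c - u) (p - u) = 0" if "p \<in> e" for p
        using that D0 by (auto simp only: xy D_def)
      then obtain p where p: "p \<in> e" "p \<in> closed_segment u c" "p \<noteq> u"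
        using collinear_edge[OF e(1) u e(2,3)] by blast
      have "p \<in> V" using edge_sub_V[OF e(1)] p(1) by blast
      then have "p \<noteq> c" using cV by blast
      then show False using before[OF p(2)] KI[OF e(1,2) hull_inc[OF p(1)]] by blast
    qed
    \<comment> \<open>the coordinates of a point in the basis \<open>c - u\<close>, \<open>y - u\<close> with origin \<open>u\<close>\<close>
    define al where "al = crd (c - u) (y - u) u"
    define be where "be = crd (y - u) (c - u) u"
    have dec: "p = u + al p *\<^sub>R (c - u) + be p *\<^sub>R (y - u)" for p
      unfolding al_def be_def using crd_decomp D D_def by blast
    have decu: "p - u = al p *\<^sub>R (c - u) + be p *\<^sub>R (y - u)" for p
      using arg_cong[OF dec[of p], of "\<lambda>x. x - u"] by (simp only: add.assoc add_diff_cancel_left')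
    have comb: "al (u + s *\<^sub>R (c - u) + t *\<^sub>R (y - u)) = s" "be (u + s *\<^sub>R (c - u) + t *\<^sub>R (y - u)) = t" for s t
      unfolding al_def be_def using crd_comb[of "c - u" "y - u"] D D_def by auto
    have aff: "al ((1 - s) *\<^sub>R p + s *\<^sub>R q) = (1 - s) * al p + s * al q"
      "be ((1 - s) *\<^sub>R p + s *\<^sub>R q) = (1 - s) * be p + s * be q" for s p q
      unfolding al_def be_def by (rule crd_affine)+
    have ab_u: "al u = 0" "be u = 0" using comb[of 0 0] by simp_all
    have ab_y: "al y = 0" "be y = 1" using comb[of 0 1] by simp_all
    have ray: "p \<in> closed_segment u c" if "be p = 0" "0 \<le> al p" "al p \<le> 1" for p
    proof -
      have "p = u + al p *\<^sub>R (c - u)" by (subst dec[of p]) (simp add: that)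
      then show ?thesis using that in_segment_from[of "al p" u c] by metis
    qed
    have side: "p \<in> convex hull e" if "al p + be p = 1" "0 \<le> al p" "0 \<le> be p" for p
    proof -
      have al1: "al p = 1 - be p" using that by simp
      have "p = (1 - be p) *\<^sub>R c + be p *\<^sub>R y" by (subst dec[of p]) (simp add: al1 algebra_simps)
      then have "p \<in> closed_segment c y" unfolding in_segment using that by (intro exI[of _ "be p"]) auto
      also have "\<dots> \<subseteq> convex hull e" using e(3) xy
        by (simp add: closed_segment_subset hull_inc)
      finally show ?thesis .
    qed
    define W where "W = {p \<in> V. p \<noteq> u \<and> 0 \<le> al p \<and> 0 \<le> be p \<and> al p + be p \<le> 1}"
    have "finite W" "y \<in> W" using yV yu ab_y by (auto simp: W_def)
    have Wpos: "0 < be p" if "p \<in> W" for p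
    proof (rule ccontr)
      assume "\<not> 0 < be p"
      then have "p \<in> closed_segment u c" using that ray by (auto simp: W_def)
      then have "p \<in> closed_segment u c" "p \<noteq> c" "p \<in> V" "p \<noteq> u"
        using that cV by (auto simp: W_def)
      then have "p \<in> open_segment u z'" using sub copen
        using \<open>p \<in> closed_segment u c\<close> \<open>p \<noteq> u\<close> z'_beyond by (auto simp: open_segment_def)
      then show False using \<open>p \<in> V\<close> z'(4) by blast
    qed
    \<comment> \<open>the ratio grows with the angle against \<open>c - u\<close>\<close>
    obtain z1 where z1: "z1 \<in> W" and z1min: "\<And>p. p \<in> W \<Longrightarrow> be z1 / (al z1 + be z1) \<le> be p / (al p + be p)"
    proof -
      have "W \<noteq> {}" using \<open>y \<in> W\<close> by blast
      from ex_is_arg_min_if_finite[OF \<open>finite W\<close> this, of "\<lambda>p. be p / (al p + be p)"]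
      show thesis using that by (auto simp: is_arg_min_def not_less)
    qed
    \<comment> \<open>several vertices may be seen under this angle; take the nearest one\<close>
    obtain z2 where z2: "z2 \<in> V" "z2 \<noteq> u" "z2 \<in> closed_segment u z1" "V \<inter> open_segment u z2 = {}"
      using nearest_vertex[of z1 u] z1 by (auto simp: W_def)
    obtain l where l: "z2 = (1 - l) *\<^sub>R u + l *\<^sub>R z1" "0 \<le> l" "l \<le> 1"
      using z2(3) unfolding in_segment by blast
    have lpos: "0 < l" using l z2(2) by (cases "l = 0") auto
    have z2l: "al z2 = l * al z1" "be z2 = l * be z1" unfolding l(1) aff ab_u by simp_all
    have z1W: "z1 \<in> V" "z1 \<noteq> u" "0 \<le> al z1" "0 \<le> be z1" "al z1 + be z1 \<le> 1" using z1 by (auto simp: W_def)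
    have bz2: "0 < be z2" "0 \<le> al z2" "al z2 + be z2 \<le> 1"
    proof -
      show "0 < be z2" "0 \<le> al z2" using Wpos[OF z1] z1W lpos by (simp_all add: z2l)
      have "al z2 + be z2 = l * (al z1 + be z1)" by (simp add: z2l algebra_simps)
      also have "\<dots> \<le> 1" using l z1W by (intro mult_le_one) auto
      finally show "al z2 + be z2 \<le> 1" .
    qed
    have z2min: "be z2 * al p \<le> al z2 * be p" if "p \<in> W" for p
    proof -
      have pos: "0 < al z1 + be z1" "0 < al p + be p" using Wpos[OF z1] Wpos[OF that] z1 that by (auto simp: W_def)
      have "be z1 * (al p + be p) \<le> be p * (al z1 + be z1)"
        using z1min[OF that] pos by (simp add: divide_simps mult.commute)
      then have "be z1 * al p \<le> al z1 * be p" by (simp add: algebra_simps)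
      then show ?thesis unfolding z2l using lpos by simp
    qed
    have "K \<inter> open_segment u z2 = {}"
    proof (rule ccontr)
      assume "K \<inter> open_segment u z2 \<noteq> {}"
      then obtain q where q: "q \<in> K" "q \<in> open_segment u z2" by blast
      then obtain g where g: "g \<in> E" "u \<notin> g" "q \<in> convex hull g" by (auto simp: K_def)
      from q(2) obtain t where t: "q = (1 - t) *\<^sub>R u + t *\<^sub>R z2" "0 < t" "t < 1"
        unfolding in_segment by blast
      have qab: "al q = t * al z2" "be q = t * be z2" unfolding t(1) aff ab_u by simp_all
      have qpos: "0 < be q" "0 \<le> al q" "al q + be q < 1"
      proof -
        have "al q + be q = t * (al z2 + be z2)" by (simp add: qab algebra_simps)
        also have "\<dots> \<le> t" using bz2 t by (simp add: mult_left_le)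
        finally show "al q + be q < 1" using t by simp
      qed (use bz2 t qab in auto)
      \<comment> \<open>positive at the points that are seen under a smaller angle than \<open>z2\<close>\<close>
      define G where "G p = be z2 * al p - al z2 * be p" for p
      have Gq: "G q = 0" by (simp add: G_def qab)
      have Gaff: "G ((1 - s) *\<^sub>R p + s *\<^sub>R q) = (1 - s) * G p + s * G q" for s p q
        unfolding G_def aff by (simp add: algebra_simps)
      obtain a b where ab: "g = {a, b}" using edgeE[OF g(1)] by metis
      then obtain s where s: "q = (1 - s) *\<^sub>R a + s *\<^sub>R b" "0 \<le> s" "s \<le> 1"
        using g(3) unfolding ab hull_edge in_segment by blast
      have "0 = (1 - s) * G a + s * G b" using Gq unfolding s(1) Gaff by simp
      then have bal: "(1 - s) * G a + s * G b = 0" by simp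
      consider (pos) "0 < G a \<or> 0 < G b" | (line) "G a = 0" "G b = 0"
        | (atA) "s = 0" "G a = 0" | (atB) "s = 1" "G b = 0"
      proof (cases "0 < G a \<or> 0 < G b")
        case False
        then have "(1 - s) * G a \<le> 0" "s * G b \<le> 0"
          using s(2,3) by (auto intro: mult_nonneg_nonpos)
        then have "(1 - s) * G a = 0" "s * G b = 0" using bal by linarith+
        then show thesis using that by auto
      qed (use that in blast)
      then show False
      proof cases
        case pos
        then obtain d where a: "d \<in> g" "0 < G d" using ab by blast
        have aV: "d \<in> V" and au: "d \<noteq> u" using edge_sub_V[OF g(1)] a(1) g(2) by auto
        have aW: "d \<notin> W" using z2min[of d] a(2) by (auto simp: G_def)
        have "be d < 0 \<or> 1 - al d - be d < 0"
        proof (rule ccontr)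
          assume *: "\<not> ?thesis"
          then have "0 \<le> al z2 * be d" using bz2 by simp
          then have "0 < be z2 * al d" using a(2) by (simp add: G_def)
          then have "0 < al d" using bz2 by (simp add: zero_less_mult_iff)
          then show False using * aV au aW by (simp add: W_def)
        qed
        from two_linear_exit[OF qpos(1) _ this, of "1 - al q - be q"] qpos(3)
        obtain r where r: "0 < r" "r < 1" and rr:
          "((1 - r) * be q + r * be d = 0 \<and> 0 \<le> (1 - r) * (1 - al q - be q) + r * (1 - al d - be d)) \<or>
           ((1 - r) * (1 - al q - be q) + r * (1 - al d - be d) = 0 \<and> 0 \<le> (1 - r) * be q + r * be d)"
          by auto
        define P where "P = (1 - r) *\<^sub>R q + r *\<^sub>R d"
        have "P \<in> closed_segment q d" unfolding P_def in_segment using r by (intro exI[of _ r]) auto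
        also have "\<dots> \<subseteq> convex hull g" using g(3) a(1) by (simp add: closed_segment_subset hull_inc)
        finally have Pg: "P \<in> convex hull g" .
        have GP: "0 < G P" unfolding P_def Gaff Gq using r a(2) by simp
        have P: "al P = (1 - r) * al q + r * al d" "be P = (1 - r) * be q + r * be d" unfolding P_def aff by auto
        have rr': "(be P = 0 \<and> al P + be P \<le> 1) \<or> (al P + be P = 1 \<and> 0 \<le> be P)"
        proof -
          have "(1 - r) * (1 - al q - be q) + r * (1 - al d - be d) = 1 - al P - be P"
            unfolding P by (simp add: algebra_simps)
          then show ?thesis using rr unfolding P(2)[symmetric] by auto
        qed
        have "0 \<le> be P" using rr' by auto
        then have "0 < be z2 * al P" 
          using GP mult_nonneg_nonneg[OF bz2(2), of "be P"] unfolding G_def by linarith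
        then have aP: "0 < al P" using bz2 by (simp add: zero_less_mult_iff)
        have ge: "P \<notin> convex hull e"
        proof
          assume Pe: "P \<in> convex hull e"
          show False
          proof (cases "g = e")
            case True
            \<comment> \<open>then \<open>q\<close> would lie on the line through \<open>c\<close> and \<open>y\<close>, which it does not reach\<close>
            have affe: "al p + be p = 1" if "p \<in> e" for p
            proof -
              obtain s where s: "c = (1 - s) *\<^sub>R x + s *\<^sub>R y" "0 \<le> s" "s \<le> 1"
                using e(3) unfolding xy hull_edge in_segment by blast
              then have "s \<noteq> 1" using yc by auto
              have "al c + be c = 1" using comb[of 1 0] by simp
              then have "(1 - s) * (al x + be x) + s = 1" unfolding s(1) aff ab_y by (simp add: algebra_simps)
              then have "(1 - s) * (al x + be x) = (1 - s) * 1" by (simp only: mult_1_right eq_diff_eq)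
              then have "al x + be x = 1" 
                by (rule mult_left_cancel[THEN iffD1, rotated]) (use \<open>s \<noteq> 1\<close> in simp)
              then show ?thesis using that xy ab_y by auto
            qed
            have "al a + be a = 1" if "a \<in> g" for a using affe that True by simp
            then have e1: "al a = 1 - be a" and e2: "al b = 1 - be b" using ab by (auto simp: eq_diff_eq)
            have "al q + be q = 1" unfolding s(1) aff e1 e2 by algebra
            then show False using qpos by simp
          next
            case False
            then have PV: "P \<in> V" using edges_meet[OF g(1) e(1) False Pg Pe] edge_sub_V[OF e(1)] by blast
            then have "P \<in> W" using rr' aP ab_u \<open>0 \<le> be P\<close> unfolding W_def by auto
            then show False using z2min[of P] GP by (simp add: G_def)
          qed
        qed
        from rr' show False
        proof
          assume *: "be P = 0 \<and> al P + be P \<le> 1"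
          then have "P \<in> closed_segment u c" using ray aP by simp
          then show False using before[of P] KI[OF g(1,2) Pg] ge e(3) by blast
        next
          assume *: "al P + be P = 1 \<and> 0 \<le> be P"
          then show False using side[of P] aP ge by simp
        qed
      next
        case line
        have par: "cross2 (q - u) (p - u) = 0" if "G p = 0" for p
        proof -
          have *: "q - u = al q *\<^sub>R (c - u) + be q *\<^sub>R (y - u)" "p - u = al p *\<^sub>R (c - u) + be p *\<^sub>R (y - u)"
            by (rule decu)+
          have "cross2 (l *\<^sub>R v + m *\<^sub>R w) (l' *\<^sub>R v + m' *\<^sub>R w) = (l * m' - m * l') * cross2 v w" for l m l' m' v w
            using cross2_commute[of w v] by (simp add: algebra_simps)
          then have "cross2 (q - u) (p - u) = (al q * be p - be q * al p) * D"
            unfolding * D_def .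
          also have "\<dots> = - D * t * G p" by (simp add: qab G_def algebra_simps)
          finally show ?thesis using that by (simp only: mult_zero_right)
        qed
        have "cross2 (q - u) (p - u) = 0" if "p \<in> g" for p
        proof -
          have "G p = 0" using that line ab by auto
          then show ?thesis by (rule par)
        qed
        then obtain p where p: "p \<in> g" "p \<in> closed_segment u q" "p \<noteq> u"
          by (rule collinear_edge[OF g(1) u g(2,3)])
        have "closed_segment u q \<subseteq> closed_segment u z2" using q(2)
          by (simp add: open_closed_segment subset_closed_segment)
        moreover have "p \<noteq> z2"
          using dist_in_closed_segment[OF p(2)] dist_in_open_segment[OF q(2)] by (auto simp: dist_commute)
        ultimately have "p \<in> open_segment u z2" using p by (auto simp: open_segment_def)
        then show False using z2(4) p(1) edge_sub_V[OF g(1)] by blast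
      next
        case atA
        then have "q \<in> V" using s ab edge_sub_V[OF g(1)] by auto
        then show False using q(2) z2(4) by blast
      next
        case atB
        then have "q \<in> V" using s ab edge_sub_V[OF g(1)] by auto
        then show False using q(2) z2(4) by blast
      qed
    qed
    then have "{u, z2} \<in> E" using unblocked_edge[of u z2] u z2 KI by blast
    moreover have "0 < cross2 k (z2 - u)"
    proof -
      have "z2 - u = al z2 *\<^sub>R (c - u) + be z2 *\<^sub>R (y - u)" by (rule decu)
      then have "cross2 k (z2 - u) = al z2 * cross2 k (c - u) + be z2 * cross2 k (y - u)"
        by (metis cross2_simps(5,8))
      then show ?thesis using bz2 kc ky by (simp add: add_nonneg_pos)
    qed
    ultimately show thesis using that by blast
  qed
qed

end

section \<open>Triangular faces\<close>

text \<open>From here on signs of cross products of differences are compared as they stand, so they are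
  expanded on demand only.\<close>

declare cross2_simps(1-8) [simp del]

lemma crd_alt: "crd b a u p = cross2 a (p - u) / cross2 a b"
  unfolding crd_def cross2_commute[of "p - u" a] cross2_commute[of b a] by (simp only: minus_divide_divide)

lemma crd_pos_iff:
  assumes "0 < cross2 a b"
  shows "0 < crd a b u p \<longleftrightarrow> 0 < cross2 (p - u) b" "0 < crd b a u p \<longleftrightarrow> 0 < cross2 a (p - u)"
  using assms unfolding crd_alt[of b a] crd_def[of a b] by (simp_all add: zero_less_divide_iff)

lemma crd_decomp_diff:
  assumes "cross2 a b \<noteq> 0"
  shows "p - u = crd a b u p *\<^sub>R a + crd b a u p *\<^sub>R b"
  using arg_cong[OF crd_decomp[OF assms, of p u], of "\<lambda>z. z - u"] by (simp only: add.assoc add_diff_cancel_left')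

lemma cross2_rotate: "cross2 (w - v) (u - v) = cross2 (v - u) (w - u)"
  unfolding cross2_def by (simp add: algebra_simps)

text \<open>The determinant of \<open>x\<close> and \<open>w\<close>, computed from their coordinates in the orthogonal frame given by \<open>k\<close>.
  If both vectors lie to the left of \<open>k\<close>, then comparing the ratios of inner product and cross product
  with \<open>k\<close> compares the angles.\<close>

lemma cross2_angle: "(k \<bullet> k) * cross2 x w = (k \<bullet> x) * cross2 k w - (k \<bullet> w) * cross2 k x"
  unfolding cross2_def inner_vec_def sum_2 inner_real_def by algebra

text \<open>The Pluecker relation between four vectors of the plane.\<close>

lemma cross2_plucker: "cross2 a r * cross2 b c = cross2 a c * cross2 b r + cross2 a b * cross2 r c"
  unfolding cross2_def by algebra

lemma cross2_between:
  assumes "0 < cross2 a c" "0 < cross2 a b" "0 < cross2 a r" "0 < cross2 b r" "0 < cross2 r c"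
  shows "0 < cross2 b c"
proof -
  have "0 < cross2 a r * cross2 b c" using assms by (subst cross2_plucker) (intro add_pos_pos mult_pos_pos)
  then show ?thesis using assms(3) by (simp add: zero_less_mult_iff)
qed

text \<open>The triangular faces. The corners are listed counterclockwise, and each face occurs three times, once
  for every choice of the first corner; the face lies to the left of the side from \<open>u\<close> to \<open>v\<close>.\<close>

definition (in plane_graph) triangles :: "((real ^ 2) \<times> (real ^ 2) \<times> (real ^ 2)) set" where
  "triangles = {(u, v, w). {u, v} \<in> E \<and> {v, w} \<in> E \<and> {w, u} \<in> E \<and> 0 < cross2 (v - u) (w - u) \<and>
     V \<inter> convex hull {u, v, w} \<subseteq> {u, v, w}}"

definition (in plane_graph) hull_darts :: "((real ^ 2) \<times> (real ^ 2)) set" where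
  "hull_darts = {(u, v). {u, v} \<in> E \<and> (\<forall>z\<in>V. cross2 (v - u) (z - u) \<le> 0)}"

context plane_graph begin

text \<open>An edge which meets the triangle \<open>u v w\<close> does not cross the sides \<open>u v\<close> and \<open>u w\<close>. Hence an end \<open>a\<close> of
  it can only be outside of the triangle if it is beyond the third side.\<close>

lemma corner:
  assumes uv: "{u, v} \<in> E" and uw: "{u, w} \<in> E" and D: "cross2 (v - u) (w - u) \<noteq> 0"
    and e: "e \<in> E" "u \<notin> e" "q \<in> convex hull e" "a \<in> e"
    and q: "0 < crd (v - u) (w - u) u q" "0 < crd (w - u) (v - u) u q"
      "crd (v - u) (w - u) u q + crd (w - u) (v - u) u q \<le> 1"
    and a: "crd (v - u) (w - u) u a + crd (w - u) (v - u) u a < 1"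
  shows "0 \<le> crd (v - u) (w - u) u a \<and> 0 \<le> crd (w - u) (v - u) u a"
proof (rule ccontr)
  define al where "al = crd (v - u) (w - u) u"
  define be where "be = crd (w - u) (v - u) u"
  have dec: "p = u + al p *\<^sub>R (v - u) + be p *\<^sub>R (w - u)" for p
    unfolding al_def be_def by (rule crd_decomp[OF D])
  assume "\<not> ?thesis"
  then have neg: "al a < 0 \<or> be a < 0" unfolding al_def be_def by linarith
  have q': "0 < al q" "0 < be q" "al q + be q \<le> 1" using q unfolding al_def be_def by auto
  obtain r where r: "0 < r" "r < 1" and rr:
    "((1 - r) * al q + r * al a = 0 \<and> 0 \<le> (1 - r) * be q + r * be a) \<or>
     ((1 - r) * be q + r * be a = 0 \<and> 0 \<le> (1 - r) * al q + r * al a)"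
    by (rule two_linear_exit[OF q'(1,2) neg])
  define P where "P = (1 - r) *\<^sub>R q + r *\<^sub>R a"
  have P: "al P = (1 - r) * al q + r * al a" "be P = (1 - r) * be q + r * be a"
    unfolding P_def al_def be_def by (rule crd_affine)+
  have "P \<in> closed_segment q a" unfolding P_def in_segment using r by (intro exI[of _ r]) auto
  also have "\<dots> \<subseteq> convex hull e" using e by (simp add: closed_segment_subset hull_inc)
  finally have Pe: "P \<in> convex hull e" .
  have "al P + be P = (1 - r) * (al q + be q) + r * (al a + be a)" unfolding P by (simp add: algebra_simps)
  also have "\<dots> < (1 - r) * 1 + r * 1"
    using r q'(3) a unfolding al_def[symmetric] be_def[symmetric]
    by (intro add_le_less_mono mult_left_mono mult_strict_left_mono) auto
  finally have lt: "al P + be P < 1" by simp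
  have no: False if x: "{u, x} \<in> E" "P = u + t *\<^sub>R (x - u)" "0 \<le> t" "t < 1" for x t
  proof -
    have "P \<in> convex hull {u, x}" using in_segment_from[of t u x] x by (simp add: hull_edge)
    moreover have "{u, x} \<noteq> e" using e(2) by auto
    ultimately have "P \<in> {u, x}" "P \<in> e" using edges_meet[OF x(1) e(1) _ _ Pe] by auto
    then have "P = x" using e(2) by auto
    then have "x - u = t *\<^sub>R (x - u)" using x(2) by (metis add_diff_cancel_left')
    then have "1 *\<^sub>R (x - u) = t *\<^sub>R (x - u)" by simp
    then show False using x(4) edge_in_V(3)[OF x(1)] unfolding scaleR_cancel_right by simp
  qed
  show False
  proof (cases "al P = 0")
    case True
    have "P = u + be P *\<^sub>R (w - u)" by (subst dec[of P]) (simp add: True)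
    moreover have "0 \<le> be P" using rr True unfolding P by linarith
    ultimately show False using no[OF uw] lt True by simp
  next
    case False
    then have b0: "be P = 0" "0 \<le> al P" using rr unfolding P by linarith+
    have "P = u + al P *\<^sub>R (v - u)" by (subst dec[of P]) (simp add: b0)
    then show False using no[OF uv] lt b0 by simp
  qed
qed

lemma triangles_rotate: "(u, v, w) \<in> triangles \<Longrightarrow> (v, w, u) \<in> triangles"
  unfolding triangles_def using cross2_rotate[of w v u] by (auto simp: insert_commute)

text \<open>The edge would end inside of the triangle or cross the side \<open>v w\<close>.\<close>

lemma no_edge_into_triangle:
  assumes t: "(u, v, w) \<in> triangles" and x: "{u, x} \<in> E"
    and pos: "0 < cross2 (v - u) (x - u)" "0 < cross2 (x - u) (w - u)"
  shows False
proof -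
  have vw: "{v, w} \<in> E" and D: "0 < cross2 (v - u) (w - u)" and hull: "V \<inter> convex hull {u, v, w} \<subseteq> {u, v, w}"
    using t by (auto simp: triangles_def)
  let ?a = "crd (v - u) (w - u) u x" and ?b = "crd (w - u) (v - u) u x"
  have ab: "0 < ?a" "0 < ?b" using crd_pos_iff[OF D] pos by auto
  have notvw: "x \<noteq> v" "x \<noteq> w" "x \<noteq> u" using pos by auto
  have "\<not> ?a + ?b \<le> 1"
  proof
    assume "?a + ?b \<le> 1"
    then have "x \<in> convex hull {u, v, w}" using in_triangle_iff[of v u w x] D ab by simp
    then show False using hull edge_in_V(2)[OF x] notvw by blast
  qed
  define t where "t = 1 / (?a + ?b)"
  have t: "0 < t" "t \<le> 1" "t * ?a + t * ?b = 1"
  proof -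
    have "1 < ?a + ?b" using \<open>\<not> ?a + ?b \<le> 1\<close> by simp
    then show "0 < t" "t \<le> 1" unfolding t_def by simp_all
    have "t * (?a + ?b) = 1" unfolding t_def using \<open>1 < ?a + ?b\<close> by (intro nonzero_eq_divide_eq[THEN iffD1]) simp_all
    then show "t * ?a + t * ?b = 1" by (simp only: distrib_left)
  qed
  define P where "P = u + t *\<^sub>R (x - u)"
  have Px: "P \<in> convex hull {u, x}" unfolding P_def hull_edge by (rule in_segment_from) (use t in auto)
  have xu: "x - u = ?a *\<^sub>R (v - u) + ?b *\<^sub>R (w - u)"
    by (rule crd_decomp_diff) (use D in simp)
  have "P = u + (t * ?a) *\<^sub>R (v - u) + (t * ?b) *\<^sub>R (w - u)"
    unfolding P_def by (subst xu) (simp add: scaleR_right_distrib)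
  also have "t * ?a = 1 - t * ?b" using t(3) by simp
  also have "u + (1 - t * ?b) *\<^sub>R (v - u) + (t * ?b) *\<^sub>R (w - u) = v + (t * ?b) *\<^sub>R (w - v)"
    by (simp add: algebra_simps)
  finally have P2: "P = v + (t * ?b) *\<^sub>R (w - v)" .
  have "0 \<le> t * ?b" "t * ?b \<le> 1"
    using t(3) mult_pos_pos[OF t(1) ab(1)] mult_pos_pos[OF t(1) ab(2)] by linarith+
  then have Pvw: "P \<in> convex hull {v, w}" unfolding P2 hull_edge by (rule in_segment_from)
  have ne: "{u, x} \<noteq> {v, w}" using notvw by auto
  have "P \<in> {u, x} \<and> P \<in> {v, w}" by (rule edges_meet[OF x vw ne Px Pvw])
  moreover have "u \<noteq> v" "u \<noteq> w" using D by auto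
  ultimately show False using notvw by auto
qed

lemma apex_unique:
  assumes t: "(u, v, w) \<in> triangles" "(u, v, w') \<in> triangles"
  shows "w = w'"
proof -
  have E: "{u, w} \<in> E" "{u, w'} \<in> E" and D: "0 < cross2 (v - u) (w - u)" "0 < cross2 (v - u) (w' - u)"
    using t by (auto simp: triangles_def insert_commute)
  have "\<not> 0 < cross2 (w' - u) (w - u)" using no_edge_into_triangle[OF t(1) E(2) D(2)] by blast
  moreover have "\<not> 0 < cross2 (w - u) (w' - u)" using no_edge_into_triangle[OF t(2) E(1) D(1)] by blast
  ultimately have "cross2 (w - u) (w' - u) = 0" using cross2_commute[of "w - u" "w' - u"] by linarith
  then show ?thesis by (rule same_direction_edges[OF E _ D])
qed

lemma finite_edge_pairs: "finite {(u, v). {u, v} \<in> E}"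
  by (rule finite_subset[of _ "V \<times> V"]) (auto dest: edge_in_V)

lemma finite_triangles: "finite triangles"
  by (rule finite_subset[of _ "V \<times> V \<times> V"]) (auto simp: triangles_def dest: edge_in_V)

lemma finite_hull_darts: "finite hull_darts"
  by (rule finite_subset[OF _ finite_edge_pairs]) (auto simp: hull_darts_def)

text \<open>Only finitely many slopes are excluded, namely those of the lines through two vertices.\<close>

lemma generic_direction:
  obtains r where "\<And>p q. p \<in> V \<Longrightarrow> q \<in> V \<Longrightarrow> p \<noteq> q \<Longrightarrow> cross2 r p \<noteq> cross2 r q"
proof -
  have "finite ((\<lambda>(p, q). (p$2 - q$2) / (p$1 - q$1)) ` (V \<times> V))" by simp
  then obtain s :: real where s: "s \<notin> (\<lambda>(p, q). (p$2 - q$2) / (p$1 - q$1)) ` (V \<times> V)"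
    using ex_new_if_finite[OF infinite_UNIV_char_0] by blast
  show thesis
  proof
    fix p q assume pq: "p \<in> V" "q \<in> V" "p \<noteq> q"
    show "cross2 (vector [1, s]) p \<noteq> cross2 (vector [1, s]) q"
    proof
      assume "cross2 (vector [1, s]) p = cross2 (vector [1, s]) q"
      then have eq: "p$2 - q$2 = s * (p$1 - q$1)" by (simp add: cross2_def algebra_simps)
      have "p$1 \<noteq> q$1" using pq(3) eq by (auto simp: vec_eq_iff forall_2)
      then have "s = (p$2 - q$2) / (p$1 - q$1)" using eq by (simp add: field_simps)
      then show False using s pq by auto
    qed
  qed
qed

text \<open>Let \<open>f\<close> be the height of a point with respect to a generic direction, so that every triangle has a
  vertex of middle height. Each vertex \<open>u\<close> offers two places, one on its left and one on its right. A
  triangle with middle vertex \<open>u\<close> takes the place on the side on which it lies, and a side of an edge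
  from \<open>u\<close> with no vertex on its left takes the place on its left. The place is determined by whether the
  edge from \<open>u\<close> goes up or down. No place is taken twice, since of two edges from \<open>u\<close> in question
  one would enter the triangle or the empty half plane to the left of the other (\<open>block\<close>). The lowest vertex
  wastes a place because no edge descends from it.\<close>

lemma card_triangles_hull_darts:
  assumes "V \<noteq> {}"
  shows "card triangles + 3 * card hull_darts + 3 \<le> 6 * card V"
proof -
  obtain r where gen: "\<And>p q. p \<in> V \<Longrightarrow> q \<in> V \<Longrightarrow> p \<noteq> q \<Longrightarrow> cross2 r p \<noteq> cross2 r q"
    using generic_direction by blast
  define f where "f = cross2 r"
  have gen': "f p \<noteq> f q" if "p \<in> V" "q \<in> V" "p \<noteq> q" for p q using gen[OF that] by (simp add: f_def)
  \<comment> \<open>each triangle once, starting from its middle vertex\<close>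
  define mid where "mid = {(u, v, w). (u, v, w) \<in> triangles \<and> (f v < f u \<and> f u < f w \<or> f w < f u \<and> f u < f v)}"
  have "mid \<subseteq> triangles" by (auto simp: mid_def)
  then have fin: "finite mid" using finite_triangles finite_subset by blast
  define rot where "rot = (\<lambda>(u::real^2, v::real^2, w::real^2). (v, w, u))"
  have "triangles \<subseteq> mid \<union> rot ` mid \<union> rot ` rot ` mid"
  proof
    fix t assume t: "t \<in> triangles"
    obtain u v w where uvw: "t = (u, v, w)" by (cases t)
    have ts: "(u, v, w) \<in> triangles" "(v, w, u) \<in> triangles" "(w, u, v) \<in> triangles"
      using t triangles_rotate unfolding uvw by blast+
    have "u \<in> V" "v \<in> V" "w \<in> V" "u \<noteq> v" "v \<noteq> w" "w \<noteq> u"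
      using ts(1) edge_in_V unfolding triangles_def by blast+
    then have "f u \<noteq> f v" "f v \<noteq> f w" "f w \<noteq> f u" using gen' by blast+
    then consider "(u, v, w) \<in> mid" | "(v, w, u) \<in> mid" | "(w, u, v) \<in> mid"
      using ts unfolding mid_def by fastforce
    then show "t \<in> mid \<union> rot ` mid \<union> rot ` rot ` mid"
    proof cases
      case 2
      then have "rot (rot (v, w, u)) \<in> rot ` rot ` mid" by blast
      then show ?thesis by (simp add: uvw rot_def)
    next
      case 3
      then have "rot (w, u, v) \<in> rot ` mid" by blast
      then show ?thesis by (simp add: uvw rot_def)
    qed (simp add: uvw)
  qed
  then have "card triangles \<le> card (mid \<union> rot ` mid \<union> rot ` rot ` mid)"
    using fin by (intro card_mono) auto
  also have "\<dots> \<le> card mid + card (rot ` mid) + card (rot ` rot ` mid)"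
    using card_Un_le[of "mid \<union> rot ` mid" "rot ` rot ` mid"] card_Un_le[of mid "rot ` mid"] by linarith
  also have "\<dots> \<le> 3 * card mid"
    using card_image_le[OF fin, of rot] card_image_le[of "rot ` mid" rot] fin by simp
  finally have T3: "card triangles \<le> 3 * card mid" .
  \<comment> \<open>the first side of a triangle, which determines it\<close>
  define base where "base = (\<lambda>(u::real^2, v::real^2, w::real^2). (u, v))"
  have inj_base: "inj_on base mid"
    unfolding inj_on_def mid_def base_def using apex_unique by auto
  have disj: "base ` mid \<inter> hull_darts = {}"
  proof -
    have "(u, v) \<notin> hull_darts" if "(u, v, w) \<in> triangles" for u v w
      using that edge_in_V(2)[of v w] unfolding triangles_def hull_darts_def by (auto simp: not_le)
    then show ?thesis unfolding mid_def base_def by auto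
  qed
  define X where "X = base ` mid \<union> hull_darts"
  have cardX: "card X = card mid + card hull_darts"
    unfolding X_def using card_Un_disjoint[OF _ finite_hull_darts disj] fin card_image[OF inj_base] by simp
  have XE: "{u, v} \<in> E" if "(u, v) \<in> X" for u v
    using that unfolding X_def base_def mid_def triangles_def hull_darts_def by auto
  have block: "\<not> 0 < cross2 (v - u) (x - u)"
    if X: "(u, v) \<in> X" and x: "{u, x} \<in> E" and side: "(f u < f v) = (f u < f x)" for u v x
  proof
    assume pos: "0 < cross2 (v - u) (x - u)"
    have "x \<in> V" "v \<in> V" "u \<in> V" "x \<noteq> u" "v \<noteq> u" using edge_in_V[OF x] edge_in_V[OF XE[OF X]] by auto
    then have ne: "f x \<noteq> f u" "f v \<noteq> f u" using gen' by auto
    have "(u, v) \<notin> hull_darts" using pos \<open>x \<in> V\<close> unfolding hull_darts_def by (auto simp: not_le)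
    then obtain w where w: "(u, v, w) \<in> mid" using X unfolding X_def base_def by auto
    then have t: "(u, v, w) \<in> triangles" and fw: "f v < f u \<and> f u < f w \<or> f w < f u \<and> f u < f v"
      by (auto simp: mid_def)
    have D: "0 < cross2 (v - u) (w - u)" using t by (simp add: triangles_def)
    have cr: "cross2 r (p - u) = f p - f u" "cross2 (p - u) r = f u - f p"
      "cross2 (- r) (p - u) = f u - f p" "cross2 (p - u) (- r) = f p - f u" for p
      using cross2_commute[of "p - u" r] by (simp_all add: f_def cross2_simps)
    have "0 < cross2 (x - u) (w - u)"
    proof (cases "f v < f u")
      case True
      then have "f x < f u" "f u < f w" using ne side fw by linarith+
      then show ?thesis using cross2_between[OF D pos, of r] True unfolding cr by simp
    next
      case False
      then have "f u < f v" "f u < f x" "f w < f u" using ne side fw by linarith+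
      then show ?thesis using cross2_between[OF D pos, of "- r"] unfolding cr by simp
    qed
    then show False using no_edge_into_triangle[OF t x pos] by blast
  qed
  define slot where "slot = (\<lambda>(u, v). (u :: real^2, f u < f v))"
  have "inj_on slot X"
  proof (rule inj_onI)
    fix p q assume p: "p \<in> X" and q: "q \<in> X" and eq: "slot p = slot q"
    obtain u v v' where uv: "p = (u, v)" "q = (u, v')" and side: "(f u < f v) = (f u < f v')"
      using eq unfolding slot_def by (cases p; cases q) auto
    have E: "{u, v} \<in> E" "{u, v'} \<in> E" using XE p q uv by auto
    have "u \<in> V" "v \<in> V" "v' \<in> V" "u \<noteq> v" "u \<noteq> v'" using edge_in_V[OF E(1)] edge_in_V[OF E(2)] by auto
    then have ne: "f u \<noteq> f v" "f u \<noteq> f v'" using gen' by auto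
    have "\<not> 0 < cross2 (v - u) (v' - u)" "\<not> 0 < cross2 (v' - u) (v - u)"
      using block[OF _ E(2), of v] block[OF _ E(1), of v'] p q uv side by auto
    then have 0: "cross2 (v - u) (v' - u) = 0" using cross2_commute[of "v - u" "v' - u"] by linarith
    have "v = v'"
    proof (cases "f u < f v")
      case True
      show ?thesis by (rule same_direction_edges[OF E 0, of r]) (use True side in \<open>simp_all add: f_def cross2_simps\<close>)
    next
      case False
      show ?thesis by (rule same_direction_edges[OF E 0, of "- r"])
        (use False side ne in \<open>simp_all add: f_def cross2_simps\<close>)
    qed
    then show "p = q" using uv by simp
  qed
  then have "card X = card (slot ` X)" by (simp add: card_image)
  obtain b where b: "b \<in> V" "\<And>x. x \<in> V \<Longrightarrow> f b \<le> f x"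
  proof -
    from ex_is_arg_min_if_finite[OF finite_V assms, of f]
    show thesis using that unfolding is_arg_min_def by (auto simp: not_less)
  qed
  have "slot ` X \<subseteq> V \<times> UNIV - {(b, False)}"
  proof
    fix s assume "s \<in> slot ` X"
    then obtain u v where uv: "(u, v) \<in> X" "s = (u, f u < f v)" unfolding slot_def by auto
    have "u \<in> V" "v \<in> V" "u \<noteq> v" using edge_in_V[OF XE[OF uv(1)]] by auto
    moreover have "f b < f v" if "u = b" using that gen'[of b v] b(2)[of v] calculation by force
    ultimately show "s \<in> V \<times> UNIV - {(b, False)}" using uv(2) by auto
  qed
  then have "card (slot ` X) \<le> card (V \<times> (UNIV :: bool set) - {(b, False)})"
    by (intro card_mono) auto
  also have "\<dots> = 2 * card V - 1" using b(1) by (simp add: card_cartesian_product card_Diff_singleton)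
  finally have "card mid + card hull_darts \<le> 2 * card V - 1"
    using cardX \<open>card X = card (slot ` X)\<close> by simp
  moreover have "card V \<ge> 1" using assms by (simp add: Suc_leI card_gt_0_iff)
  ultimately show ?thesis using T3 by linarith
qed

end

context maximal_plane_graph begin

text \<open>Let \<open>w\<close> be the neighbour of \<open>u\<close> that comes first when the edge from \<open>u\<close> to \<open>v\<close> is rotated to the left;
  it is less than half a turn away by \<open>edge_into_half_plane\<close>. If the triangle \<open>u v w\<close> contained further
  vertices, then the one nearest to \<open>u\<close>, measured in parallel to \<open>v w\<close>, could be joined to \<open>u\<close>,
  contrary to the choice of \<open>w\<close> (\<open>W0\<close>). So it contains none, and then nothing blocks the segment from \<open>v\<close> to \<open>w\<close>:
  an edge across it could neither end in the triangle nor leave it through the sides at \<open>u\<close>.\<close>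

lemma left_triangle_exists:
  assumes uv: "{u, v} \<in> E" and z: "z \<in> V" "0 < cross2 (v - u) (z - u)"
  obtains w where "(u, v, w) \<in> triangles"
proof -
  have uvV: "u \<in> V" "v \<in> V" "u \<noteq> v" using edge_in_V[OF uv] by auto
  define X where "X = {x. {u, x} \<in> E \<and> 0 < cross2 (v - u) (x - u)}"
  have "finite X" by (rule finite_subset[OF _ finite_V]) (auto simp: X_def dest: edge_in_V)
  moreover have "X \<noteq> {}" using edge_into_half_plane[OF uvV(1) z] unfolding X_def by blast
  ultimately obtain w where w: "w \<in> X" and
    wmin: "\<And>x. x \<in> X \<Longrightarrow> - ((v - u) \<bullet> (w - u)) / cross2 (v - u) (w - u) \<le> - ((v - u) \<bullet> (x - u)) / cross2 (v - u) (x - u)"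
    using ex_is_arg_min_if_finite[of X "\<lambda>x. - ((v - u) \<bullet> (x - u)) / cross2 (v - u) (x - u)"]
    unfolding is_arg_min_def by (meson not_less)
  have uw: "{u, w} \<in> E" and D: "0 < cross2 (v - u) (w - u)" using w by (auto simp: X_def)
  have wV: "w \<in> V" "u \<noteq> w" using edge_in_V[OF uw] by auto
  have first: "\<not> 0 < cross2 (x - u) (w - u)" if "x \<in> X" for x
  proof -
    have cx: "0 < cross2 (v - u) (x - u)" using that by (simp add: X_def)
    have "((v - u) \<bullet> (x - u)) * cross2 (v - u) (w - u) \<le> ((v - u) \<bullet> (w - u)) * cross2 (v - u) (x - u)"
      using wmin[OF that] cx D by (simp only: divide_minus_left neg_le_iff_le frac_le_eq) (simp add: divide_le_eq le_divide_eq mult.commute)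
    then have "((v - u) \<bullet> (v - u)) * cross2 (x - u) (w - u) \<le> 0" unfolding cross2_angle by linarith
    moreover have "0 < (v - u) \<bullet> (v - u)" using uvV(3) by simp
    ultimately show ?thesis by (simp only: mult_le_0_iff) linarith
  qed
  \<comment> \<open>coordinates with origin \<open>u\<close>; their sum is \<open>0\<close> at \<open>u\<close> and \<open>1\<close> on the line \<open>v w\<close>\<close>
  define al where "al = crd (v - u) (w - u) u"
  define be where "be = crd (w - u) (v - u) u"
  have Dne: "cross2 (v - u) (w - u) \<noteq> 0" using D by simp
  have pos: "0 < al p \<longleftrightarrow> 0 < cross2 (p - u) (w - u)" "0 < be p \<longleftrightarrow> 0 < cross2 (v - u) (p - u)" for p
    unfolding al_def be_def by (rule crd_pos_iff[OF D])+
  have dec: "p = u + al p *\<^sub>R (v - u) + be p *\<^sub>R (w - u)" for p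
    unfolding al_def be_def by (rule crd_decomp[OF Dne])
  have aff: "al ((1 - s) *\<^sub>R p + s *\<^sub>R q) = (1 - s) * al p + s * al q"
    "be ((1 - s) *\<^sub>R p + s *\<^sub>R q) = (1 - s) * be p + s * be q" for s p q
    unfolding al_def be_def by (rule crd_affine)+
  have comb: "al (u + s *\<^sub>R (v - u) + t *\<^sub>R (w - u)) = s" "be (u + s *\<^sub>R (v - u) + t *\<^sub>R (w - u)) = t" for s t
    unfolding al_def be_def using crd_comb[OF Dne] by auto
  have abu: "al u = 0" "be u = 0" using comb[of 0 0] by simp_all
  have abv: "al v = 1" "be v = 0" using comb[of 1 0] by simp_all
  have abw: "al w = 0" "be w = 1" using comb[of 0 1] by simp_all
  have inhull: "p \<in> convex hull {u, v, w} \<longleftrightarrow> 0 \<le> al p \<and> 0 \<le> be p \<and> al p + be p \<le> 1" for p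
    unfolding al_def be_def by (rule in_triangle_iff[OF Dne])
  have onside: "p \<in> {u, x}" if x: "{u, x} \<in> E" and p: "p \<in> V" "p = u + t *\<^sub>R (x - u)" "0 \<le> t" "t \<le> 1" for p x t
    using vertex_on_edge[OF x p(1)] in_segment_from[of t u x] p by (simp add: hull_edge)
  have no_cone: "\<not> (0 < al p \<and> 0 < be p)" if "{u, p} \<in> E" for p
    using first[of p] that pos unfolding X_def by blast
  have uncrossed: "al a \<ge> 0 \<and> be a \<ge> 0"
    if "e \<in> E" "u \<notin> e" "q \<in> convex hull e" "a \<in> e" "0 < al q" "0 < be q" "al q + be q \<le> 1" "al a + be a < 1" for e q a
    using corner[OF uv uw Dne that(1-4)] that(5-8) unfolding al_def be_def by blast
  define W where "W = {p \<in> V. p \<notin> {u, v, w} \<and> 0 \<le> al p \<and> 0 \<le> be p \<and> al p + be p \<le> 1}"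
  have W0: "W = {}"
  proof (rule ccontr)
    assume "W \<noteq> {}"
    moreover have "finite W" by (simp add: W_def)
    ultimately obtain z where zW: "z \<in> W" and zmin: "\<And>p. p \<in> W \<Longrightarrow> al z + be z \<le> al p + be p"
      using ex_is_arg_min_if_finite[of W "\<lambda>p. al p + be p"] unfolding is_arg_min_def by (meson not_less)
    have z: "z \<in> V" "z \<noteq> u" "z \<noteq> v" "z \<noteq> w" "0 \<le> al z" "0 \<le> be z" "al z + be z \<le> 1"
      using zW by (auto simp: W_def)
    have "al z \<noteq> 0"
    proof
      assume "al z = 0"
      then have "z = u + be z *\<^sub>R (w - u)" by (subst dec[of z]) (simp only: scaleR_zero_left add_0_right)
      then have "z \<in> {u, w}" by (rule onside[OF uw z(1)]) (use z \<open>al z = 0\<close> in simp_all)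
      then show False using z by blast
    qed
    moreover have "be z \<noteq> 0"
    proof
      assume "be z = 0"
      then have "z = u + al z *\<^sub>R (v - u)" by (subst dec[of z]) (simp only: scaleR_zero_left add_0_right)
      then have "z \<in> {u, v}" by (rule onside[OF uv z(1)]) (use z \<open>be z = 0\<close> in simp_all)
      then show False using z by blast
    qed
    ultimately have zpos: "0 < al z" "0 < be z" using z by auto
    have qz: "0 < al q \<and> 0 < be q \<and> al q + be q < al z + be z" if "q \<in> open_segment u z" for q
    proof -
      from that obtain s where s: "q = (1 - s) *\<^sub>R u + s *\<^sub>R z" "0 < s" "s < 1" unfolding in_segment by blast
      have q: "al q = s * al z" "be q = s * be z" unfolding s(1) aff abu by simp_all
      have "s * al z < 1 * al z" "s * be z < 1 * be z" using s zpos by (auto intro: mult_strict_right_mono)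
      then show ?thesis unfolding q using mult_pos_pos[OF s(2) zpos(1)] mult_pos_pos[OF s(2) zpos(2)] by linarith
    qed
    have "{u, z} \<in> E"
    proof (rule unblocked_edge)
      show "V \<inter> open_segment u z = {}"
      proof (rule ccontr)
        assume "V \<inter> open_segment u z \<noteq> {}"
        then obtain q where q: "q \<in> V" "q \<in> open_segment u z" by blast
        have "q \<in> W" unfolding W_def using q(1) qz[OF q(2)] z abu abv abw by auto
        then show False using zmin qz[OF q(2)] by fastforce
      qed
      fix e assume e: "e \<in> E" "u \<notin> e" "z \<notin> e"
      show "convex hull e \<inter> open_segment u z = {}"
      proof (rule ccontr)
        assume "convex hull e \<inter> open_segment u z \<noteq> {}"
        then obtain q where q: "q \<in> convex hull e" "q \<in> open_segment u z" by blast
        obtain a b where ab: "e = {a, b}" using edgeE[OF e(1)] by blast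
        have "q \<in> closed_segment a b" using q(1) by (simp only: ab hull_edge)
        then obtain s where s: "q = (1 - s) *\<^sub>R a + s *\<^sub>R b" "0 \<le> s" "s \<le> 1"
          unfolding in_segment by blast
        have "al q + be q = (1 - s) * (al a + be a) + s * (al b + be b)"
          unfolding s(1) aff by (simp add: algebra_simps)
        then have "al a + be a \<le> al q + be q \<or> al b + be b \<le> al q + be q"
          using s(2,3) convex_bound_lt[of "- (al a + be a)" "- (al q + be q)" "- (al b + be b)" "1 - s" s] by fastforce
        then obtain d where d: "d \<in> e" "al d + be d \<le> al q + be q" using ab by blast
        have lt: "al d + be d < al z + be z" using d(2) qz[OF q(2)] by linarith
        have "0 \<le> al d \<and> 0 \<le> be d"
          using uncrossed[OF e(1,2) q(1) d(1)] qz[OF q(2)] z lt by linarith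
        moreover have "d \<in> V" "d \<noteq> u" using d(1) e edge_sub_V by auto
        moreover have "d \<noteq> v" "d \<noteq> w" using lt z abv abw by auto
        ultimately have "d \<in> W" unfolding W_def using lt z by auto
        then show False using zmin lt by fastforce
      qed
    qed (use uvV z in auto)
    then show False using no_cone zpos by blast
  qed
  then have Whull: "p \<in> {u, v, w}" if "p \<in> V" "p \<in> convex hull {u, v, w}" for p
    using that unfolding W_def inhull by blast
  have vw: "v \<noteq> w" using abv abw by auto
  have qvw: "0 < al q \<and> 0 < be q \<and> al q + be q = 1" if "q \<in> open_segment v w" for q
  proof -
    from that obtain s where s: "q = (1 - s) *\<^sub>R v + s *\<^sub>R w" "0 < s" "s < 1" unfolding in_segment by blast
    show ?thesis unfolding s(1) aff abv abw using s by simp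
  qed
  have inV: "p \<in> V \<Longrightarrow> p \<notin> open_segment v w" for p
    using qvw[of p] Whull[of p] inhull[of p] abu abv abw by force
  have "{v, w} \<in> E"
  proof (rule unblocked_edge[OF uvV(2) wV(1) vw])
    show "V \<inter> open_segment v w = {}" using inV by blast
    fix e assume e: "e \<in> E" "v \<notin> e" "w \<notin> e"
    show "convex hull e \<inter> open_segment v w = {}"
    proof (rule ccontr)
      assume "convex hull e \<inter> open_segment v w \<noteq> {}"
      then obtain q where q: "q \<in> convex hull e" "q \<in> open_segment v w" by blast
      note q' = qvw[OF q(2)]
      obtain a b where ab: "e = {a, b}" using edgeE[OF e(1)] by blast
      have "q \<in> closed_segment a b" using q(1) by (simp only: ab hull_edge)
      then obtain s where s: "q = (1 - s) *\<^sub>R a + s *\<^sub>R b" "0 \<le> s" "s \<le> 1"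
        unfolding in_segment by blast
      have sum: "(1 - s) * (al a + be a) + s * (al b + be b) = 1"
        using q' unfolding s(1) aff by (simp add: algebra_simps)
      have "u \<notin> e"
      proof
        assume "u \<in> e"
        then obtain x where x: "e = {u, x}" using ab by blast
        then have "q \<in> closed_segment u x" using q(1) by (simp only: hull_edge)
        then obtain t where t: "q = (1 - t) *\<^sub>R u + t *\<^sub>R x" "0 \<le> t" "t \<le> 1"
          unfolding in_segment by blast
        have "al q = t * al x" "be q = t * be x" unfolding t(1) aff abu by simp_all
        then have "0 < al x \<and> 0 < be x" using q' t(2) by (auto simp: zero_less_mult_iff)
        then show False using no_cone[of x] e(1) x by blast
      qed
      show False
      proof (cases "\<exists>d\<in>e. al d + be d < 1")
        case True
        then obtain d where d: "d \<in> e" "al d + be d < 1" by blast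
        then have "0 \<le> al d \<and> 0 \<le> be d" using uncrossed[OF e(1) \<open>u \<notin> e\<close> q(1)] q' by simp
        then have "d \<in> convex hull {u, v, w}" using d(2) inhull by simp
        then have "d \<in> {u, v, w}" using Whull d(1) edge_sub_V[OF e(1)] by blast
        then show False using d(1) e(2,3) \<open>u \<notin> e\<close> by blast
      next
        case False
        define A B where "A = al a + be a" and "B = al b + be b"
        have AB: "1 \<le> A" "1 \<le> B" using False ab unfolding A_def B_def by (auto simp: not_less)
        have "(1 - s) * (A - 1) + s * (B - 1) = 0" using sum unfolding A_def[symmetric] B_def[symmetric]
          by (simp add: algebra_simps)
        moreover have "0 \<le> (1 - s) * (A - 1)" "0 \<le> s * (B - 1)" using AB s by auto
        ultimately have AB0: "(1 - s) * (A - 1) = 0" "s * (B - 1) = 0" by linarith+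
        have "a \<in> V" "b \<in> V" using ab edge_sub_V[OF e(1)] by auto
        have "s \<noteq> 0" "s \<noteq> 1" using inV[OF \<open>a \<in> V\<close>] inV[OF \<open>b \<in> V\<close>] q(2) s(1) by auto
        then have line: "al x + be x = 1" if "x \<in> e" for x using that AB0 ab unfolding A_def B_def by auto
        have par: "cross2 (q - v) (x - v) = 0" if "al x + be x = 1" for x
        proof -
          have on: "p - v = be p *\<^sub>R (w - v)" if "al p + be p = 1" for p
          proof -
            have e: "al p = 1 - be p" using that by simp
            have "p - v = (u + (1 - be p) *\<^sub>R (v - u) + be p *\<^sub>R (w - u)) - v"
              using arg_cong[OF dec[of p], of "\<lambda>z. z - v"] unfolding e .
            also have "\<dots> = be p *\<^sub>R (w - v)" by (simp add: algebra_simps)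
            finally show ?thesis .
          qed
          show ?thesis unfolding on[OF that] on[of q, OF conjunct2[OF conjunct2[OF q']]] by (simp only: cross2_simps(4,8,9) mult_zero_right)
        qed
        obtain x where x: "x \<in> e" "x \<in> closed_segment v q" "x \<noteq> v"
          by (rule collinear_edge[OF e(1) uvV(2) e(2) q(1)]) (use par line in blast)+
        have "closed_segment v q \<subseteq> closed_segment v w" using q(2)
          by (simp add: open_closed_segment subset_closed_segment)
        then have "x \<in> open_segment v w" using x e(3) unfolding open_segment_def by auto
        then show False using inV x(1) edge_sub_V[OF e(1)] by blast
      qed
    qed
  qed
  then have "(u, v, w) \<in> triangles"
    unfolding triangles_def using uv uw D Whull by (auto simp: insert_commute)
  then show thesis by (rule that)
qed

end

section \<open>Rhombic faces\<close>

definition open_rhombus :: "real ^ 2 \<Rightarrow> real ^ 2 \<Rightarrow> real ^ 2 \<Rightarrow> (real ^ 2) set" where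
  "open_rhombus p d w = {x. 0 < crd d w p x \<and> crd d w p x < 1 \<and> 0 < crd w d p x \<and> crd w d p x < 1}"

definition closed_rhombus :: "real ^ 2 \<Rightarrow> real ^ 2 \<Rightarrow> real ^ 2 \<Rightarrow> (real ^ 2) set" where
  "closed_rhombus p d w = {x. 0 \<le> crd d w p x \<and> crd d w p x \<le> 1 \<and> 0 \<le> crd w d p x \<and> crd w d p x \<le> 1}"

lemma crd_rotate:
  assumes "cross2 d w \<noteq> 0"
  shows "crd w (- d) (p + d) x = crd w d p x" "crd (- d) w (p + d) x = 1 - crd d w p x"
proof -
  have 1: "cross2 (x - (p + d)) (- d) = - cross2 (x - p) d" "cross2 w (- d) = - cross2 w d"
    "cross2 (x - (p + d)) w = cross2 (x - p) w - cross2 d w" "cross2 (- d) w = - cross2 d w"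
    by (simp_all add: cross2_simps algebra_simps)
  show "crd w (- d) (p + d) x = crd w d p x"
    unfolding crd_def 1 by (rule minus_divide_divide)
  show "crd (- d) w (p + d) x = 1 - crd d w p x"
    unfolding crd_def 1 using assms by (simp add: diff_divide_distrib)
qed

lemma rhombus_rotate:
  assumes "cross2 d w \<noteq> 0"
  shows "open_rhombus (p + d) w (- d) = open_rhombus p d w"
    "closed_rhombus (p + d) w (- d) = closed_rhombus p d w"
  unfolding open_rhombus_def closed_rhombus_def crd_rotate[OF assms] by auto

lemma continuous_on_crd: "continuous_on S (crd a b u)"
  unfolding crd_def divide_inverse by (intro continuous_intros)

lemma open_open_rhombus: "open (open_rhombus p d w)"
  unfolding open_rhombus_def
  by (intro open_Collect_conj open_Collect_less continuous_on_crd continuous_on_const)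

lemma closed_closed_rhombus: "closed (closed_rhombus p d w)"
  unfolding closed_rhombus_def
  by (intro closed_Collect_conj closed_Collect_le continuous_on_crd continuous_on_const)

lemma frontier_open_rhombus: "frontier (open_rhombus p d w) \<subseteq> closed_rhombus p d w - open_rhombus p d w"
proof -
  have "open_rhombus p d w \<subseteq> closed_rhombus p d w" unfolding open_rhombus_def closed_rhombus_def by auto
  then have "closure (open_rhombus p d w) \<subseteq> closed_rhombus p d w"
    by (rule closure_minimal[OF _ closed_closed_rhombus])
  then show ?thesis unfolding frontier_def interior_open[OF open_open_rhombus] by blast
qed

lemma in_open_rhombus:
  assumes "cross2 d w \<noteq> 0"
  shows "p + s *\<^sub>R d + t *\<^sub>R w \<in> open_rhombus p d w \<longleftrightarrow> 0 < s \<and> s < 1 \<and> 0 < t \<and> t < 1"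
  unfolding open_rhombus_def mem_Collect_eq crd_comb[OF assms] by blast

lemma in_closed_rhombus:
  assumes "cross2 d w \<noteq> 0"
  shows "p + s *\<^sub>R d + t *\<^sub>R w \<in> closed_rhombus p d w \<longleftrightarrow> 0 \<le> s \<and> s \<le> 1 \<and> 0 \<le> t \<and> t \<le> 1"
  unfolding closed_rhombus_def mem_Collect_eq crd_comb[OF assms] by blast

lemma convex_open_rhombus: "convex (open_rhombus p d w)"
  unfolding convex_alt
proof (intro ballI allI impI)
  fix x y :: "real ^ 2" and u :: real
  assume xy: "x \<in> open_rhombus p d w" "y \<in> open_rhombus p d w" and u: "0 \<le> u \<and> u \<le> 1"
  have *: "0 < (1 - u) * a + u * b \<and> (1 - u) * a + u * b < 1"
    if "0 < a" "a < 1" "0 < b" "b < 1" for a b :: real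
    using convex_bound_lt[of a 1 b "1 - u" u] convex_bound_lt[of "- a" 0 "- b" "1 - u" u] that u by simp
  show "(1 - u) *\<^sub>R x + u *\<^sub>R y \<in> open_rhombus p d w"
    using xy *[of "crd d w p x" "crd d w p y"] *[of "crd w d p x" "crd w d p y"]
    unfolding open_rhombus_def mem_Collect_eq crd_affine by blast
qed

text \<open>The limit of positive values; used to pass from an open rhombus to its corners.\<close>

lemma affine_pos_imp_nonneg:
  fixes A B :: real
  assumes "\<And>s. 0 < s \<Longrightarrow> s < 1 \<Longrightarrow> 0 < A + s * B"
  shows "0 \<le> A"
proof (rule ccontr)
  assume "\<not> 0 \<le> A"
  moreover have "0 < A + (1/2) * B" by (rule assms) simp_all
  ultimately have "0 < - A" "0 < B" "- A < B" by linarith+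
  then have B: "0 < B" "0 < - A / B" "- A / B < 1" by (simp_all only: divide_less_eq_1_pos divide_pos_pos)
  have "A + (- A / B) * B = 0" using B by simp
  then show False using assms[OF B(2,3)] by simp
qed

locale matchstick = plane_graph +
  assumes unit: "\<And>u v. {u, v} \<in> E \<Longrightarrow> dist u v = 1"
    and no_triangle: "\<And>a b c. {a, b} \<in> E \<Longrightarrow> {b, c} \<in> E \<Longrightarrow> {a, c} \<in> E \<Longrightarrow> False"
begin

text \<open>A rhombic face together with one of its corners \<open>p\<close>; \<open>d\<close> and \<open>w\<close> lead along its sides at \<open>p\<close>, in
  counterclockwise order. Every face occurs four times, once for each of its sides: it lies to the left
  of the side from \<open>p\<close> in direction \<open>d\<close>.\<close>

definition corners :: "((real ^ 2) \<times> (real ^ 2) \<times> (real ^ 2)) set" where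
  "corners = {(p, d, w). 0 < cross2 d w \<and> {p, p + d} \<in> E \<and> {p, p + w} \<in> E \<and>
     {p + d, p + d + w} \<in> E \<and> {p + w, p + d + w} \<in> E \<and>
     V \<inter> closed_rhombus p d w \<subseteq> {p, p + d, p + w, p + d + w}}"

lemma cornersD:
  assumes "(p, d, w) \<in> corners"
  shows "0 < cross2 d w" "{p, p + d} \<in> E" "{p, p + w} \<in> E" "{p + d, p + d + w} \<in> E" "{p + w, p + d + w} \<in> E"
    "\<And>x. x \<in> V \<Longrightarrow> x \<in> closed_rhombus p d w \<Longrightarrow> x \<in> {p, p + d, p + w, p + d + w}"
  using assms unfolding corners_def by blast+

lemma corners_rotate:
  assumes "(p, d, w) \<in> corners"
  shows "(p + d, w, - d) \<in> corners"
proof -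
  note c = cornersD[OF assms]
  have D: "cross2 d w \<noteq> 0" using c(1) by simp
  have "0 < cross2 w (- d)" using c(1) cross2_commute[of w "- d"] by (simp add: cross2_simps)
  moreover have "p + d + - d = p" "p + d + w + - d = p + w" by simp_all
  moreover have "V \<inter> closed_rhombus (p + d) w (- d) \<subseteq> {p + d, p + d + w, p, p + w}"
    unfolding rhombus_rotate(2)[OF D] using c(6) by blast
  ultimately show ?thesis unfolding corners_def using c(2-5) by (simp add: insert_commute)
qed

lemma no_diagonal:
  assumes "(p, d, w) \<in> corners"
  shows "{p, p + d + w} \<notin> E" "{p + d, p + w} \<notin> E"
  using cornersD[OF assms] no_triangle[of p "p + d" "p + d + w"] no_triangle[of "p + d" p "p + w"]
  by (auto simp: insert_commute)

lemma rhombus_side: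
  assumes c: "(p, d, w) \<in> corners" and x: "x \<in> closed_rhombus p d w" "x \<notin> open_rhombus p d w"
  obtains g where "g \<in> E" "x \<in> convex hull g" "g \<subseteq> {p, p + d, p + w, p + d + w}"
proof -
  note cD = cornersD[OF c]
  have D: "cross2 d w \<noteq> 0" using cD(1) by simp
  define s t where "s = crd d w p x" and "t = crd w d p x"
  have xe: "x = p + s *\<^sub>R d + t *\<^sub>R w" unfolding s_def t_def by (rule crd_decomp[OF D])
  have st: "0 \<le> s" "s \<le> 1" "0 \<le> t" "t \<le> 1" "\<not> (0 < s \<and> s < 1 \<and> 0 < t \<and> t < 1)"
    using x unfolding xe in_open_rhombus[OF D] in_closed_rhombus[OF D] by auto
  have seg: "q + r *\<^sub>R a \<in> convex hull {q, q + a}" if "0 \<le> r" "r \<le> 1" for q a :: "real ^ 2" and r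
    using in_segment_from[OF that, of q "q + a"] by (simp add: hull_edge)
  consider "s = 0" | "s = 1" | "t = 0" | "t = 1" using st by linarith
  then show thesis
  proof cases
    case 1
    then have "x = p + t *\<^sub>R w" using xe by simp
    then show thesis using that[OF cD(3)] seg st by auto
  next
    case 2
    then have "x = (p + d) + t *\<^sub>R w" using xe by simp
    then show thesis using that[OF cD(4)] seg[OF st(3,4), of "p + d" w] by auto
  next
    case 3
    then have "x = p + s *\<^sub>R d" using xe by simp
    then show thesis using that[OF cD(2)] seg st by auto
  next
    case 4
    then have "x = (p + w) + s *\<^sub>R d" using xe by (simp add: algebra_simps)
    moreover have eq: "p + w + d = p + d + w" by (simp add: add_ac)
    ultimately have "x \<in> convex hull {p + w, p + d + w}" using seg[OF st(1,2), of "p + w" d, unfolded eq] by blast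
    then show thesis by (rule that[OF cD(5)]) blast
  qed
qed

text \<open>An edge that meets the open rhombus has no end in it and does not cross its sides, so both of its ends
  are corners. It is not a side, so it would be a diagonal, which forms a triangle with two sides.\<close>

lemma edge_avoids_rhombus:
  assumes c: "(p, d, w) \<in> corners" and e: "e \<in> E" and m: "m \<in> convex hull e"
  shows "m \<notin> open_rhombus p d w"
proof
  assume mo: "m \<in> open_rhombus p d w"
  note cD = cornersD[OF c]
  have D: "cross2 d w \<noteq> 0" using cD(1) by simp
  let ?C = "{p, p + d, p + w, p + d + w}"
  have corner_not: "x \<notin> open_rhombus p d w" if "x \<in> ?C" for x
    using that in_open_rhombus[OF D, of p 0 0] in_open_rhombus[OF D, of p 1 0]
      in_open_rhombus[OF D, of p 0 1] in_open_rhombus[OF D, of p 1 1] by auto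
  have sub: "open_rhombus p d w \<subseteq> closed_rhombus p d w" unfolding open_rhombus_def closed_rhombus_def by auto
  have V_not: "x \<notin> open_rhombus p d w" if "x \<in> V" for x
    using cD(6)[OF that] corner_not sub by blast
  have side_not: "e \<noteq> {q, q'}"
    if q: "q = p + i *\<^sub>R d + j *\<^sub>R w" "q' = p + i' *\<^sub>R d + j' *\<^sub>R w"
      and ij: "i' = i \<and> i \<in> {0, 1} \<or> j' = j \<and> j \<in> {0, 1}" for q q' i j i' j'
  proof
    assume "e = {q, q'}"
    then have "m \<in> closed_segment q q'" using m by (simp only: hull_edge)
    then obtain t where t: "m = (1 - t) *\<^sub>R q + t *\<^sub>R q'" unfolding in_segment by blast
    have "m = p + ((1 - t) * i + t * i') *\<^sub>R d + ((1 - t) * j + t * j') *\<^sub>R w"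
      unfolding t q by (simp add: algebra_simps)
    then have *: "0 < (1 - t) * i + t * i' \<and> (1 - t) * i + t * i' < 1 \<and> 0 < (1 - t) * j + t * j' \<and> (1 - t) * j + t * j' < 1"
      using mo in_open_rhombus[OF D] by simp
    from ij show False
    proof
      assume "i' = i \<and> i \<in> {0, 1}"
      then have "i' = i" "(1 - t) * i + t * i' = i" "i = 0 \<or> i = 1" by (auto simp: algebra_simps)
      then show False using * by auto
    next
      assume "j' = j \<and> j \<in> {0, 1}"
      then have "j' = j" "(1 - t) * j + t * j' = j" "j = 0 \<or> j = 1" by (auto simp: algebra_simps)
      then show False using * by auto
    qed
  qed
  have not_side: "e \<noteq> {p, p + d}" "e \<noteq> {p, p + w}" "e \<noteq> {p + d, p + d + w}" "e \<noteq> {p + w, p + d + w}"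
  proof -
    show "e \<noteq> {p, p + d}" by (rule side_not[of _ 0 0 _ 1 0]) simp_all
    show "e \<noteq> {p, p + w}" by (rule side_not[of _ 0 0 _ 0 1]) simp_all
    show "e \<noteq> {p + d, p + d + w}" by (rule side_not[of _ 1 0 _ 1 1]) simp_all
    show "e \<noteq> {p + w, p + d + w}" by (rule side_not[of _ 0 1 _ 1 1]) simp_all
  qed
  have two_corners: False if xy: "e = {x, y}" "x \<noteq> y" and C: "x \<in> ?C" "y \<in> ?C" for x y
  proof -
    have "{x, y} \<in> {{p, p + d}, {p, p + w}, {p + d, p + d + w}, {p + w, p + d + w}, {p, p + d + w}, {p + d, p + w}}"
      using C xy(2) by (elim insertE emptyE) (simp_all only: doubleton_eq_iff insert_iff simp_thms)
    then have "e = {p, p + d} \<or> e = {p, p + w} \<or> e = {p + d, p + d + w} \<or> e = {p + w, p + d + w} \<or>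
        e = {p, p + d + w} \<or> e = {p + d, p + w}"
      unfolding xy(1) by (simp only: insert_iff empty_iff simp_thms)
    then have "e = {p, p + d + w} \<or> e = {p + d, p + w}" by (simp only: not_side simp_thms)
    then show False using no_diagonal[OF c] e by (elim disjE) (simp_all only: simp_thms)
  qed
  have end_corner: "x \<in> ?C" if xy: "e = {x, y}" for x y
  proof -
    have xyV: "x \<in> V" "y \<in> V" using edge_sub_V[OF e] xy by auto
    have seg: "closed_segment m x \<subseteq> convex hull e"
      using m xy by (simp add: closed_segment_subset hull_inc)
    have "closed_segment m x \<inter> frontier (open_rhombus p d w) \<noteq> {}"
    proof (rule connected_Int_frontier)
      show "closed_segment m x \<inter> open_rhombus p d w \<noteq> {}" using mo by auto
      show "closed_segment m x - open_rhombus p d w \<noteq> {}" using V_not[OF xyV(1)] by auto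
    qed simp
    then obtain b where b: "b \<in> closed_segment m x" "b \<in> closed_rhombus p d w" "b \<notin> open_rhombus p d w"
      using frontier_open_rhombus by blast
    obtain g where g: "g \<in> E" "b \<in> convex hull g" "g \<subseteq> ?C" by (rule rhombus_side[OF c b(2,3)])
    have "b \<in> e \<and> b \<in> ?C"
    proof (cases "e = g")
      case True
      \<comment> \<open>impossible, as both ends of \<open>g\<close> are corners\<close>
      obtain x' y' where x'y': "e = {x', y'}" "x' \<noteq> y'" by (rule edgeE[OF e])
      then have False using two_corners[OF x'y'] True g(3) by blast
      then show ?thesis ..
    next
      case False
      have "b \<in> convex hull e" using b(1) seg by blast
      then show ?thesis using edges_meet[OF e g(1) False _ g(2)] g(3) by blast
    qed
    then have bxy: "b = x \<or> b = y" and bC: "b \<in> ?C" using xy by auto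
    have "b \<noteq> y \<or> x = y"
    proof (rule ccontr)
      assume "\<not> ?thesis"
      then have "y \<in> closed_segment m x" using b(1) by blast
      then have 1: "dist m x = dist m y + dist y x"
        using between_mem_segment[of m x y] between[of m x y] by simp
      have "m \<in> closed_segment x y" using m xy by (simp only: hull_edge)
      then have "dist x y = dist x m + dist m y"
        using between_mem_segment[of x y m] between[of x y m] by simp
      then have "dist m y = 0" using 1 zero_le_dist[of m y] dist_commute[of x m] dist_commute[of x y] by linarith
      then have "m = y" by simp
      then show False using V_not[OF xyV(2)] mo by simp
    qed
    then show "x \<in> ?C" using bxy bC by auto
  qed
  obtain x y where xy: "e = {x, y}" "x \<noteq> y" by (rule edgeE[OF e])
  have "e = {y, x}" using xy(1) by (simp add: insert_commute)
  then show False using two_corners[OF xy] end_corner xy(1) by blast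
qed

text \<open>The corner is the limit of points on the diagonal of its own open rhombus.\<close>

lemma corner_in_closed:
  assumes c: "(q, w, b) \<in> corners" and sub: "open_rhombus q w b \<subseteq> open_rhombus p d a"
  shows "q \<in> closed_rhombus p d a"
proof -
  have D: "cross2 w b \<noteq> 0" using cornersD(1)[OF c] by simp
  have "q + s *\<^sub>R w + s *\<^sub>R b \<in> open_rhombus p d a" if "0 < s" "s < 1" for s
    using in_open_rhombus[OF D, of q s s] that sub by blast
  moreover have "crd v v' p (q + s *\<^sub>R w + s *\<^sub>R b) = crd v v' p q + s * (crd v v' 0 (w + b))" for s v v'
    unfolding crd_def by (simp add: cross2_simps add_divide_distrib diff_divide_distrib algebra_simps)
  ultimately have *: "0 < crd d a p q + s * crd d a 0 (w + b)" "0 < (1 - crd d a p q) + s * - crd d a 0 (w + b)"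
     "0 < crd a d p q + s * crd a d 0 (w + b)" "0 < (1 - crd a d p q) + s * - crd a d 0 (w + b)"
    if "0 < s" "s < 1" for s
    using that unfolding open_rhombus_def by fastforce+
  show ?thesis
    using affine_pos_imp_nonneg[OF *(1)] affine_pos_imp_nonneg[OF *(2)]
      affine_pos_imp_nonneg[OF *(3)] affine_pos_imp_nonneg[OF *(4)]
    unfolding closed_rhombus_def by simp
qed

text \<open>If the second rhombus were not contained in the first one, it would meet a side of it. So it is
  contained in it, and its corners, being vertices, are corners of the first one. Hence the faces agree,
  and the sign of \<open>cross2 d w\<close> leaves only one way in which the second triple can be rotated.\<close>

lemma rhombi_overlap:
  assumes c: "(p, d, a) \<in> corners" and c': "(q, w, b) \<in> corners"
    and x: "x \<in> open_rhombus p d a" "x \<in> open_rhombus q w b" and dw: "0 < cross2 d w"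
  shows "a = w \<and> q = p + d \<and> b = - d"
proof -
  note cD = cornersD[OF c] and cD' = cornersD[OF c']
  have D: "0 < cross2 d a" and D': "cross2 w b \<noteq> 0" "0 < cross2 w b" using cD(1) cD'(1) by auto
  have sub: "open_rhombus q w b \<subseteq> open_rhombus p d a"
  proof (rule ccontr)
    assume "\<not> ?thesis"
    then have "open_rhombus q w b \<inter> frontier (open_rhombus p d a) \<noteq> {}"
      using x by (intro connected_Int_frontier convex_connected convex_open_rhombus) blast+
    then obtain y where y: "y \<in> open_rhombus q w b" "y \<in> closed_rhombus p d a" "y \<notin> open_rhombus p d a"
      using frontier_open_rhombus by blast
    obtain g where "g \<in> E" "y \<in> convex hull g" by (rule rhombus_side[OF c y(2,3)])
    then show False using edge_avoids_rhombus[OF c'] y(1) by blast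
  qed
  let ?C = "{p, p + d, p + a, p + d + a}"
  have q1: "q \<in> ?C" using corner_in_closed[OF c' sub] cD(6) edge_in_V(1)[OF cD'(2)] by blast
  have q2: "q + w \<in> ?C"
    using corner_in_closed[OF corners_rotate[OF c'], unfolded rhombus_rotate[OF D'(1)], OF sub]
      cD(6) edge_in_V(2)[OF cD'(2)] by blast
  have q3: "q + b \<in> ?C"
  proof -
    have "cross2 w b = cross2 b (- w)" "cross2 w b = cross2 (- w) (- b)"
      using cross2_commute[of b "- w"] by (simp_all add: cross2_simps)
    then have D2: "cross2 b (- w) \<noteq> 0" "cross2 (- w) (- b) \<noteq> 0" using D' by simp_all
    have "(q + w + b + - w, - b, - (- w)) \<in> corners"
      by (intro corners_rotate c')
    moreover have "open_rhombus (q + w + b + - w) (- b) (- (- w)) = open_rhombus q w b"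
      by (simp only: rhombus_rotate[OF D2(2)] rhombus_rotate[OF D2(1)] rhombus_rotate[OF D'(1)])
    ultimately have "q + w + b + - w \<in> closed_rhombus p d a" using corner_in_closed sub by simp
    then have "q + b \<in> closed_rhombus p d a" by simp
    then show ?thesis using cD(6) edge_in_V(2)[OF cD'(3)] by blast
  qed
  have diag: "{q, q + w} \<noteq> {p, p + d + a}" "{q, q + w} \<noteq> {p + d, p + a}"
    "{q, q + b} \<noteq> {p, p + d + a}" "{q, q + b} \<noteq> {p + d, p + a}"
    using no_diagonal[OF c] cD'(2,3) by auto
  have ad: "cross2 a d = - cross2 d a" by (rule cross2_commute)
  have coord: "\<exists>i j. (i = 0 \<or> i = 1) \<and> (j = 0 \<or> j = 1) \<and> x = p + i *\<^sub>R d + j *\<^sub>R a" if "x \<in> ?C" for x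
  proof -
    have "x = p + 0 *\<^sub>R d + 0 *\<^sub>R a \<or> x = p + 1 *\<^sub>R d + 0 *\<^sub>R a \<or> x = p + 0 *\<^sub>R d + 1 *\<^sub>R a \<or>
        x = p + 1 *\<^sub>R d + 1 *\<^sub>R a"
      using that by simp
    then show ?thesis by blast
  qed
  obtain i j where ij: "i = 0 \<or> i = 1" "j = 0 \<or> j = 1" "q = p + i *\<^sub>R d + j *\<^sub>R a"
    using coord[OF q1] by blast
  obtain i1 j1 where ij1: "i1 = 0 \<or> i1 = 1" "j1 = 0 \<or> j1 = 1" "q + w = p + i1 *\<^sub>R d + j1 *\<^sub>R a"
    using coord[OF q2] by blast
  obtain i2 j2 where ij2: "i2 = 0 \<or> i2 = 1" "j2 = 0 \<or> j2 = 1" "q + b = p + i2 *\<^sub>R d + j2 *\<^sub>R a"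
    using coord[OF q3] by blast
  have w: "w = (i1 - i) *\<^sub>R d + (j1 - j) *\<^sub>R a"
    using arg_cong[OF ij1(3), of "\<lambda>z. z - q"] unfolding ij(3) by (simp add: algebra_simps)
  have b: "b = (i2 - i) *\<^sub>R d + (j2 - j) *\<^sub>R a"
    using arg_cong[OF ij2(3), of "\<lambda>z. z - q"] unfolding ij(3) by (simp add: algebra_simps)
  have "cross2 d w = (j1 - j) * cross2 d a" unfolding w by (simp add: cross2_simps)
  then have "0 < j1 - j" using dw D by (simp add: zero_less_mult_iff)
  then have j: "j = 0" "j1 = 1" using ij(2) ij1(2) by auto
  have "i1 = i"
  proof (rule ccontr)
    assume "i1 \<noteq> i"
    then consider "i = 0" "i1 = 1" | "i = 1" "i1 = 0" using ij(1) ij1(1) by blast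
    then show False
    proof cases
      case 1
      have "{q, q + w} = {p, p + d + a}" unfolding ij1(3) unfolding ij(3) by (simp add: 1 j)
      then show False using diag(1) by blast
    next
      case 2
      have "{q, q + w} = {p + d, p + a}" unfolding ij1(3) unfolding ij(3) by (simp add: 2 j)
      then show False using diag(2) by blast
    qed
  qed
  then have wa: "w = a" using w j by simp
  have "cross2 w b = (i2 - i) * - cross2 d a" unfolding wa b ad[symmetric] by (simp add: cross2_simps)
  then have "0 < - (i2 - i)" using D'(2) D by (simp add: zero_less_mult_iff mult_less_0_iff)
  then have i: "i = 1" "i2 = 0" using ij(1) ij2(1) by auto
  have "j2 = 0"
  proof (rule ccontr)
    assume "j2 \<noteq> 0"
    then have "j2 = 1" using ij2(2) by blast
    then have "{q, q + b} = {p + d, p + a}" unfolding ij2(3) unfolding ij(3) by (simp add: i j)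
    then show False using diag(4) by blast
  qed
  then show ?thesis using wa b ij(3) i j by simp
qed

text \<open>Otherwise one of the sides in directions \<open>w\<close> and \<open>w'\<close> would enter the rhombus of the other.\<close>

lemma corner_unique:
  assumes c: "(p, d, w) \<in> corners" "(p, d, w') \<in> corners"
  shows "w = w'"
proof -
  have main: "\<not> 0 < cross2 w' w" if c: "(p, d, w) \<in> corners" "(p, d, w') \<in> corners" for w w'
  proof
    assume pos: "0 < cross2 w' w"
    note cD = cornersD[OF c(1)] and cD' = cornersD[OF c(2)]
    have D: "cross2 d w \<noteq> 0" using cD(1) by simp
    define A B where "A = crd d w 0 w'" and "B = crd w d 0 w'"
    have AB: "0 < A" "0 < B" using crd_pos_iff[OF cD(1), of 0 w'] pos cD'(1) unfolding A_def B_def by simp_all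
    have w': "w' = A *\<^sub>R d + B *\<^sub>R w" using crd_decomp[OF D, of w' 0] unfolding A_def B_def by simp
    define t where "t = 1 / (1 + A + B)"
    have t: "0 < t" "t < 1" "t * A < 1" "t * B < 1" using AB unfolding t_def by (simp_all add: divide_simps)
    have "p + (t * A) *\<^sub>R d + (t * B) *\<^sub>R w \<in> open_rhombus p d w"
      using in_open_rhombus[OF D] t AB by simp
    moreover have "p + (t * A) *\<^sub>R d + (t * B) *\<^sub>R w = p + t *\<^sub>R ((p + w') - p)"
      unfolding w' by (simp add: algebra_simps)
    moreover have "p + t *\<^sub>R ((p + w') - p) \<in> convex hull {p, p + w'}"
      unfolding hull_edge by (rule in_segment_from) (use t in auto)
    ultimately show False using edge_avoids_rhombus[OF c(1) cD'(3)] by metis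
  qed
  have "cross2 w w' = 0" using main[OF c] main[OF c(2,1)] cross2_commute[of w w'] by linarith
  then have "p + w = p + w'"
    using same_direction_edges[OF cornersD(3)[OF c(1)] cornersD(3)[OF c(2)], of d]
      cornersD(1)[OF c(1)] cornersD(1)[OF c(2)] by simp
  then show ?thesis by simp
qed

end

section \<open>Strips of rhombi\<close>

text \<open>Read \<open>\<kappa>\<close> as the lower border of a band of height \<open>c\<close> over the interval from \<open>x0\<close> to \<open>x1\<close>, continued by
  constants on both sides, and \<open>t\<close> as the height of the moving point \<open>(\<tau> t, t)\<close>, which rises all the time.
  The point cannot get from above the band to below it. It does not pass through the band, and to pass
  beside it would have to descend relative to a constant.\<close>

lemma no_return:
  fixes \<tau> \<kappa> :: "real \<Rightarrow> real"
  assumes t: "t1 \<le> t2" and c: "0 < c" and cont: "continuous_on {t1..t2} (\<lambda>t. \<kappa> (\<tau> t))" "continuous_on {t1..t2} \<tau>"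
    and \<kappa>: "\<And>x. x \<le> x0 \<Longrightarrow> \<kappa> x = \<kappa> x0" "\<And>x. x1 \<le> x \<Longrightarrow> \<kappa> x = \<kappa> x1" and x01: "x0 \<le> x1"
    and start: "c \<le> t1 - \<kappa> (\<tau> t1)" and stop: "t2 - \<kappa> (\<tau> t2) \<le> 0"
    and gap: "\<And>t. t1 \<le> t \<Longrightarrow> t \<le> t2 \<Longrightarrow> x0 \<le> \<tau> t \<Longrightarrow> \<tau> t \<le> x1 \<Longrightarrow> 0 < t - \<kappa> (\<tau> t) \<Longrightarrow> t - \<kappa> (\<tau> t) < c \<Longrightarrow> False"
  shows False
proof -
  define \<phi> where "\<phi> t = t - \<kappa> (\<tau> t)" for t
  have cphi: "continuous_on {t1..t2} \<phi>" unfolding \<phi>_def by (intro continuous_intros cont)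
  have comp: "compact ({a..t2} \<inter> \<phi> -` T)" if "closed T" "t1 \<le> a" for a T
  proof -
    have "closed ({a..t2} \<inter> \<phi> -` T)"
      by (rule continuous_closed_preimage[OF continuous_on_subset[OF cphi]]) (use that in auto)
    moreover have "bounded ({a..t2} \<inter> \<phi> -` T)" by (rule bounded_subset[of "{a..t2}"]) auto
    ultimately show ?thesis by (simp add: compact_eq_bounded_closed)
  qed
  have "t1 \<in> {t1..t2} \<inter> \<phi> -` {c..}" using t start by (simp add: \<phi>_def)
  then have "{t1..t2} \<inter> \<phi> -` {c..} \<noteq> {}" by blast
  then obtain ta where ta: "ta \<in> {t1..t2} \<inter> \<phi> -` {c..}" and tamax: "\<And>t. t \<in> {t1..t2} \<inter> \<phi> -` {c..} \<Longrightarrow> t \<le> ta"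
    using compact_attains_sup[OF comp[OF closed_atLeast order_refl]] by meson
  have "t2 \<in> {ta..t2} \<inter> \<phi> -` {..0}" using ta stop by (simp add: \<phi>_def)
  then have "{ta..t2} \<inter> \<phi> -` {..0} \<noteq> {}" by blast
  moreover have "t1 \<le> ta" using ta by simp
  ultimately obtain tb where tb: "tb \<in> {ta..t2} \<inter> \<phi> -` {..0}" and tbmin: "\<And>t. t \<in> {ta..t2} \<inter> \<phi> -` {..0} \<Longrightarrow> tb \<le> t"
    using compact_attains_inf[OF comp[OF closed_atMost]] by meson
  have le: "t1 \<le> ta" "ta \<le> tb" "tb \<le> t2" "c \<le> \<phi> ta" "\<phi> tb \<le> 0" using ta tb by auto
  have between: "0 < \<phi> t \<and> \<phi> t < c" if "ta < t" "t < tb" for t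
    using tamax[of t] tbmin[of t] that le by force
  have outside: "\<tau> t < x0 \<or> x1 < \<tau> t" if "ta < t" "t < tb" for t
  proof (rule ccontr)
    assume "\<not> ?thesis"
    then have "x0 \<le> \<tau> t" "\<tau> t \<le> x1" by auto
    moreover have "t1 \<le> t" "t \<le> t2" using that le by auto
    ultimately show False using gap[of t] between[OF that] unfolding \<phi>_def by blast
  qed
  \<comment> \<open>between \<open>ta\<close> and \<open>tb\<close> the point stays on one side of the interval, where \<open>\<kappa>\<close> is constant\<close>
  have inc: "\<phi> s < \<phi> s'" if s: "ta < s" "s < s'" "s' < tb" for s s'
  proof -
    have conn: "connected (\<tau> ` {s..s'})"
      by (rule connected_continuous_image[OF continuous_on_subset[OF cont(2)]]) (use s le in auto)
    have "(\<tau> s < x0 \<and> \<tau> s' < x0) \<or> (x1 < \<tau> s \<and> x1 < \<tau> s')"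
    proof (rule ccontr)
      assume "\<not> ?thesis"
      then have "(\<tau> s < x0 \<and> x1 < \<tau> s') \<or> (x1 < \<tau> s \<and> \<tau> s' < x0)"
        using outside[of s] outside[of s'] s by linarith
      then have "x0 \<in> \<tau> ` {s..s'}"
        using connectedD_interval[OF conn, of "\<tau> s" "\<tau> s'" x0] connectedD_interval[OF conn, of "\<tau> s'" "\<tau> s" x0]
          s x01 by auto
      then obtain v where "s \<le> v" "v \<le> s'" "\<tau> v = x0" by auto
      then show False using outside[of v] s x01 by simp
    qed
    then have "\<kappa> (\<tau> s) = \<kappa> (\<tau> s')"
      using \<kappa>(1)[of "\<tau> s"] \<kappa>(1)[of "\<tau> s'"] \<kappa>(2)[of "\<tau> s"] \<kappa>(2)[of "\<tau> s'"] by linarith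
    then show ?thesis using s unfolding \<phi>_def by simp
  qed
  have "\<exists>s. ta \<le> s \<and> s \<le> tb \<and> \<phi> s = 2 * c / 3"
    by (rule IVT2') (use le c continuous_on_subset[OF cphi] in auto)
  then obtain s where s: "ta \<le> s" "s \<le> tb" "\<phi> s = 2 * c / 3" by blast
  have "\<exists>s'. s \<le> s' \<and> s' \<le> tb \<and> \<phi> s' = c / 3"
    by (rule IVT2') (use le c s continuous_on_subset[OF cphi] in auto)
  then obtain s' where s': "s \<le> s'" "s' \<le> tb" "\<phi> s' = c / 3" by blast
  have "ta \<noteq> s" "s \<noteq> s'" "s' \<noteq> tb" using s s' le c by auto
  then have "\<phi> s < \<phi> s'" using s s' by (intro inc) auto
  then show False using s s' c by simp
qed

context matchstick begin

text \<open>A side of an edge is represented by the pair of its starting point \<open>p\<close> and its vector \<open>d\<close>; it is meant to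
  be the left one. A step leads through the rhombus on this side to the left side of the opposite edge.\<close>

definition strip_step :: "(((real ^ 2) \<times> (real ^ 2)) \<times> ((real ^ 2) \<times> (real ^ 2))) set" where
  "strip_step = {((p, d), (p + w, d)) | p d w. (p, d, w) \<in> corners}"

lemma strip_stepI: "(p, d, w) \<in> corners \<Longrightarrow> ((p, d), (p + w, d)) \<in> strip_step"
  unfolding strip_step_def by blast

lemma strip_stepE:
  assumes "(x, y) \<in> strip_step"
  obtains p d w where "x = (p, d)" "y = (p + w, d)" "(p, d, w) \<in> corners"
  using assms unfolding strip_step_def by blast

lemma single_valued_strip_step: "single_valued strip_step"
proof (rule single_valuedI)
  fix x y z assume "(x, y) \<in> strip_step" "(x, z) \<in> strip_step"
  then obtain p d w p' d' w' where "x = (p, d)" "y = (p + w, d)" "(p, d, w) \<in> corners"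
     "x = (p', d')" "z = (p' + w', d')" "(p', d', w') \<in> corners" by (elim strip_stepE)
  then show "y = z" using corner_unique[of p d w w'] by simp
qed

text \<open>A step can be traced back, as the same rhombus lies to the left of the reversed opposite edge.\<close>

lemma single_valued_strip_step_converse: "single_valued (strip_step\<inverse>)"
proof (rule single_valuedI)
  fix x y z assume "(x, y) \<in> strip_step\<inverse>" "(x, z) \<in> strip_step\<inverse>"
  then have "(y, x) \<in> strip_step" "(z, x) \<in> strip_step" by simp_all
  then obtain p d w p' d' w' where *: "y = (p, d)" "x = (p + w, d)" "(p, d, w) \<in> corners"
     "z = (p', d')" "x = (p' + w', d')" "(p', d', w') \<in> corners" by (elim strip_stepE)
  then have eq: "d' = d" "p + w = p' + w'" by simp_all
  have "(p + d + w, - d, - w) \<in> corners" "(p' + d' + w', - d', - w') \<in> corners"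
    using corners_rotate[OF corners_rotate[OF *(3)]] corners_rotate[OF corners_rotate[OF *(6)]] by simp_all
  moreover have "p' + d' + w' = p + d + w"
    using arg_cong[OF eq(2), of "\<lambda>z. z + d"] eq(1) by (simp add: add_ac)
  ultimately have "- w = - w'" using corner_unique[of "p + d + w" "- d" "- w" "- w'"] eq(1) by metis
  then have "w = w'" by simp
  then show "y = z" using eq * by simp
qed

text \<open>A strip advances to the left of its direction \<open>d\<close>. In particular it does not close up.\<close>

lemma strip_mono:
  assumes "(x, y) \<in> strip_step\<^sup>*"
  shows "snd y = snd x \<and> cross2 (snd x) (fst x) \<le> cross2 (snd x) (fst y)"
  using assms
proof (induction rule: rtrancl_induct)
  case (step y z)
  from step(2) obtain p d w where yz: "y = (p, d)" "z = (p + w, d)" "(p, d, w) \<in> corners" by (rule strip_stepE)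
  then have "0 < cross2 d w" using cornersD(1) by blast
  then show ?case using step.IH yz(1,2) by (simp add: cross2_simps)
qed simp

lemma strip_mono_step:
  assumes c: "(p, d, w) \<in> corners" and s: "((p + w, d), (q, d)) \<in> strip_step\<^sup>*"
  shows "cross2 d p < cross2 d q"
  using strip_mono[OF s] cornersD(1)[OF c] by (simp add: cross2_simps)

lemma strip_first_step:
  assumes c: "(p, d, w) \<in> corners" and s: "((p, d), (q, d)) \<in> strip_step\<^sup>*" and ne: "p \<noteq> q"
  shows "((p + w, d), (q, d)) \<in> strip_step\<^sup>*"
  using s
proof (cases rule: converse_rtranclE)
  case base
  then show ?thesis using ne by simp
next
  case (step y)
  then have "y = (p + w, d)" using single_valuedD[OF single_valued_strip_step step(1) strip_stepI[OF c]] by blast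
  then show ?thesis using step(2) by simp
qed

text \<open>The left ends of the cross-sections of a strip form a curve, which is parametrised here by the height
  \<open>cross2 d\<close>. The cross-section at each height, a translate of \<open>d\<close>, is an edge or runs through a
  rhombus of the strip.\<close>

lemma strip_track:
  assumes E: "{p, p + d} \<in> E" and s: "((p, d), (q, d)) \<in> strip_step\<^sup>*"
  shows "\<exists>h. continuous_on {cross2 d p..cross2 d q} h \<and> h (cross2 d p) = p \<and> h (cross2 d q) = q \<and>
    (\<forall>t\<in>{cross2 d p..cross2 d q}. cross2 d (h t) = t \<and> ({h t, h t + d} \<in> E \<or>
      (\<exists>p' a \<beta>. (p', d, a) \<in> corners \<and> 0 < \<beta> \<and> \<beta> < 1 \<and> h t = p' + \<beta> *\<^sub>R a \<and>
        ((p, d), (p', d)) \<in> strip_step\<^sup>* \<and> ((p' + a, d), (q, d)) \<in> strip_step\<^sup>*)))"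
proof -
  have "\<exists>h. continuous_on {cross2 d p..cross2 d (fst y)} h \<and> h (cross2 d p) = p \<and> h (cross2 d (fst y)) = fst y \<and>
    (\<forall>t\<in>{cross2 d p..cross2 d (fst y)}. cross2 d (h t) = t \<and> ({h t, h t + d} \<in> E \<or>
      (\<exists>p' a \<beta>. (p', d, a) \<in> corners \<and> 0 < \<beta> \<and> \<beta> < 1 \<and> h t = p' + \<beta> *\<^sub>R a \<and>
        ((p, d), (p', d)) \<in> strip_step\<^sup>* \<and> ((p' + a, d), y) \<in> strip_step\<^sup>*)))"
    if "((p, d), y) \<in> strip_step\<^sup>*" for y
    using that
  proof (induction rule: rtrancl_induct)
    case base
    show ?case using E by (intro exI[of _ "\<lambda>_. p"]) auto
  next
    case (step y z)
    from step(2) obtain r d' w where yz: "y = (r, d')" "z = (r + w, d')" and c': "(r, d', w) \<in> corners"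
      by (rule strip_stepE)
    have "d' = d" using strip_mono[OF step(1)] yz by simp
    then have yz: "y = (r, d)" "z = (r + w, d)" and c: "(r, d, w) \<in> corners" using yz c' by simp_all
    from step.IH yz obtain h where h: "continuous_on {cross2 d p..cross2 d r} h" "h (cross2 d p) = p"
      "h (cross2 d r) = r" and
      hp: "\<And>t. t \<in> {cross2 d p..cross2 d r} \<Longrightarrow> cross2 d (h t) = t \<and> ({h t, h t + d} \<in> E \<or>
      (\<exists>p' a \<beta>. (p', d, a) \<in> corners \<and> 0 < \<beta> \<and> \<beta> < 1 \<and> h t = p' + \<beta> *\<^sub>R a \<and>
        ((p, d), (p', d)) \<in> strip_step\<^sup>* \<and> ((p' + a, d), y) \<in> strip_step\<^sup>*))"
      by auto
    note cD = cornersD[OF c]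
    have le: "cross2 d p \<le> cross2 d r" using strip_mono[OF step(1)] yz by simp
    define k where "k t = r + ((t - cross2 d r) / cross2 d w) *\<^sub>R w" for t
    define g where "g t = (if t \<le> cross2 d r then h t else k t)" for t
    have top: "cross2 d (r + w) = cross2 d r + cross2 d w" by (simp add: cross2_simps)
    have "continuous_on ({cross2 d p..cross2 d r} \<union> {cross2 d r..cross2 d (r + w)}) g"
      unfolding g_def
    proof (rule continuous_on_If)
      show "continuous_on {cross2 d r..cross2 d (r + w)} k" unfolding k_def divide_inverse by (intro continuous_intros)
    qed (use h(1,3) in \<open>auto simp: k_def\<close>)
    moreover have "{cross2 d p..cross2 d r} \<union> {cross2 d r..cross2 d (r + w)} = {cross2 d p..cross2 d (r + w)}"
      using le cD(1) top by auto
    ultimately have cont: "continuous_on {cross2 d p..cross2 d (r + w)} g" by simp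
    have g0: "g (cross2 d p) = p" using le h(2) by (simp add: g_def)
    have g1: "g (cross2 d (r + w)) = r + w" using cD(1) by (simp add: g_def k_def top)
    have gp: "cross2 d (g t) = t \<and> ({g t, g t + d} \<in> E \<or>
      (\<exists>p' a \<beta>. (p', d, a) \<in> corners \<and> 0 < \<beta> \<and> \<beta> < 1 \<and> g t = p' + \<beta> *\<^sub>R a \<and>
        ((p, d), (p', d)) \<in> strip_step\<^sup>* \<and> ((p' + a, d), z) \<in> strip_step\<^sup>*))"
      if t: "t \<in> {cross2 d p..cross2 d (r + w)}" for t
    proof (cases "t \<le> cross2 d r")
      case True
      then have gt: "g t = h t" by (simp add: g_def)
      have "t \<in> {cross2 d p..cross2 d r}" using t True by simp
      from hp[OF this] show ?thesis unfolding gt using step(2) by (meson rtrancl.rtrancl_into_rtrancl)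
    next
      case False
      then have gt: "g t = k t" by (simp add: g_def)
      define \<beta> where "\<beta> = (t - cross2 d r) / cross2 d w"
      have kt: "k t = r + \<beta> *\<^sub>R w" by (simp add: k_def \<beta>_def)
      have "cross2 d (k t) = t" using cD(1) unfolding kt \<beta>_def by (simp add: cross2_simps)
      have b: "0 < \<beta>" "\<beta> \<le> 1" using False t cD(1) top unfolding \<beta>_def by (simp_all add: divide_le_eq)
      have "{k t, k t + d} \<in> E \<or>
        (\<exists>p' a \<beta>. (p', d, a) \<in> corners \<and> 0 < \<beta> \<and> \<beta> < 1 \<and> k t = p' + \<beta> *\<^sub>R a \<and>
          ((p, d), (p', d)) \<in> strip_step\<^sup>* \<and> ((p' + a, d), z) \<in> strip_step\<^sup>*)"
      proof (cases "\<beta> < 1")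
        case True
        moreover have "((p, d), (r, d)) \<in> strip_step\<^sup>*" "((r + w, d), z) \<in> strip_step\<^sup>*"
          using step(1) yz by simp_all
        ultimately show ?thesis using c b(1) kt by blast
      next
        case False
        then have "\<beta> = 1" using b by simp
        have kw: "k t = r + w" unfolding kt \<open>\<beta> = 1\<close> by simp
        have kd: "r + w + d = r + d + w" by (simp add: add_ac)
        have "{k t, k t + d} \<in> E" unfolding kw kd by (rule cD(5))
        then show ?thesis ..
      qed
      then show ?thesis unfolding gt using \<open>cross2 d (k t) = t\<close> by blast
    qed
    show ?case unfolding yz(2) fst_conv using cont g0 g1 gp yz(2) by blast
  qed
  from this[OF s] show ?thesis by simp
qed

text \<open>Suppose that two strips, of directions \<open>d\<close> and \<open>w\<close>, share the rhombi at \<open>p\<close> and at \<open>q\<close>, and choose these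
  such that no common rhombus lies between them on the first strip. View the part of the
  second strip between the two rhombi as a band in direction \<open>w\<close>, with \<open>cross2 d\<close> as height. The middle line of
  the first strip starts at the upper side of the rhombus at \<open>p\<close>, above the band, and arrives at the lower side of
  the rhombus at \<open>q\<close>, below it. As it is rising, it would have to run through the band
  (\<open>no_return\<close>). But then a cross-section of the first strip meets one of the second strip,
  which can only happen inside a common rhombus.\<close>

lemma strips_cross_once:
  assumes p: "(p, d, w) \<in> corners" and q: "(q, d, w) \<in> corners"
    and s: "((p, d), (q, d)) \<in> strip_step\<^sup>*"
    and r: "((p + d, w), (q + d, w)) \<in> strip_step\<^sup>* \<or> ((q + d, w), (p + d, w)) \<in> strip_step\<^sup>*"
  shows "p = q"
proof (rule ccontr)
  assume "p \<noteq> q"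
  define S where "S = {(p, q). (p, d, w) \<in> corners \<and> (q, d, w) \<in> corners \<and> ((p, d), (q, d)) \<in> strip_step\<^sup>* \<and>
    (((p + d, w), (q + d, w)) \<in> strip_step\<^sup>* \<or> ((q + d, w), (p + d, w)) \<in> strip_step\<^sup>*) \<and> p \<noteq> q}"
  have cV: "p \<in> V" if "(p, d, w) \<in> corners" for p by (rule edge_in_V(1)[OF cornersD(2)[OF that]])
  have "S \<subseteq> V \<times> V" unfolding S_def using cV by auto
  then have "finite S" by (rule finite_subset) simp
  moreover have "S \<noteq> {}" using p q s r \<open>p \<noteq> q\<close> unfolding S_def by blast
  ultimately have "\<exists>pq. is_arg_min (\<lambda>z. cross2 d (snd z) - cross2 d (fst z)) (\<lambda>z. z \<in> S) pq"
    by (rule ex_is_arg_min_if_finite)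
  then obtain pq where pqS: "pq \<in> S"
    and pqmin: "\<And>z. z \<in> S \<Longrightarrow> cross2 d (snd pq) - cross2 d (fst pq) \<le> cross2 d (snd z) - cross2 d (fst z)"
    unfolding is_arg_min_def by (auto simp: not_less)
  obtain p q where pq: "pq = (p, q)" by (cases pq)
  have p: "(p, d, w) \<in> corners" and q: "(q, d, w) \<in> corners" and s: "((p, d), (q, d)) \<in> strip_step\<^sup>*"
    and r: "((p + d, w), (q + d, w)) \<in> strip_step\<^sup>* \<or> ((q + d, w), (p + d, w)) \<in> strip_step\<^sup>*" and ne: "p \<noteq> q"
    using pqS unfolding S_def pq by blast+
  have min: "cross2 d q - cross2 d p \<le> cross2 d q' - cross2 d p'" if "(p', q') \<in> S" for p' q'
    using pqmin[OF that] unfolding pq by simp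
  define c where "c = cross2 d w"
  have c: "0 < c" using cornersD(1)[OF p] by (simp add: c_def)
  have wd: "cross2 w d = - c" unfolding c_def by (rule cross2_commute)
  \<comment> \<open>the part of the first strip between the two rhombi\<close>
  have s1: "((p + w, d), (q, d)) \<in> strip_step\<^sup>*" by (rule strip_first_step[OF p s ne])
  have E1: "{p + w, p + w + d} \<in> E" using cornersD(5)[OF p] by (simp add: add_ac)
  obtain h where h: "continuous_on {cross2 d (p + w)..cross2 d q} h" "h (cross2 d (p + w)) = p + w" "h (cross2 d q) = q"
    and hp: "\<And>t. t \<in> {cross2 d (p + w)..cross2 d q} \<Longrightarrow> cross2 d (h t) = t \<and> ({h t, h t + d} \<in> E \<or>
      (\<exists>p' a \<beta>. (p', d, a) \<in> corners \<and> 0 < \<beta> \<and> \<beta> < 1 \<and> h t = p' + \<beta> *\<^sub>R a \<and>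
        ((p + w, d), (p', d)) \<in> strip_step\<^sup>* \<and> ((p' + a, d), (q, d)) \<in> strip_step\<^sup>*))"
    using strip_track[OF E1 s1] by blast
  \<comment> \<open>the part of the second strip between them\<close>
  have pd: "(p + d, w, - d) \<in> corners" and qd: "(q + d, w, - d) \<in> corners"
    using corners_rotate p q by blast+
  \<comment> \<open>the second strip may be traversed in either order; its ends between the two rhombi are \<open>r0\<close> and \<open>r1\<close>\<close>
  define r0 r1 where "r0 = (if ((p + d, w), (q + d, w)) \<in> strip_step\<^sup>* then p else q)"
    and "r1 = (if ((p + d, w), (q + d, w)) \<in> strip_step\<^sup>* then q + d else p + d)"
  have r01: "r0 = p \<and> r1 = q + d \<and> ((p + d, w), (q + d, w)) \<in> strip_step\<^sup>* \<or>
      r0 = q \<and> r1 = p + d \<and> ((q + d, w), (p + d, w)) \<in> strip_step\<^sup>*"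
    using r unfolding r0_def r1_def by auto
  have cancel: "p + d + - d = p" "q + d + - d = q" by simp_all
  have ne': "p + d \<noteq> q + d" "q + d \<noteq> p + d" using ne by simp_all
  have s2: "((r0, w), (r1, w)) \<in> strip_step\<^sup>*"
    using r01 strip_first_step[OF pd _ ne'(1)] strip_first_step[OF qd _ ne'(2)] unfolding cancel by blast
  have E2: "{r0, r0 + w} \<in> E" using r01 cornersD(3)[OF p] cornersD(3)[OF q] by auto
  define x0 x1 where "x0 = cross2 w r0" and "x1 = cross2 w r1"
  have x01: "x0 \<le> x1" using strip_mono[OF s2] by (simp add: x0_def x1_def)
  obtain k where k: "continuous_on {x0..x1} k" "k x0 = r0" "k x1 = r1"
    and kp: "\<And>t. t \<in> {x0..x1} \<Longrightarrow> cross2 w (k t) = t \<and> ({k t, k t + w} \<in> E \<or>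
      (\<exists>p' a \<beta>. (p', w, a) \<in> corners \<and> 0 < \<beta> \<and> \<beta> < 1 \<and> k t = p' + \<beta> *\<^sub>R a \<and>
        ((r0, w), (p', w)) \<in> strip_step\<^sup>* \<and> ((p' + a, w), (r1, w)) \<in> strip_step\<^sup>*))"
    using strip_track[OF E2 s2] unfolding x0_def x1_def by blast
  \<comment> \<open>the middle line of the first strip\<close>
  define z where "z t = h t + (1/2) *\<^sub>R d" for t
  define \<tau> where "\<tau> t = cross2 w (z t)" for t
  \<comment> \<open>the lower border of the second strip, continued by constants\<close>
  define \<kappa> where "\<kappa> x = cross2 d (k (max x0 (min x x1)))" for x
  let ?t1 = "cross2 d (p + w)" and ?t2 = "cross2 d q"
  have \<tau>h: "\<tau> t = cross2 w (h t) - c / 2" for t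
    unfolding \<tau>_def z_def by (simp add: cross2_simps wd)
  have t12: "?t1 \<le> ?t2" using strip_mono[OF s1] by simp
  have cont_\<tau>: "continuous_on {?t1..?t2} \<tau>" unfolding \<tau>_def z_def by (intro continuous_intros h(1))
  have "continuous_on UNIV (\<lambda>x. k (max x0 (min x x1)))"
    by (rule continuous_on_compose2[OF k(1)]) (use x01 in \<open>auto intro!: continuous_intros\<close>)
  then have cont_\<kappa>: "continuous_on UNIV \<kappa>" unfolding \<kappa>_def by (intro continuous_intros)
  show False
  proof (rule no_return[of ?t1 ?t2 c \<kappa> \<tau> x0 x1])
    show "continuous_on {?t1..?t2} (\<lambda>t. \<kappa> (\<tau> t))"
      by (rule continuous_on_compose2[OF cont_\<kappa> cont_\<tau>]) simp
    show "\<kappa> x = \<kappa> x0" if "x \<le> x0" for x using that x01 by (simp add: \<kappa>_def max_def min_def)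
    show "\<kappa> x = \<kappa> x1" if "x1 \<le> x" for x using that x01 by (simp add: \<kappa>_def max_def min_def)
    have kap: "\<kappa> x = cross2 d r0" if "x \<le> x0" for x using that x01 k(2) by (simp add: \<kappa>_def max_def min_def)
    have kap': "\<kappa> x = cross2 d r1" if "x1 \<le> x" for x using that x01 k(2,3) by (simp add: \<kappa>_def max_def min_def)
    have \<tau>1: "\<tau> ?t1 = cross2 w p - c / 2" unfolding \<tau>h h(2) by (simp add: cross2_simps)
    have \<tau>2: "\<tau> ?t2 = cross2 w q - c / 2" unfolding \<tau>h h(3) by simp
    have "\<kappa> (\<tau> ?t1) = cross2 d p \<and> \<kappa> (\<tau> ?t2) = cross2 d q"
      using r01
    proof (elim disjE conjE)
      assume r: "r0 = p" "r1 = q + d"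
      have "\<tau> ?t1 \<le> x0" unfolding \<tau>1 x0_def r using c by simp
      moreover have "x1 \<le> \<tau> ?t2" unfolding \<tau>2 x1_def r using c by (simp add: cross2_simps wd)
      ultimately show ?thesis using kap kap' r by (simp add: cross2_simps)
    next
      assume r: "r0 = q" "r1 = p + d"
      have "\<tau> ?t2 \<le> x0" unfolding \<tau>2 x0_def r using c by simp
      moreover have "x1 \<le> \<tau> ?t1" unfolding \<tau>1 x1_def r using c by (simp add: cross2_simps wd)
      ultimately show ?thesis using kap kap' r by (simp add: cross2_simps)
    qed
    then show "c \<le> ?t1 - \<kappa> (\<tau> ?t1)" "?t2 - \<kappa> (\<tau> ?t2) \<le> 0" by (simp_all add: cross2_simps c_def)
    fix t assume t: "?t1 \<le> t" "t \<le> ?t2" and x: "x0 \<le> \<tau> t" "\<tau> t \<le> x1" and gap: "0 < t - \<kappa> (\<tau> t)" "t - \<kappa> (\<tau> t) < c"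
    define K where "K = k (\<tau> t)"
    have \<kappa>K: "\<kappa> (\<tau> t) = cross2 d K" using x by (simp add: \<kappa>_def K_def max_def min_def)
    have "t \<in> {?t1..?t2}" "\<tau> t \<in> {x0..x1}" using t x by simp_all
    note H = hp[OF this(1)] and KK = kp[OF this(2), folded K_def]
    have dz: "cross2 d (z t) = t" using H unfolding z_def by (simp add: cross2_simps)
    define l where "l = (t - cross2 d K) / c"
    have l: "0 < l" "l < 1" using gap c unfolding \<kappa>K l_def by simp_all
    have zK: "z t = K + l *\<^sub>R w"
    proof -
      have wz: "cross2 w (z t - K) = 0" using KK by (simp add: cross2_simps \<tau>_def)
      then have wz': "cross2 (z t - K) w = 0" using cross2_commute[of "z t - K" w] by simp
      have "cross2 d w *\<^sub>R (z t - K) = cross2 (z t - K) w *\<^sub>R d + cross2 d (z t - K) *\<^sub>R w" by (rule cross2_decomp)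
      then have "c *\<^sub>R (z t - K) = (t - cross2 d K) *\<^sub>R w" unfolding wz' c_def using dz by (simp add: cross2_simps)
      from arg_cong[OF this, of "\<lambda>x. (1 / c) *\<^sub>R x"] have "z t - K = l *\<^sub>R w"
        using c by (simp add: l_def)
      then show ?thesis by (simp add: algebra_simps)
    qed
    have zE: "z t \<in> convex hull {h t, h t + d}"
      using in_segment_from[of "1/2" "h t" "h t + d"] by (simp add: hull_edge z_def)
    have zK': "z t \<in> convex hull {K, K + w}"
      using in_segment_from[of l K "K + w"] l by (simp add: hull_edge zK)
    have z_in_S: "z t \<in> open_rhombus p' d a" if "(p', d, a) \<in> corners" "0 < \<beta>" "\<beta> < 1" "h t = p' + \<beta> *\<^sub>R a" for p' a \<beta>
    proof -
      have "z t = p' + (1/2) *\<^sub>R d + \<beta> *\<^sub>R a" unfolding z_def that(4) by simp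
      then show ?thesis using in_open_rhombus[of d a p' "1/2" \<beta>] cornersD(1)[OF that(1)] that(2,3) by simp
    qed
    have z_in_R: "z t \<in> open_rhombus p' w a" if "(p', w, a) \<in> corners" "0 < \<beta>" "\<beta> < 1" "K = p' + \<beta> *\<^sub>R a" for p' a \<beta>
    proof -
      have "z t = p' + l *\<^sub>R w + \<beta> *\<^sub>R a" unfolding zK that(4) by simp
      then show ?thesis using in_open_rhombus[of w a p' l \<beta>] cornersD(1)[OF that(1)] that(2,3) l by simp
    qed
    consider (ee) "{h t, h t + d} \<in> E" "{K, K + w} \<in> E"
      | (er) p' a \<beta> where "{h t, h t + d} \<in> E" "(p', w, a) \<in> corners" "0 < \<beta>" "\<beta> < 1" "K = p' + \<beta> *\<^sub>R a"
      | (re) p' a \<beta> where "{K, K + w} \<in> E" "(p', d, a) \<in> corners" "0 < \<beta>" "\<beta> < 1" "h t = p' + \<beta> *\<^sub>R a"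
      | (rr) p' a \<beta> p'' a' \<beta>' where "(p', d, a) \<in> corners" "0 < \<beta>" "\<beta> < 1" "h t = p' + \<beta> *\<^sub>R a"
          "((p + w, d), (p', d)) \<in> strip_step\<^sup>*" "((p' + a, d), (q, d)) \<in> strip_step\<^sup>*"
          "(p'', w, a') \<in> corners" "0 < \<beta>'" "\<beta>' < 1" "K = p'' + \<beta>' *\<^sub>R a'"
          "((r0, w), (p'', w)) \<in> strip_step\<^sup>*" "((p'' + a', w), (r1, w)) \<in> strip_step\<^sup>*"
      using H KK by blast
    then show False
    proof cases
      case ee
      have "{h t, h t + d} \<noteq> {K, K + w}"
      proof
        assume "{h t, h t + d} = {K, K + w}"
        then have "(h t = K \<and> h t + d = K + w) \<or> (h t = K + w \<and> h t + d = K)" by (simp only: doubleton_eq_iff)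
        moreover have "cross2 d (h t + d) = cross2 d (h t)" by (simp add: cross2_simps)
        ultimately have "cross2 d (K + w) = cross2 d K" by metis
        then show False using c by (simp add: c_def cross2_simps)
      qed
      then have "z t \<in> {h t, h t + d}" using edges_meet[OF ee _ zE zK'] by blast
      then have "cross2 w (z t) = cross2 w (h t) \<or> cross2 w (z t) = cross2 w (h t + d)" by auto
      then show False using \<tau>h[of t] c unfolding \<tau>_def by (auto simp: cross2_simps wd)
    next
      case er
      then show False using edge_avoids_rhombus[OF er(2,1) zE] z_in_R by blast
    next
      case re
      then show False using edge_avoids_rhombus[OF re(2,1) zK'] z_in_S by blast
    next
      case rr
      have "0 < cross2 d w" using c by (simp add: c_def)
      from rhombi_overlap[OF rr(1,7) z_in_S[OF rr(1-4)] z_in_R[OF rr(7-10)] this]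
      have eq: "a = w" "p'' = p' + d" "a' = - d" by blast+
      have p': "(p', d, w) \<in> corners" using rr(1) eq by simp
      have lt: "cross2 d p < cross2 d p'" by (rule strip_mono_step[OF p rr(5)])
      have lt': "cross2 d p' < cross2 d q" using strip_mono_step[OF p', of q] rr(6) eq by simp
      have 1: "((p, d), (p', d)) \<in> strip_step\<^sup>*"
        using converse_rtrancl_into_rtrancl[OF strip_stepI[OF p] rr(5)] .
      have 2: "((r0, w), (p' + d, w)) \<in> strip_step\<^sup>*" "((p', w), (r1, w)) \<in> strip_step\<^sup>*"
        using rr(11,12) eq by simp_all
      have step: "((x + d, w), (x, w)) \<in> strip_step" if "(x, d, w) \<in> corners" for x
        using strip_stepI[OF corners_rotate[OF that]] by simp
      have "((p + d, w), (p' + d, w)) \<in> strip_step\<^sup>* \<or> ((p' + d, w), (p + d, w)) \<in> strip_step\<^sup>*"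
        using r01
      proof (elim disjE conjE)
        assume "r0 = p"
        then show ?thesis using converse_rtrancl_into_rtrancl[OF step[OF p]] 2(1) by blast
      next
        assume "r1 = p + d"
        then show ?thesis using converse_rtrancl_into_rtrancl[OF step[OF p']] 2(2) by blast
      qed
      then have "(p, p') \<in> S" unfolding S_def using p p' 1 lt by auto
      then show False using min[of p p'] lt' by simp
    qed
  qed (use t12 c cont_\<tau> x01 in auto)
qed

definition darts :: "((real ^ 2) \<times> (real ^ 2)) set" where
  "darts = {(p, d). {p, p + d} \<in> E}"

text \<open>The sides along which no rhombus lies; here the strips stop.\<close>

definition free_darts :: "((real ^ 2) \<times> (real ^ 2)) set" where
  "free_darts = darts - Domain strip_step"

lemma card_darts: "card darts = 2 * card E"
proof -
  define D where "D e = {(p, d). {p, p + d} = e}" for e :: "(real ^ 2) set"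
  have D2: "finite (D e) \<and> card (D e) = 2" if e: "e \<in> E" for e
  proof -
    obtain u v where uv: "e = {u, v}" "u \<noteq> v" by (rule edgeE[OF e])
    have "D e = {(u, v - u), (v, u - v)}"
      unfolding D_def uv by (auto simp: doubleton_eq_iff algebra_simps)
    then show ?thesis using uv(2) by simp
  qed
  have "darts = (\<Union>e\<in>E. D e)" unfolding darts_def D_def by auto
  then have "card darts = (\<Sum>e\<in>E. card (D e))"
    using D2 by (simp only:) (rule card_UN_disjoint, auto simp: D_def)
  then show ?thesis using D2 by simp
qed

lemma finite_darts: "finite darts"
proof (rule finite_subset[OF _ finite_imageI[OF finite_edge_pairs]])
  show "darts \<subseteq> (\<lambda>(u, v). (u, v - u)) ` {(u, v). {u, v} \<in> E}"
  proof
    fix x assume "x \<in> darts"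
    then obtain p d where x: "x = (p, d)" "{p, p + d} \<in> E" unfolding darts_def by blast
    then have "x = (\<lambda>(u, v). (u, v - u)) (p, p + d)" by simp
    then show "x \<in> (\<lambda>(u, v). (u, v - u)) ` {(u, v). {u, v} \<in> E}" using x(2) by blast
  qed
qed

lemma Domain_strip_step: "Domain strip_step \<subseteq> darts"
  unfolding darts_def using cornersD(2) by (auto elim!: strip_stepE)

lemma Range_strip_step: "(x, y) \<in> strip_step \<Longrightarrow> y \<in> darts"
  unfolding darts_def using cornersD(5) by (auto elim!: strip_stepE simp: add_ac)

lemma card_corners: "card corners = card (Domain strip_step)" "finite corners"
proof -
  have bij: "bij_betw (\<lambda>(p, d, w). (p, d)) corners (Domain strip_step)"
    unfolding bij_betw_def
  proof
    show "inj_on (\<lambda>(p, d, w). (p, d)) corners" unfolding inj_on_def using corner_unique by auto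
    show "(\<lambda>(p, d, w). (p, d)) ` corners = Domain strip_step"
      unfolding strip_step_def by force
  qed
  then show "card corners = card (Domain strip_step)" by (rule bij_betw_same_card)
  show "finite corners"
    using bij_betw_finite[OF bij] finite_subset[OF Domain_strip_step finite_darts] by simp
qed

lemma strip_terminates:
  assumes "x \<in> darts"
  shows "\<exists>t\<in>free_darts. (x, t) \<in> strip_step\<^sup>*"
proof -
  have "finite strip_step"
    by (rule finite_subset[of _ "darts \<times> darts"]) (use Domain_strip_step Range_strip_step finite_darts in auto)
  moreover have "acyclic strip_step"
  proof (rule acyclicI, rule allI, rule notI)
    fix x assume "(x, x) \<in> strip_step\<^sup>+"
    then obtain y where y: "(x, y) \<in> strip_step" "(y, x) \<in> strip_step\<^sup>*" by (meson tranclD)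
    from y(1) obtain p d w where *: "x = (p, d)" "y = (p + w, d)" "(p, d, w) \<in> corners" by (rule strip_stepE)
    then show False using strip_mono_step[OF *(3), of p] y(2) by simp
  qed
  ultimately have "wf (strip_step\<inverse>)" by (rule finite_acyclic_wf_converse)
  then show ?thesis using assms
  proof (induction x rule: wf_induct_rule)
    case (less x)
    show ?case
    proof (cases "x \<in> Domain strip_step")
      case True
      then obtain y where y: "(x, y) \<in> strip_step" by blast
      then obtain t where "t \<in> free_darts" "(y, t) \<in> strip_step\<^sup>*" using less.IH[of y] Range_strip_step by blast
      then show ?thesis using converse_rtrancl_into_rtrancl[OF y] by blast
    next
      case False
      then show ?thesis using less.prems unfolding free_darts_def by blast
    qed
  qed
qed

text \<open>Send the rhombus with sides \<open>d\<close> and \<open>w\<close> at \<open>p\<close> to the free sides \<open>t\<close> and \<open>t'\<close> that are reached from its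
  sides in directions \<open>d\<close> and \<open>w\<close>. Two rhombi with the same image lie on the same two strips, so this
  map is injective. Steps preserve directions, hence \<open>0 < cross2 (snd t) (snd t')\<close>. This relation is
  asymmetric, so it holds for at most half of all pairs of distinct free sides.\<close>

lemma card_edges_le_free_darts: "4 * card E \<le> card free_darts * card free_darts + card free_darts"
proof -
  define T where "T x = (SOME t. t \<in> free_darts \<and> (x, t) \<in> strip_step\<^sup>*)" for x
  have T: "T x \<in> free_darts \<and> (x, T x) \<in> strip_step\<^sup>*" if "x \<in> darts" for x
  proof -
    have "\<exists>t. t \<in> free_darts \<and> (x, t) \<in> strip_step\<^sup>*" using strip_terminates[OF that] by (simp only: Bex_def)
    then show ?thesis unfolding T_def by (rule someI_ex)
  qed
  have fin: "finite free_darts" unfolding free_darts_def using finite_darts by simp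
  define P where "P = {(t, t'). t \<in> free_darts \<and> t' \<in> free_darts \<and> 0 < cross2 (snd t) (snd t')}"
  define g where "g = (\<lambda>(p, d, w). (T (p, d), T (p + d, w)))"
  have dart1: "(p, d) \<in> darts" "(p + d, w) \<in> darts" if "(p, d, w) \<in> corners" for p d w
    using cornersD(2,4)[OF that] unfolding darts_def by simp_all
  have compare: "(x, y) \<in> strip_step\<^sup>* \<or> (y, x) \<in> strip_step\<^sup>*" if "(x, t) \<in> strip_step\<^sup>*" "(y, t) \<in> strip_step\<^sup>*" for x y t
    using single_valued_confluent[OF single_valued_strip_step_converse, of t x y] that
    unfolding rtrancl_converse by auto
  have sndT: "snd (T x) = snd x" if "x \<in> darts" for x using T[OF that] strip_mono by blast
  have "inj_on g corners"
  proof (rule inj_onI)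
    fix x y assume x: "x \<in> corners" and y: "y \<in> corners" and eq: "g x = g y"
    obtain p d w where xp: "x = (p, d, w)" by (cases x)
    obtain q d' w' where yq: "y = (q, d', w')" by (cases y)
    have c: "(p, d, w) \<in> corners" "(q, d', w') \<in> corners" using x y xp yq by simp_all
    have eq1: "T (p, d) = T (q, d')" "T (p + d, w) = T (q + d', w')" using eq unfolding g_def xp yq by simp_all
    have "d = d'" "w = w'"
      using sndT[OF dart1(1)[OF c(1)]] sndT[OF dart1(1)[OF c(2)]] sndT[OF dart1(2)[OF c(1)]] sndT[OF dart1(2)[OF c(2)]]
        eq1 by simp_all
    then have c': "(q, d, w) \<in> corners" and eq2: "T (p, d) = T (q, d)" "T (p + d, w) = T (q + d, w)" using c eq1 by simp_all
    have 1: "((p, d), (q, d)) \<in> strip_step\<^sup>* \<or> ((q, d), (p, d)) \<in> strip_step\<^sup>*"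
      by (rule compare[of _ "T (p, d)"]) (use T[OF dart1(1)[OF c(1)]] T[OF dart1(1)[OF c']] eq2 in simp_all)
    have 2: "((p + d, w), (q + d, w)) \<in> strip_step\<^sup>* \<or> ((q + d, w), (p + d, w)) \<in> strip_step\<^sup>*"
      by (rule compare[of _ "T (p + d, w)"]) (use T[OF dart1(2)[OF c(1)]] T[OF dart1(2)[OF c']] eq2 in simp_all)
    have "p = q" using 1 2 strips_cross_once[OF c(1) c'] strips_cross_once[OF c' c(1)] by blast
    then show "x = y" using xp yq \<open>d = d'\<close> \<open>w = w'\<close> by simp
  qed
  moreover have "g ` corners \<subseteq> P"
  proof
    fix y assume "y \<in> g ` corners"
    then obtain p d w where c: "(p, d, w) \<in> corners" and y: "y = (T (p, d), T (p + d, w))" unfolding g_def by auto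
    show "y \<in> P" unfolding P_def y
      using T[OF dart1(1)[OF c]] T[OF dart1(2)[OF c]] sndT[OF dart1(1)[OF c]] sndT[OF dart1(2)[OF c]] cornersD(1)[OF c]
      by simp
  qed
  moreover have finP: "finite P" by (rule finite_subset[of _ "free_darts \<times> free_darts"]) (use fin in \<open>auto simp: P_def\<close>)
  ultimately have cP: "card corners \<le> card P" by (metis card_inj_on_le)
  have "card P + card (prod.swap ` P) + card ((\<lambda>t. (t, t)) ` free_darts) \<le> card (free_darts \<times> free_darts)"
  proof -
    have "P \<inter> prod.swap ` P = {}"
    proof -
      have "\<not> (0 < cross2 a b \<and> 0 < cross2 b a)" for a b using cross2_commute[of a b] by linarith
      then show ?thesis unfolding P_def by auto
    qed
    moreover have "(P \<union> prod.swap ` P) \<inter> (\<lambda>t. (t, t)) ` free_darts = {}" unfolding P_def by auto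
    ultimately have "card P + card (prod.swap ` P) + card ((\<lambda>t. (t, t)) ` free_darts)
        = card (P \<union> prod.swap ` P \<union> (\<lambda>t. (t, t)) ` free_darts)"
      using finP fin by (simp add: card_Un_disjoint)
    also have "\<dots> \<le> card (free_darts \<times> free_darts)" using fin by (intro card_mono) (auto simp: P_def)
    finally show ?thesis .
  qed
  moreover have "card (prod.swap ` P) = card P" by (rule card_image) simp
  moreover have "card ((\<lambda>t. (t, t)) ` free_darts) = card free_darts" by (rule card_image) (simp add: inj_on_def)
  ultimately have PL: "2 * card P + card free_darts \<le> card free_darts * card free_darts"
    by (simp add: card_cartesian_product)
  have "card free_darts = card darts - card (Domain strip_step)"
    unfolding free_darts_def
    by (rule card_Diff_subset[OF finite_subset[OF Domain_strip_step finite_darts] Domain_strip_step])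
  moreover have "card (Domain strip_step) \<le> card darts" by (rule card_mono[OF finite_darts Domain_strip_step])
  ultimately have "card free_darts + card corners = 2 * card E" using card_darts card_corners(1) by linarith
  then show ?thesis using PL cP by linarith
qed

end

section \<open>Discharging\<close>

text \<open>Both apexes lie on the perpendicular bisector of the base \<open>u v\<close>, on different sides of the base and at
  the same distance from it.\<close>

lemma isosceles_apexes:
  fixes u v w z :: "real ^ 2"
  assumes w: "dist u w = 1" "dist v w = 1" and z: "dist u z = 1" "dist v z = 1"
    and sides: "0 < cross2 (v - u) (w - u)" "0 < cross2 (u - v) (z - v)"
  shows "z - v = u - w"
proof -
  define x y d where "x = w - u" and "y = z - u" and "d = v - u"
  have wz: "x - d = w - v" "y - d = z - v" by (simp_all add: x_def y_def d_def)
  have n: "x \<bullet> x = 1" "y \<bullet> y = 1" "(x - d) \<bullet> (x - d) = 1" "(y - d) \<bullet> (y - d) = 1"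
    unfolding wz using w z by (simp_all add: x_def y_def dist_norm norm_minus_commute flip: power2_norm_eq_inner)
  have xd: "2 * (x \<bullet> d) = d \<bullet> d" "2 * (y \<bullet> d) = d \<bullet> d"
    using n by (simp_all add: inner_diff_left inner_diff_right inner_commute)
  have perp: "(x - y) \<bullet> d = 0" "(x - y) \<bullet> (x + y) = 0"
  proof -
    show "(x - y) \<bullet> d = 0" unfolding inner_diff_left using xd by linarith
    show "(x - y) \<bullet> (x + y) = 0"
      unfolding inner_diff_left inner_add_right inner_commute[of y x] using n(1,2) by linarith
  qed
  have "cross2 d x > 0" "cross2 d y < 0"
  proof -
    show "cross2 d x > 0" using sides(1) by (simp add: d_def x_def)
    have "cross2 (u - v) (z - v) = - cross2 d y"
      unfolding d_def y_def by (simp add: cross2_def algebra_simps)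
    then show "cross2 d y < 0" using sides(2) by simp
  qed
  then have "x - y \<noteq> 0" "d \<noteq> 0" by auto
  have "((x - y) \<bullet> (x - y)) * cross2 d (x + y) = 0"
    unfolding cross2_angle[of "x - y" d "x + y"] perp by simp
  then have "cross2 d (x + y) = 0" using \<open>x - y \<noteq> 0\<close> by simp
  then obtain k where k: "x + y = k *\<^sub>R d" by (rule cross2_eq_0_parallel[OF _ \<open>d \<noteq> 0\<close>])
  have "d \<bullet> d = (x + y) \<bullet> d" using xd by (simp add: inner_add_left)
  also have "\<dots> = k * (d \<bullet> d)" unfolding k by simp
  finally have "k = 1" using \<open>d \<noteq> 0\<close> by simp
  then have "x + y = d" using k by simp
  then show ?thesis by (simp add: x_def y_def d_def algebra_simps)
qed

context matchstick begin

text \<open>The rhombus is composed of two isosceles triangles with the common base \<open>u v\<close>, so it contains no further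
  vertices.\<close>

lemma rhombus_from_triangles:
  assumes F: "plane_graph V F"
    and t: "(u, v, w) \<in> plane_graph.triangles V F" "(v, u, z) \<in> plane_graph.triangles V F"
    and E: "{v, w} \<in> E" "{w, u} \<in> E" "{u, z} \<in> E" "{z, v} \<in> E"
  shows "(v, w - v, z - v) \<in> corners"
proof -
  interpret F: plane_graph V F by (rule F)
  have s: "0 < cross2 (v - u) (w - u)" "0 < cross2 (u - v) (z - v)"
    and hull: "V \<inter> convex hull {u, v, w} \<subseteq> {u, v, w}" "V \<inter> convex hull {v, u, z} \<subseteq> {v, u, z}"
    using t unfolding F.triangles_def by auto
  have zv: "z - v = u - w"
    using isosceles_apexes[OF _ _ _ _ s] unit[OF E(1)] unit[OF E(2)] unit[OF E(3)] unit[OF E(4)]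
    by (simp add: dist_commute)
  have D: "0 < cross2 (w - v) (z - v)"
  proof -
    have "cross2 (w - v) (z - v) = cross2 (w - v) (u - v)"
      unfolding zv by (simp add: cross2_def algebra_simps)
    then show ?thesis using s(1) cross2_rotate[of w v u] by simp
  qed
  have e: "v + (w - v) = w" "v + (z - v) = z" "w + (z - v) = u" unfolding zv by simp_all (simp add: zv[symmetric])
  have "x \<in> {v, w, z, u}" if x: "x \<in> V" "x \<in> closed_rhombus v (w - v) (z - v)" for x
  proof -
    have D': "cross2 (w - v) (z - v) \<noteq> 0" using D by simp
    define a b where "a = crd (w - v) (z - v) v x" and "b = crd (z - v) (w - v) v x"
    have xe: "x = v + a *\<^sub>R (w - v) + b *\<^sub>R (z - v)" unfolding a_def b_def by (rule crd_decomp[OF D'])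
    have ab: "0 \<le> a" "a \<le> 1" "0 \<le> b" "b \<le> 1" using x(2) unfolding closed_rhombus_def a_def b_def by simp_all
    show ?thesis
    proof (cases "b \<le> a")
      case True
      have "x = b *\<^sub>R u + (1 - a) *\<^sub>R v + (a - b) *\<^sub>R w" unfolding xe zv by (simp add: algebra_simps)
      then have "x \<in> convex hull {u, v, w}" unfolding convex_hull_3 using True ab
        by (intro CollectI exI[of _ b] exI[of _ "1 - a"] exI[of _ "a - b"]) simp
      then show ?thesis using hull(1) x(1) by blast
    next
      case False
      have w: "w - v = u - z" using zv by (simp add: algebra_simps)
      have "x = (1 - b) *\<^sub>R v + a *\<^sub>R u + (b - a) *\<^sub>R z" unfolding xe w by (simp add: algebra_simps)
      then have "x \<in> convex hull {v, u, z}" unfolding convex_hull_3 using False ab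
        by (intro CollectI exI[of _ "1 - b"] exI[of _ a] exI[of _ "b - a"]) simp
      then show ?thesis using hull(2) x(1) by blast
    qed
  qed
  then show ?thesis unfolding corners_def using D E by (auto simp: e insert_commute)
qed

text \<open>Discharging over the triangles of a maximal extension \<open>F\<close>. In units in which a triangle is worth
  \<open>30\<close>, spread evenly over its three sides, each side in the graph costs \<open>18\<close>, and each side along a rhombus gets
  \<open>3\<close> back. A triangle with two sides in the graph then has a deficit of \<open>6\<close>. If it is half of a rhombus,
  this is covered by the two refunds. Otherwise (\<open>B - B2\<close>) it obtains \<open>6\<close> across its third side.
  A triangle with at most one side in the graph can afford to give \<open>6\<close> across each of its other sides (\<open>C\<close>), since
  \<open>30 - 18 = 2 \<cdot> 6\<close> and \<open>30 \<ge> 3 \<cdot> 6\<close>; so can the outside. The function \<open>ph\<close> is the resulting balance of a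
  single side of a triangle.\<close>

lemma edges_free_darts_vertices:
  assumes "V \<noteq> {}"
  shows "10 * card E + card free_darts + 10 \<le> 20 * card V"
proof -
  obtain F where EF: "E \<subseteq> F" and maxF: "maximal_plane_graph V F" by (rule maximal_extension)
  interpret F: maximal_plane_graph V F by (rule maxF)
  define Tr where "Tr = F.triangles"
  have finT: "finite Tr" unfolding Tr_def by (rule F.finite_triangles)
  have TrF: "{u, v} \<in> F" "{v, w} \<in> F" "{w, u} \<in> F" if "(u, v, w) \<in> Tr" for u v w
    using that unfolding Tr_def F.triangles_def by auto
  have uniq: "w = w'" if "(u, v, w) \<in> Tr" "(u, v, w') \<in> Tr" for u v w w'
    using F.apex_unique that unfolding Tr_def by blast
  have cases: "(u, v) \<in> F.hull_darts \<or> (\<exists>w. (u, v, w) \<in> Tr)" if uv: "{u, v} \<in> F" for u v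
  proof (cases "\<exists>z\<in>V. 0 < cross2 (v - u) (z - u)")
    case True
    then obtain z where z: "z \<in> V" "0 < cross2 (v - u) (z - u)" by blast
    obtain w where "(u, v, w) \<in> F.triangles" by (rule F.left_triangle_exists[OF uv z])
    then show ?thesis unfolding Tr_def by blast
  next
    case False
    then show ?thesis using uv unfolding F.hull_darts_def by (auto simp: not_less)
  qed
  \<comment> \<open>triangles with two sides in the graph, starting from the third side\<close>
  define B where "B = {(u, v, w). (u, v, w) \<in> Tr \<and> {u, v} \<notin> E \<and> {v, w} \<in> E \<and> {w, u} \<in> E}"
  \<comment> \<open>those that are halves of rhombi\<close>
  define B2 where "B2 = {(u, v, w). (u, v, w) \<in> B \<and> (\<exists>z. (v, u, z) \<in> B)}"
  \<comment> \<open>all other sides of triangles which do not belong to the graph\<close>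
  define C where "C = {(u, v, w). (u, v, w) \<in> Tr \<and> {u, v} \<notin> E \<and> (u, v, w) \<notin> B}"
  define G where "G = {(u, v, w). (u, v, w) \<in> Tr \<and> {u, v} \<in> E}"
  define R where "R = {(u, v, w). (u, v, w) \<in> Tr \<and> (u, v - u) \<in> Domain strip_step}"
  have sub: "B \<subseteq> Tr" "B2 \<subseteq> B" "C \<subseteq> Tr" "G \<subseteq> Tr" "R \<subseteq> Tr"
    unfolding B_def B2_def C_def G_def R_def by auto
  have fin: "finite B" "finite B2" "finite C" "finite G" "finite R"
    using sub finT finite_subset by metis+
  define ph where "ph t = (10 - 18 * of_bool (t \<in> G) + 3 * of_bool (t \<in> R) + 6 * of_bool (t \<in> B - B2) - 6 * of_bool (t \<in> C) :: int)" for t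
  define rot where "rot = (\<lambda>(u::real^2, v::real^2, w::real^2). (v, w, u))"
  have rotTr: "rot t \<in> Tr" if "t \<in> Tr" for t
    using that F.triangles_rotate unfolding Tr_def rot_def by (cases t) auto
  have bij: "bij_betw rot Tr Tr"
    unfolding bij_betw_def
  proof
    show "inj_on rot Tr" unfolding inj_on_def rot_def by auto
    then show "rot ` Tr = Tr" using rotTr finT by (intro endo_inj_surj) auto
  qed
  have nonneg: "0 \<le> ph t + ph (rot t) + ph (rot (rot t))" if tT: "t \<in> Tr" for t
  proof -
    obtain u v w where t: "t = (u, v, w)" by (cases t)
    have rt: "rot t = (v, w, u)" "rot (rot t) = (w, u, v)" unfolding t rot_def by simp_all
    have T3: "(u, v, w) \<in> Tr" "(v, w, u) \<in> Tr" "(w, u, v) \<in> Tr"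
  proof -
      show "(u, v, w) \<in> Tr" using tT unfolding t .
      show "(v, w, u) \<in> Tr" using rotTr[OF tT] unfolding rt(1) .
      show "(w, u, v) \<in> Tr" using rotTr[OF rotTr[OF tT]] unfolding rt(2) .
    qed
    have main: "0 \<le> ph (u, v, w) + ph (v, w, u) + ph (w, u, v)"
      if T: "(u, v, w) \<in> Tr" "(v, w, u) \<in> Tr" "(w, u, v) \<in> Tr" and E: "{u, v} \<notin> E" "{v, w} \<in> E" "{w, u} \<in> E" for u v w
    proof -
      have B: "(u, v, w) \<in> B" using T E unfolding B_def by simp
      have G: "(v, w, u) \<in> G" "(w, u, v) \<in> G" "(u, v, w) \<notin> G" using T E unfolding G_def by simp_all
      have nB: "(v, w, u) \<notin> B" "(w, u, v) \<notin> B" using E unfolding B_def by simp_all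
      have nC: "(u, v, w) \<notin> C" "(v, w, u) \<notin> C" "(w, u, v) \<notin> C" using B E unfolding C_def by simp_all
      show ?thesis
      proof (cases "(u, v, w) \<in> B2")
        case True
        then obtain z where z: "(v, u, z) \<in> B" unfolding B2_def by blast
        then have z': "(v, u, z) \<in> Tr" "{u, z} \<in> E" "{z, v} \<in> E" unfolding B_def by simp_all
        have c: "(v, w - v, z - v) \<in> corners"
          using rhombus_from_triangles[OF F.plane_graph_axioms _ _ E(2,3) z'(2,3)] T(1) z'(1) unfolding Tr_def by blast
        have s: "0 < cross2 (v - u) (w - u)" "0 < cross2 (u - v) (z - v)"
          using T(1) z'(1) unfolding Tr_def F.triangles_def by auto
        have zv: "z - v = u - w"
          using isosceles_apexes[OF _ _ _ _ s] unit[OF E(2)] unit[OF E(3)] unit[OF z'(2)] unit[OF z'(3)]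
          by (simp add: dist_commute)
        have "(v + (w - v), z - v, - (w - v)) \<in> corners" by (rule corners_rotate[OF c])
        then have "(w, u - w, v - w) \<in> corners" unfolding zv by simp
        then have "(v, w - v) \<in> Domain strip_step" "(w, u - w) \<in> Domain strip_step"
          using strip_stepI[OF c] strip_stepI[of w "u - w" "v - w"] by blast+
        then have "(v, w, u) \<in> R" "(w, u, v) \<in> R" using T unfolding R_def by simp_all
        then show ?thesis using True G nB nC unfolding ph_def by simp
      next
        case False
        then show ?thesis using B G nB nC unfolding ph_def by simp
      qed
    qed
    have few: "0 \<le> ph (u, v, w) + ph (v, w, u) + ph (w, u, v)"
      if T: "(u, v, w) \<in> Tr" "(v, w, u) \<in> Tr" "(w, u, v) \<in> Tr" and E: "{v, w} \<notin> E" "{w, u} \<notin> E" for u v w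
    proof -
      have m: "(u, v, w) \<notin> B" "(v, w, u) \<notin> B" "(w, u, v) \<notin> B" "(v, w, u) \<notin> G" "(w, u, v) \<notin> G"
        using E unfolding B_def G_def by simp_all
      have "\<not> ((u, v, w) \<in> G \<and> (u, v, w) \<in> C)" unfolding G_def C_def by simp
      then have "- 8 \<le> ph (u, v, w)" unfolding ph_def using m(1)
        by (cases "(u, v, w) \<in> G"; cases "(u, v, w) \<in> C"; cases "(u, v, w) \<in> R") simp_all
      moreover have "4 \<le> ph (v, w, u)" unfolding ph_def using m(2,4)
        by (cases "(v, w, u) \<in> C"; cases "(v, w, u) \<in> R") simp_all
      moreover have "4 \<le> ph (w, u, v)" unfolding ph_def using m(3,5)
        by (cases "(w, u, v) \<in> C"; cases "(w, u, v) \<in> R") simp_all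
      ultimately show ?thesis by linarith
    qed
    have not3: "\<not> ({u, v} \<in> E \<and> {v, w} \<in> E \<and> {w, u} \<in> E)"
      using no_triangle[of u v w] by (auto simp: insert_commute)
    have "0 \<le> ph (u, v, w) + ph (v, w, u) + ph (w, u, v)"
    proof -
      consider "{v, w} \<notin> E" "{w, u} \<notin> E" | "{w, u} \<notin> E" "{u, v} \<notin> E" | "{u, v} \<notin> E" "{v, w} \<notin> E"
        | "{u, v} \<notin> E" "{v, w} \<in> E" "{w, u} \<in> E" | "{v, w} \<notin> E" "{w, u} \<in> E" "{u, v} \<in> E"
        | "{w, u} \<notin> E" "{u, v} \<in> E" "{v, w} \<in> E" using not3 by blast
      then show ?thesis
      proof cases
        case 1 then show ?thesis using few[OF T3] by simp
      next
        case 2 then show ?thesis using few[OF T3(2,3,1)] by simp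
      next
        case 3 then show ?thesis using few[OF T3(3,1,2)] by simp
      next
        case 4 then show ?thesis using main[OF T3] by simp
      next
        case 5 then show ?thesis using main[OF T3(2,3,1)] by simp
      next
        case 6 then show ?thesis using main[OF T3(3,1,2)] by simp
      qed
    qed
    then show ?thesis unfolding rt(2) unfolding rt(1) unfolding t .
  qed
  have "0 \<le> (\<Sum>t\<in>Tr. ph t + ph (rot t) + ph (rot (rot t)))" by (rule sum_nonneg) (rule nonneg)
  also have "\<dots> = (\<Sum>t\<in>Tr. ph t) + (\<Sum>t\<in>Tr. ph (rot t)) + (\<Sum>t\<in>Tr. ph (rot (rot t)))"
    by (simp add: sum.distrib)
  also have "(\<Sum>t\<in>Tr. ph (rot (rot t))) = (\<Sum>t\<in>Tr. ph (rot t))"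
    by (rule sum.reindex_bij_betw[OF bij])
  also have "(\<Sum>t\<in>Tr. ph (rot t)) = (\<Sum>t\<in>Tr. ph t)" by (rule sum.reindex_bij_betw[OF bij])
  finally have sum0: "0 \<le> (\<Sum>t\<in>Tr. ph t)" by simp
  have count: "(\<Sum>t\<in>Tr. of_bool (t \<in> S)) = int (card S)" if S: "S \<subseteq> Tr" for S
  proof -
    have "(\<Sum>t\<in>Tr. of_bool (t \<in> S)) = (\<Sum>t\<in>S. of_bool (t \<in> S) :: int)"
      by (rule sum.mono_neutral_right[OF finT S]) simp
    also have "\<dots> = int (card S)" by simp
    finally show ?thesis .
  qed
  have "(\<Sum>t\<in>Tr. ph t) = 10 * int (card Tr) - 18 * (\<Sum>t\<in>Tr. of_bool (t \<in> G)) + 3 * (\<Sum>t\<in>Tr. of_bool (t \<in> R))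
      + 6 * (\<Sum>t\<in>Tr. of_bool (t \<in> B - B2)) - 6 * (\<Sum>t\<in>Tr. of_bool (t \<in> C))"
    unfolding ph_def sum.distrib sum_subtractf sum_distrib_left by simp
  also have "\<dots> = 10 * int (card Tr) - 18 * int (card G) + 3 * int (card R) + 6 * int (card (B - B2)) - 6 * int (card C)"
  proof -
    have "B - B2 \<subseteq> Tr" using sub(1) by blast
    then show ?thesis unfolding count[OF sub(4)] count[OF sub(5)] count[OF sub(3)] by (simp only: count)
  qed
  finally have "(\<Sum>t\<in>Tr. ph t) = 10 * int (card Tr) - 18 * int (card G) + 3 * int (card R) + 6 * int (card (B - B2)) - 6 * int (card C)" .
  then have disch: "18 * card G + 6 * card C \<le> 10 * card Tr + 3 * card R + 6 * card (B - B2)" using sum0 by linarith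
  \<comment> \<open>across the third side of a triangle in \<open>B - B2\<close> lies a side in \<open>C\<close> or the outside (\<open>Nh\<close>)\<close>
  define Nh where "Nh = {x \<in> F.hull_darts. {fst x, snd x} \<notin> E}"
  define Eh where "Eh = {x \<in> F.hull_darts. {fst x, snd x} \<in> E}"
  have finH: "finite Nh" "finite Eh" unfolding Nh_def Eh_def using F.finite_hull_darts by simp_all
  have cardH: "card F.hull_darts = card Nh + card Eh"
  proof -
    have "F.hull_darts = Nh \<union> Eh" "Nh \<inter> Eh = {}" unfolding Nh_def Eh_def by auto
    then show ?thesis using finH card_Un_disjoint by metis
  qed
  have "card (B - B2) \<le> card C + card Nh"
  proof -
    let ?f = "\<lambda>(u::real^2, v::real^2, w::real^2). (v, u)"
    have "inj_on ?f (B - B2)" using uniq unfolding inj_on_def B_def by auto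
    then have "card (B - B2) = card (?f ` (B - B2))" by (simp add: card_image)
    also have "?f ` (B - B2) \<subseteq> (\<lambda>(u, v, w). (u, v)) ` C \<union> Nh"
    proof
      fix y assume "y \<in> ?f ` (B - B2)"
      then obtain u v w where y: "y = (v, u)" and t: "(u, v, w) \<in> B" "(u, v, w) \<notin> B2" by auto
      have vu: "{v, u} \<in> F" "{v, u} \<notin> E" using t(1) TrF[of u v w] unfolding B_def by (auto simp: insert_commute)
      from cases[OF vu(1)] show "y \<in> (\<lambda>(u, v, w). (u, v)) ` C \<union> Nh"
      proof
        assume "(v, u) \<in> F.hull_darts"
        then show ?thesis using vu(2) y unfolding Nh_def by simp
      next
        assume "\<exists>z. (v, u, z) \<in> Tr"
        then obtain z where z: "(v, u, z) \<in> Tr" by blast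
        have "(v, u, z) \<notin> B" using t unfolding B2_def by blast
        then have "(v, u, z) \<in> C" using z vu(2) unfolding C_def by simp
        then show ?thesis using y by force
      qed
    qed
    then have "card (?f ` (B - B2)) \<le> card ((\<lambda>(u, v, w). (u, v)) ` C \<union> Nh)"
      using fin finH by (intro card_mono) auto
    also have "\<dots> \<le> card ((\<lambda>(u, v, w). (u, v)) ` C) + card Nh" by (rule card_Un_le)
    also have "\<dots> \<le> card C + card Nh" using card_image_le[OF fin(3)] by simp
    finally show ?thesis using \<open>card (B - B2) = card (?f ` (B - B2))\<close> by simp
  qed
  moreover have "2 * card E \<le> card G + card Eh"
  proof -
    have "darts \<subseteq> (\<lambda>(u, v, w). (u, v - u)) ` G \<union> (\<lambda>(u, v). (u, v - u)) ` Eh"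
    proof
      fix x assume "x \<in> darts"
      then obtain p d where x: "x = (p, d)" "{p, p + d} \<in> E" unfolding darts_def by blast
      have "{p, p + d} \<in> F" using x EF by blast
      from cases[OF this] show "x \<in> (\<lambda>(u, v, w). (u, v - u)) ` G \<union> (\<lambda>(u, v). (u, v - u)) ` Eh"
      proof
        assume "(p, p + d) \<in> F.hull_darts"
        then have "(p, p + d) \<in> Eh" using x(2) unfolding Eh_def by simp
        then have "(\<lambda>(u, v). (u, v - u)) (p, p + d) \<in> (\<lambda>(u, v). (u, v - u)) ` Eh" by (rule imageI)
        then show ?thesis using x(1) by simp
      next
        assume "\<exists>w. (p, p + d, w) \<in> Tr"
        then obtain w where "(p, p + d, w) \<in> G" using x(2) unfolding G_def by blast
        then have "(\<lambda>(u, v, w). (u, v - u)) (p, p + d, w) \<in> (\<lambda>(u, v, w). (u, v - u)) ` G" by (rule imageI)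
        then show ?thesis using x(1) by simp
      qed
    qed
    then have "card darts \<le> card ((\<lambda>(u, v, w). (u, v - u)) ` G \<union> (\<lambda>(u, v). (u, v - u)) ` Eh)"
      using fin finH by (intro card_mono) auto
    also have "\<dots> \<le> card ((\<lambda>(u, v, w). (u, v - u)) ` G) + card ((\<lambda>(u, v). (u, v - u)) ` Eh)" by (rule card_Un_le)
    also have "\<dots> \<le> card G + card Eh" by (intro add_mono card_image_le fin finH)
    finally show ?thesis by (simp add: card_darts)
  qed
  moreover have "card R + card free_darts \<le> 2 * card E"
  proof -
  have "card R \<le> card (Domain strip_step)"
  proof (rule card_inj_on_le)
    show "inj_on (\<lambda>(u, v, w). (u, v - u)) R" using uniq unfolding inj_on_def R_def by auto
    show "(\<lambda>(u, v, w). (u, v - u)) ` R \<subseteq> Domain strip_step" unfolding R_def by auto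
    show "finite (Domain strip_step)" by (rule finite_subset[OF Domain_strip_step finite_darts])
  qed
  moreover have "card (Domain strip_step) + card free_darts = 2 * card E"
  proof -
    have "darts = Domain strip_step \<union> free_darts" "Domain strip_step \<inter> free_darts = {}"
      using Domain_strip_step unfolding free_darts_def by auto
    then have "card darts = card (Domain strip_step) + card free_darts"
      using finite_darts by (metis card_Un_disjoint finite_Un)
    then show ?thesis by (simp add: card_darts)
  qed
  ultimately show ?thesis by linarith
  qed
  moreover have "card Tr + 3 * (card Nh + card Eh) + 3 \<le> 6 * card V"
    using F.card_triangles_hull_darts[OF assms] unfolding Tr_def cardH .
  moreover have arith: "10 * e + L + 10 \<le> 20 * n"
    if "b \<le> c + nh" "2 * e \<le> g + eh" "r + L \<le> 2 * e" "t + 3 * (nh + eh) + 3 \<le> 6 * n" "18 * g + 6 * c \<le> 10 * t + 3 * r + 6 * b"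
    for b c nh e g eh r L t n :: nat
  proof -
    have "36 * e \<le> 18 * g + 18 * eh" using that(2) by simp
    moreover have "18 * g \<le> 10 * t + 3 * r + 6 * nh" using that(1,5) by simp
    moreover have "3 * r + 3 * L \<le> 6 * e" using that(3) by simp
    moreover have "10 * t + 30 * nh + 30 * eh + 30 \<le> 60 * n" using that(4) by simp
    ultimately have "30 * e + 3 * L + 30 \<le> 60 * n" by linarith
    then show ?thesis by simp
  qed
  ultimately show ?thesis using disch by blast
qed

text \<open>The two estimates combined; \<open>s\<^sup>2 = 2n\<close>, and the claim is \<open>e \<le> s\<^sup>2 - s/5\<close>.\<close>

lemma edge_bound:
  assumes "V \<noteq> {}"
  shows "real (card E) \<le> 2 * real (card V) - sqrt 2 / 5 * sqrt (real (card V))"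
proof (rule ccontr)
  assume contr: "\<not> ?thesis"
  define s where "s = sqrt (2 * real (card V))"
  define L where "L = real (card free_darts)"
  define e where "e = real (card E)"
  have s2: "s * s = 2 * real (card V)" "0 \<le> s" unfolding s_def by simp_all
  have "sqrt 2 / 5 * sqrt (real (card V)) = s / 5" unfolding s_def by (simp add: real_sqrt_mult)
  then have e: "s * s - s / 5 < e" using contr s2 unfolding e_def by simp
  have "real (10 * card E + card free_darts + 10) \<le> real (20 * card V)"
    using edges_free_darts_vertices[OF assms] by (simp only: of_nat_le_iff)
  then have 1: "10 * e + L + 10 \<le> 10 * (s * s)" unfolding e_def L_def s2(1) by simp
  have "real (4 * card E) \<le> real (card free_darts * card free_darts + card free_darts)"
    using card_edges_le_free_darts by (simp only: of_nat_le_iff)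
  then have 2: "4 * e \<le> L * L + L" unfolding e_def L_def by simp
  have L: "0 \<le> L" "L \<le> 2 * s - 10" using 1 e unfolding L_def by simp_all
  have "L * L \<le> (2 * s - 10) * (2 * s - 10)" using L by (intro mult_mono) auto
  then have "4 * e \<le> 4 * (s * s) - 38 * s + 90" using 2 L by (simp add: algebra_simps)
  then show False using e L by simp
qed

end

lemma matchstick_graph_edge_bound:
  assumes ms: "matchstick_graph V E" and tf: "triangle_free E" and "V \<noteq> {}"
  shows "real (card E) \<le> 2 * real (card V) - sqrt 2 / 5 * sqrt (real (card V))"
proof -
  have sg: "simple_graph V E" using ms by (simp add: matchstick_graph_def)
  have ne: "u \<noteq> v" if uv: "{u, v} \<in> E" for u v
  proof -
    from uv sg obtain x y where "x \<noteq> y" "{u, v} = {x, y}" unfolding simple_graph_def by blast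
    then show ?thesis by (auto simp: doubleton_eq_iff)
  qed
  interpret matchstick V E
  proof
    show "simple_graph V E" by (rule sg)
    show "x \<in> e" if "e \<in> E" "x \<in> V" "x \<in> convex hull e" for e x
      using ms that by (simp add: matchstick_graph_def)
    show "x \<in> e \<and> x \<in> f" if "e \<in> E" "f \<in> E" "e \<noteq> f" "x \<in> convex hull e" "x \<in> convex hull f" for e f x
    proof -
      have "convex hull e \<inter> convex hull f \<subseteq> e \<inter> f" using ms that(1-3) by (simp add: matchstick_graph_def)
      then show ?thesis using that(4,5) by blast
    qed
    show "dist u v = 1" if "{u, v} \<in> E" for u v
      using ms that by (simp add: matchstick_graph_def)
    show False if "{a, b} \<in> E" "{b, c} \<in> E" "{a, c} \<in> E" for a b c
      using tf[unfolded triangle_free_def] that ne[OF that(1)] ne[OF that(2)] ne[OF that(3)] by metis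
  qed
  show ?thesis by (rule edge_bound[OF assms(3)])
qed

lemma max_edges_upper:
  assumes "n \<ge> 1"
  shows "real (max_edges n) \<le> 2 * real n - sqrt 2 / 5 * sqrt (real n)"
proof -
  have "max_edges n \<in> edge_counts n"
    unfolding max_edges_def by (rule Max_in[OF finite_edge_counts edge_counts_nonempty])
  then obtain V E where VE: "max_edges n = card E" "matchstick_graph V E" "triangle_free E" "card V = n"
    unfolding edge_counts_def by blast
  have "V \<noteq> {}" using VE(4) assms by auto
  then show ?thesis using matchstick_graph_edge_bound[OF VE(2,3)] VE(1,4) by simp
qed

section \<open>Rhombus tilings of zonogons\<close>

text \<open>The unit vector of slope \<open>k\<close>.\<close>

definition dir :: "nat \<Rightarrow> real ^ 2" where
  "dir k = (1 / sqrt (1 + (real k)\<^sup>2)) *\<^sub>R vector [1, real k]"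

text \<open>The part of step \<open>k\<close> that has been covered at time \<open>t\<close>, if step \<open>k\<close> is taken between the times \<open>k\<close> and
  \<open>k + 1\<close>.\<close>

definition clamp01 :: "nat \<Rightarrow> real \<Rightarrow> real" where
  "clamp01 k t = max 0 (min 1 (t - real k))"

text \<open>The displacement between the times \<open>s\<close> and \<open>t\<close> on the convex polygonal curve with the successive steps
  \<open>dir 0\<close>, \<open>dir 1\<close>, and so on. At integer times these are the vertices of the tiling, and its edges arise if one
  of the two times runs through a unit interval.\<close>

definition zono :: "nat \<Rightarrow> real \<Rightarrow> real \<Rightarrow> real ^ 2" where
  "zono M s t = (\<Sum>k<M. (clamp01 k t - clamp01 k s) *\<^sub>R dir k)"

lemma sqrt_pos: "0 < sqrt (1 + (real k)\<^sup>2)"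
  using zero_le_power2[of "real k"] by (simp add: add_pos_nonneg)

lemma norm_dir: "norm (dir k) = 1"
proof -
  define c where "c = 1 + (real k)\<^sup>2"
  have c: "0 < c" unfolding c_def by (simp add: add_pos_nonneg)
  have "dir k \<bullet> dir k = (1 / sqrt c) * ((1 / sqrt c) * ((vector [1, real k] :: real ^ 2) \<bullet> vector [1, real k]))"
    unfolding dir_def c_def by (simp only: inner_scaleR_left inner_scaleR_right)
  also have "(vector [1, real k] :: real ^ 2) \<bullet> vector [1, real k] = c"
    unfolding c_def by (simp add: inner_vec_def sum_2 power2_eq_square)
  also have "(1 / sqrt c) * ((1 / sqrt c) * c) = 1" using c by (simp add: real_div_sqrt)
  finally show ?thesis by (simp add: norm_eq_1)
qed

lemma dir_1_pos: "0 < dir k $ 1"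
  using sqrt_pos[of k] unfolding dir_def by simp

lemma cross2_dir: "cross2 (dir m) (dir k) = (real k - real m) / (sqrt (1 + (real m)\<^sup>2) * sqrt (1 + (real k)\<^sup>2))"
  unfolding dir_def cross2_def by (simp add: diff_divide_distrib)

lemma cross2_dir_pos: "m < k \<Longrightarrow> 0 < cross2 (dir m) (dir k)"
  unfolding cross2_dir using sqrt_pos by simp

lemma cross2_dir_neg: "k < m \<Longrightarrow> cross2 (dir m) (dir k) < 0"
  using cross2_dir_pos[of k m] cross2_commute[of "dir m" "dir k"] by simp

lemma cross2_sum_right: "cross2 a (sum f S) = (\<Sum>x\<in>S. cross2 a (f x))"
  unfolding cross2_def by (simp add: sum_distrib_left sum_subtractf)

lemma clamp01_mono: "s \<le> t \<Longrightarrow> clamp01 k s \<le> clamp01 k t"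
  unfolding clamp01_def by (simp add: max_def min_def)

lemma clamp01_full:
  assumes "s < t" "clamp01 k t - clamp01 k s = t - s"
  shows "real k \<le> s" "t \<le> real k + 1"
  using assms unfolding clamp01_def by (auto simp: max_def min_def split: if_splits)

lemma clamp01_before: "t \<le> real k \<Longrightarrow> clamp01 k t = 0"
  unfolding clamp01_def by simp

lemma clamp01_after: "real k + 1 \<le> t \<Longrightarrow> clamp01 k t = 1"
  unfolding clamp01_def by simp

lemma sum_clamp01: "0 \<le> t \<Longrightarrow> (\<Sum>k<M. clamp01 k t) = min t (real M)"
proof (induction M)
  case (Suc M)
  then show ?case by (simp add: clamp01_def max_def min_def)
qed simp

lemma clamp01_affine:
  assumes "0 \<le> l" "l \<le> 1"
  shows "clamp01 k (real a + l) = (1 - l) * clamp01 k (real a) + l * clamp01 k (real a + 1)"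
proof -
  consider "k < a" | "k = a" | "a < k" by linarith
  then show ?thesis
  proof cases
    case 1
    then have "real k + 1 \<le> real a" by linarith
    then show ?thesis using assms by (simp add: clamp01_after)
  next
    case 2
    then show ?thesis using assms by (simp add: clamp01_def)
  next
    case 3
    then have "real a + 1 \<le> real k" by linarith
    then show ?thesis using assms by (simp add: clamp01_before)
  qed
qed

lemma zono_affine_right:
  assumes "0 \<le> l" "l \<le> 1"
  shows "zono M s (real a + l) = (1 - l) *\<^sub>R zono M s (real a) + l *\<^sub>R zono M s (real a + 1)"
  unfolding zono_def clamp01_affine[OF assms] scaleR_sum_right sum.distrib[symmetric]
  by (rule sum.cong[OF refl]) (simp add: algebra_simps)

lemma zono_affine_left:
  assumes "0 \<le> l" "l \<le> 1"
  shows "zono M (real a + l) t = (1 - l) *\<^sub>R zono M (real a) t + l *\<^sub>R zono M (real a + 1) t"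
  unfolding zono_def clamp01_affine[OF assms] scaleR_sum_right sum.distrib[symmetric]
  by (rule sum.cong[OF refl]) (simp add: algebra_simps)

lemma zono_self [simp]: "zono M s s = 0"
  unfolding zono_def by simp

lemma zono_step:
  assumes "j < M"
  shows "zono M (real j) (real j + 1) = dir j"
proof -
  have "clamp01 k (real j + 1) - clamp01 k (real j) = of_bool (k = j)" for k
  proof -
    consider "k < j" | "k = j" | "j < k" by linarith
    then show ?thesis
    proof cases
      case 1 then have "real k + 1 \<le> real j" by linarith
      then show ?thesis using 1 by (simp add: clamp01_after)
    next
      case 2 then show ?thesis by (simp add: clamp01_def)
    next
      case 3 then have "real j + 1 \<le> real k" by linarith
      then show ?thesis using 3 by (simp add: clamp01_before)
    qed
  qed
  then have "zono M (real j) (real j + 1) = (\<Sum>k<M. of_bool (k = j) *\<^sub>R dir k)" unfolding zono_def by simp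
  also have "\<dots> = (\<Sum>k<M. if k = j then dir k else 0)" by (rule sum.cong) auto
  also have "\<dots> = dir j" using assms by simp
  finally show ?thesis .
qed

lemma zono_add: "zono M s t + zono M t u = zono M s u"
  unfolding zono_def sum.distrib[symmetric] scaleR_left_distrib[symmetric] by simp

text \<open>The curve turns left. Compare all steps with the direction \<open>dir m\<close> of the step under way at time
  \<open>b\<close>: the displacement from \<open>a\<close> to \<open>b\<close> does not point to its left and that from \<open>c\<close> to \<open>e\<close> does not point
  to its right. As they are equal, both are parallel to \<open>dir m\<close>, hence part of this one step.\<close>

lemma zono_parallel_increments:
  assumes a: "0 \<le> a" "a \<le> b" "b \<le> c" "c \<le> e" "e \<le> real M" and eq: "zono M a b = zono M c e"
  shows "(a = b \<and> c = e) \<or> (\<exists>m::nat. real m \<le> a \<and> e \<le> real m + 1)"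
proof -
  define m where "m = nat \<lfloor>b\<rfloor>"
  have m: "real m \<le> b" "b < real m + 1" using a unfolding m_def by (simp_all add: of_nat_nat)
  define u where "u k = clamp01 k b - clamp01 k a" for k
  define v where "v k = clamp01 k e - clamp01 k c" for k
  have u0: "0 \<le> u k" and v0: "0 \<le> v k" for k unfolding u_def v_def using clamp01_mono a by simp_all
  have uk: "u k = 0" if "m < k" for k
  proof -
    have "b \<le> real k" using that m by linarith
    then show ?thesis using a unfolding u_def by (simp add: clamp01_before)
  qed
  have vk: "v k = 0" if "k < m" for k
  proof -
    have "real k + 1 \<le> c" using that m a by linarith
    then show ?thesis using a unfolding v_def by (simp add: clamp01_after)
  qed
  have "(\<Sum>k<M. u k * cross2 (dir m) (dir k)) = (\<Sum>k<M. v k * cross2 (dir m) (dir k))"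
    using arg_cong[OF eq, of "cross2 (dir m)"] unfolding zono_def u_def v_def by (simp add: cross2_sum_right cross2_simps)
  moreover have ul: "u k * cross2 (dir m) (dir k) \<le> 0" for k
    using u0[of k] uk[of k] cross2_dir_neg[of k m] by (cases "m < k"; cases "k = m") (auto simp: mult_le_0_iff)
  moreover have vl: "0 \<le> v k * cross2 (dir m) (dir k)" for k
    using v0[of k] vk[of k] cross2_dir_pos[of m k] by (cases "k < m"; cases "k = m") (auto simp: zero_le_mult_iff)
  moreover have "(\<Sum>k<M. u k * cross2 (dir m) (dir k)) \<le> 0" by (rule sum_nonpos) (rule ul)
  moreover have "0 \<le> (\<Sum>k<M. v k * cross2 (dir m) (dir k))" by (rule sum_nonneg) (rule vl)
  ultimately have "(\<Sum>k<M. u k * cross2 (dir m) (dir k)) = 0" "(\<Sum>k<M. v k * cross2 (dir m) (dir k)) = 0"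
    by linarith+
  then have z: "(\<Sum>k<M. - (u k * cross2 (dir m) (dir k))) = 0" "(\<Sum>k<M. v k * cross2 (dir m) (dir k)) = 0"
    by (simp_all add: sum_negf)
  have uz: "u k = 0" if "k < M" "k \<noteq> m" for k
  proof -
    have "- (u k * cross2 (dir m) (dir k)) = 0"
      using z(1) ul that(1) by (subst (asm) sum_nonneg_eq_0_iff) auto
    moreover have "cross2 (dir m) (dir k) \<noteq> 0"
      using cross2_dir_pos[of m k] cross2_dir_neg[of k m] that(2) by (cases "k < m") auto
    ultimately show ?thesis by simp
  qed
  have vz: "v k = 0" if "k < M" "k \<noteq> m" for k
  proof -
    have "v k * cross2 (dir m) (dir k) = 0"
      using z(2) vl that(1) by (subst (asm) sum_nonneg_eq_0_iff) auto
    moreover have "cross2 (dir m) (dir k) \<noteq> 0"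
      using cross2_dir_pos[of m k] cross2_dir_neg[of k m] that(2) by (cases "k < m") auto
    ultimately show ?thesis by simp
  qed
  have only: "(\<Sum>k<M. x k) = (if m < M then x m else 0)" if "\<And>k. k < M \<Longrightarrow> k \<noteq> m \<Longrightarrow> x k = 0" for x :: "nat \<Rightarrow> real"
  proof -
    have "(\<Sum>k<M. x k) = (\<Sum>k<M. if k = m then x k else 0)" by (rule sum.cong) (use that in auto)
    then show ?thesis by simp
  qed
  have su: "(\<Sum>k<M. u k) = b - a" and sv: "(\<Sum>k<M. v k) = e - c"
    unfolding u_def v_def sum_subtractf using a by (simp_all add: sum_clamp01)
  have ou: "(if m < M then u m else 0) = b - a"
  proof -
    have "(\<Sum>k<M. u k) = (if m < M then u m else 0)" by (rule only) (rule uz)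
    then show ?thesis using su by (rule trans[OF sym])
  qed
  have ov: "(if m < M then v m else 0) = e - c"
  proof -
    have "(\<Sum>k<M. v k) = (if m < M then v m else 0)" by (rule only) (rule vz)
    then show ?thesis using sv by (rule trans[OF sym])
  qed
  have "(\<Sum>k<M. u k *\<^sub>R dir k) = (\<Sum>k<M. v k *\<^sub>R dir k)" using eq unfolding zono_def u_def v_def .
  then have "(\<Sum>k<M. u k *\<^sub>R dir k) $ 1 = (\<Sum>k<M. v k *\<^sub>R dir k) $ 1" by simp
  then have "(\<Sum>k<M. u k * dir k $ 1) = (\<Sum>k<M. v k * dir k $ 1)" by simp
  then have uv: "m < M \<Longrightarrow> u m = v m"
    using only[of "\<lambda>k. u k * dir k $ 1"] only[of "\<lambda>k. v k * dir k $ 1"] uz vz dir_1_pos[of m] by simp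
  show ?thesis
  proof (cases "a = b")
    case True
    then have "u m = 0" unfolding u_def by simp
    then have "e - c = 0" using ov uv by (cases "m < M") simp_all
    then show ?thesis using True by simp
  next
    case False
    then have "b - a \<noteq> 0" by simp
    then have mM: "m < M" and ba: "u m = b - a" using ou by (auto split: if_splits)
    have ec: "v m = e - c" using ov mM by simp
    have "c < e" using ec uv[OF mM] ba False a by linarith
    then have "e \<le> real m + 1" using clamp01_full(2)[of c e m] ec unfolding v_def by simp
    moreover have "real m \<le> a" using clamp01_full(1)[of a b m] ba False a unfolding u_def by simp
    ultimately show ?thesis by blast
  qed
qed

text \<open>If one time interval contains the other one, compare the first coordinates, which increase along the curve. Otherwise the
  intervals are shifted against each other; cancelling the common part leaves equal displacements over
  disjoint intervals, and \<open>zono_parallel_increments\<close> applies. On the edges of the tiling the first time is an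
  integer or the interval has length at least one, and this excludes two different intervals inside one
  step. Empty intervals all give the origin.\<close>

lemma zono_inj:
  assumes st: "0 \<le> s" "s \<le> t" "t \<le> real M" "s \<in> \<nat> \<or> s + 1 \<le> t"
    and st': "0 \<le> s'" "s' \<le> t'" "t' \<le> real M" "s' \<in> \<nat> \<or> s' + 1 \<le> t'"
    and eq: "zono M s t = zono M s' t'"
  shows "s = s' \<and> t = t' \<or> s = t \<and> s' = t'"
proof -
  have nested: "s = s' \<and> t = t'"
    if "s \<le> s'" "t' \<le> t" "0 \<le> s" "s' \<le> t'" "t \<le> real M" "zono M s t = zono M s' t'" for s t s' t'
  proof -
    define u where "u k = (clamp01 k t - clamp01 k t') + (clamp01 k s' - clamp01 k s)" for k
    have u0: "0 \<le> u k" for k unfolding u_def using clamp01_mono that(1,2) by (simp add: add_nonneg_nonneg)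
    have "(\<Sum>k<M. u k *\<^sub>R dir k) = zono M s t - zono M s' t'"
      unfolding zono_def u_def sum_subtractf[symmetric] scaleR_left_diff_distrib[symmetric]
      by (rule sum.cong[OF refl]) (simp add: algebra_simps)
    then have "(\<Sum>k<M. u k *\<^sub>R dir k) $ 1 = 0" using that(6) by simp
    then have "(\<Sum>k<M. u k * dir k $ 1) = 0" by simp
    moreover have "0 \<le> u k * dir k $ 1" for k using u0[of k] dir_1_pos[of k] by simp
    ultimately have "u k * dir k $ 1 = 0" if "k < M" for k
      using that by (subst (asm) sum_nonneg_eq_0_iff) auto
    then have "u k = 0" if "k < M" for k using that dir_1_pos[of k] by force
    then have "(\<Sum>k<M. u k) = 0" by simp
    moreover have "(\<Sum>k<M. u k) = (t - t') + (s' - s)"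
      unfolding u_def sum.distrib sum_subtractf using that(1-5) by (simp add: sum_clamp01)
    ultimately show ?thesis using that(1,2) by linarith
  qed
  have shifted: "s = t \<and> s' = t'"
    if lt: "s < s'" "t < t'" and st: "0 \<le> s" "s \<le> t" "s \<in> \<nat> \<or> s + 1 \<le> t"
      and st': "s' \<le> t'" "t' \<le> real M" "s' \<in> \<nat> \<or> s' + 1 \<le> t'"
      and eq: "zono M s t = zono M s' t'" for s t s' t'
  proof -
    define b c where "b = min t s'" and "c = max t s'"
    have bc: "s \<le> b" "b \<le> c" "c \<le> t'" using lt st st' unfolding b_def c_def by auto
    have "zono M s b = zono M c t'"
    proof (cases "t \<le> s'")
      case True
      then show ?thesis using eq unfolding b_def c_def by (simp add: min_def max_def)
    next
      case False
      then have bc: "b = s'" "c = t" unfolding b_def c_def by auto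
      have "zono M s s' + zono M s' t = zono M s t" by (rule zono_add)
      moreover have "zono M s' t + zono M t t' = zono M s' t'" by (rule zono_add)
      ultimately have "zono M s s' + zono M s' t = zono M t t' + zono M s' t" using eq by (simp add: add.commute)
      then show ?thesis unfolding bc by simp
    qed
    have "(s = b \<and> c = t') \<or> (\<exists>m::nat. real m \<le> s \<and> t' \<le> real m + 1)"
      by (rule zono_parallel_increments[OF st(1) bc st'(2) \<open>zono M s b = zono M c t'\<close>])
    then show ?thesis
    proof (elim disjE exE conjE)
      assume "s = b" "c = t'"
      then show ?thesis using lt unfolding b_def c_def by (auto simp: min_def max_def split: if_splits)
    next
      fix m :: nat assume m: "real m \<le> s" "t' \<le> real m + 1"
      have "s' \<in> \<nat>" using st'(3) m lt by linarith
      then obtain i :: nat where i: "s' = real i" by (rule Nats_cases)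
      have "m < i" using m lt i by simp
      then have "s' = t'" using m st'(1) i by simp
      then have "zono M s t = zono M s s" using eq by simp
      then have "s = s \<and> t = s" using nested[of s s s t] st lt st'(2) by simp
      then show ?thesis using \<open>s' = t'\<close> by simp
    qed
  qed
  consider "s \<le> s'" "t' \<le> t" | "s' \<le> s" "t \<le> t'" | "s < s'" "t < t'" | "s' < s" "t' < t" by linarith
  then show ?thesis
  proof cases
    case 1 then show ?thesis using nested[OF 1 st(1) st'(2) st(3) eq] by simp
  next
    case 2 then show ?thesis using nested[OF 2 st'(1) st(2) st'(3) eq[symmetric]] by simp
  next
    case 3 then show ?thesis using shifted[OF 3 st(1,2,4) st'(2,3,4) eq] by simp
  next
    case 4 then show ?thesis using shifted[OF 4 st'(1,2,4) st(2,3,4) eq[symmetric]] by simp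
  qed
qed

text \<open>A part of the tiling is described by the set of grid points \<open>(i, j)\<close>, \<open>i < j\<close>, in it, with \<open>C j\<close>
  collecting the values of \<open>i\<close> in row \<open>j\<close>. Each of these is joined to \<open>(i, j - 1)\<close> and to \<open>(i + 1, j)\<close>;
  for \<open>i = j - 1\<close> both are the origin, so there is only one edge. The closure
  conditions say that these neighbours belong to the part, too. Triangles are excluded since \<open>j - i\<close> changes
  by one along each edge.\<close>

lemma zonogon_matchstick_graph:
  fixes C :: "nat \<Rightarrow> nat set" and M :: nat
  assumes C: "\<And>i j. i \<in> C j \<Longrightarrow> i < j \<and> j \<le> M"
    and up: "\<And>i j. i \<in> C j \<Longrightarrow> Suc i < j \<Longrightarrow> Suc i \<in> C j"
    and down: "\<And>i j. i \<in> C j \<Longrightarrow> Suc i < j \<Longrightarrow> i \<in> C (j - 1)"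
  shows "\<exists>V E. matchstick_graph V E \<and> triangle_free E \<and> card V = Suc (\<Sum>j\<le>M. card (C j)) \<and>
    card E = (\<Sum>j\<le>M. card (C j)) + (\<Sum>j\<le>M. card (C j - {j - 1}))"
proof -
  define P where "P i j = zono M (real i) (real j)" for i j
  define A where "A = (SIGMA j:{..M}. C j)"
  define A' where "A' = (SIGMA j:{..M}. C j - {j - 1})"
  have finC: "finite (C j)" for j by (rule finite_subset[of _ "{..<j}"]) (use C in auto)
  have finA: "finite A" "finite A'" unfolding A_def A'_def using finC by auto
  have cardA: "card A = (\<Sum>j\<le>M. card (C j))" "card A' = (\<Sum>j\<le>M. card (C j - {j - 1}))"
    unfolding A_def A'_def using finC by (simp_all add: card_SigmaI)
  have AD: "i < j" "j \<le> M" "i \<in> C j" if "(j, i) \<in> A" for j i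
    using that C unfolding A_def by auto
  have A'D: "(j, i) \<in> A" "Suc i < j" if "(j, i) \<in> A'" for j i
    using that C[of i j] unfolding A_def A'_def by auto
  define V where "V = insert 0 ((\<lambda>(j, i). P i j) ` A)"
  define Idx where "Idx = {True} \<times> A \<union> {False} \<times> A'"
  \<comment> \<open>an edge is named by its upper end and by whether it decreases \<open>j\<close> or increases \<open>i\<close>\<close>
  define ed where "ed = (\<lambda>(b, j, i). if b then {P i j, P i (j - 1)} else {P i j, P (Suc i) j})"
  \<comment> \<open>the pairs of times that belong to the points of an edge\<close>
  define on where "on = (\<lambda>(b, j, i) s t. if b then s = real i \<and> real (j - 1) \<le> t \<and> t \<le> real j
     else real i \<le> s \<and> s \<le> real i + 1 \<and> t = real j)"
  define E where "E = ed ` Idx"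
  have P0: "P i i = 0" for i unfolding P_def by simp
  have PV: "P i j \<in> V" if "(j, i) \<in> A \<or> i = j" for i j
    using that unfolding V_def P0[symmetric, of 0] using P0[of 0] P0[of j] by force
  have VP: "\<exists>i j. i \<le> j \<and> j \<le> M \<and> x = P i j" if x: "x \<in> V" for x
  proof -
    from x P0[of 0] consider "x = P 0 0" | i j where "(j, i) \<in> A" "x = P i j" unfolding V_def by auto
    then show ?thesis
    proof cases
      case 1 then show ?thesis by blast
    next
      case (2 i j) then show ?thesis using AD[OF 2(1)] by (intro exI[of _ i] exI[of _ j]) simp
    qed
  qed
  have diff: "zono M s t - zono M s u = zono M u t" "zono M s t - zono M u t = zono M s u" for s t u
    using zono_add[of M s u t] by (simp_all add: algebra_simps)
  have stepR: "dist (P i j) (P i (j - 1)) = 1" if "(j, i) \<in> A" for i j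
  proof -
    have j: "real j = real (j - 1) + 1" "j - 1 < M" using AD[OF that] by auto
    have "P i j - P i (j - 1) = dir (j - 1)" unfolding P_def diff unfolding j(1) by (rule zono_step[OF j(2)])
    then show ?thesis by (simp add: dist_norm norm_dir)
  qed
  have stepL: "dist (P i j) (P (Suc i) j) = 1" if "(j, i) \<in> A" for i j
  proof -
    have i: "real (Suc i) = real i + 1" "i < M" using AD[OF that] by auto
    have "P i j - P (Suc i) j = dir i" unfolding P_def diff i(1) by (rule zono_step[OF i(2)])
    then show ?thesis by (simp add: dist_norm norm_dir)
  qed
  have ends: "\<exists>a b. ed x = {a, b} \<and> a \<in> V \<and> b \<in> V \<and> dist a b = 1 \<and>
      (\<exists>i j i' j'. a = P i j \<and> b = P i' j' \<and> i \<le> j \<and> j \<le> M \<and> i' \<le> j' \<and> j' \<le> M \<and> j - i = Suc (j' - i'))"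
    if x: "x \<in> Idx" for x
  proof -
    obtain b j i where bji: "x = (b, j, i)" by (cases x)
    show ?thesis
    proof (cases b)
      case True
      then have A: "(j, i) \<in> A" using x unfolding Idx_def bji by simp
      have "(j - 1, i) \<in> A \<or> i = j - 1"
      proof (cases "Suc i < j")
        case True
        then show ?thesis using down[OF AD(3)[OF A] True] AD[OF A] unfolding A_def by auto
      next
        case False
        then have "i = j - 1" using AD[OF A] by linarith
        then show ?thesis ..
      qed
      then have "P i (j - 1) \<in> V" by (rule PV)
      moreover have "P i j \<in> V" using PV A by blast
      moreover have "ed x = {P i j, P i (j - 1)}" unfolding ed_def bji using True by simp
      moreover have "i \<le> j" "j \<le> M" "i \<le> j - 1" "j - 1 \<le> M" "j - i = Suc (j - 1 - i)" using AD[OF A] by auto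
      ultimately show ?thesis using stepR[OF A] by blast
    next
      case False
      then have A': "(j, i) \<in> A'" using x unfolding Idx_def bji by simp
      note A = A'D[OF A']
      have "(j, Suc i) \<in> A" using up[OF AD(3)[OF A(1)] A(2)] AD[OF A(1)] unfolding A_def by simp
      then have "P (Suc i) j \<in> V" using PV by blast
      moreover have "P i j \<in> V" using PV A by blast
      moreover have "ed x = {P i j, P (Suc i) j}" unfolding ed_def bji using False by simp
      moreover have "i \<le> j" "j \<le> M" "Suc i \<le> j" "j - i = Suc (j - Suc i)" using AD[OF A(1)] A(2) by auto
      ultimately show ?thesis using stepL[OF A(1)] by blast
    qed
  qed
  have cov: "\<exists>s t. on x s t \<and> z = zono M s t" if x: "x \<in> Idx" and z: "z \<in> convex hull (ed x)" for x z
  proof -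
    obtain b j i where bji: "x = (b, j, i)" by (cases x)
    show ?thesis
    proof (cases b)
      case True
      then have A: "(j, i) \<in> A" using x unfolding Idx_def bji by simp
      obtain a where a: "j = Suc a" using AD(1)[OF A] by (cases j) auto
      have ra: "real (Suc a) = real a + 1" by simp
      have "z \<in> closed_segment (P i a) (P i j)"
        using z True unfolding ed_def bji a by (simp add: segment_convex_hull insert_commute)
      then obtain l where l: "z = (1 - l) *\<^sub>R P i a + l *\<^sub>R P i j" "0 \<le> l" "l \<le> 1" unfolding in_segment by blast
      have "z = zono M (real i) (real a + l)"
        unfolding l(1) P_def a ra by (rule zono_affine_right[OF l(2,3), symmetric])
      moreover have "on x (real i) (real a + l)" unfolding on_def bji a using True l by simp
      ultimately show ?thesis by blast
    next
      case False
      have ri: "real (Suc i) = real i + 1" by simp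
      have "z \<in> closed_segment (P i j) (P (Suc i) j)"
        using z False unfolding ed_def bji by (simp add: segment_convex_hull)
      then obtain l where l: "z = (1 - l) *\<^sub>R P i j + l *\<^sub>R P (Suc i) j" "0 \<le> l" "l \<le> 1" unfolding in_segment by blast
      have "z = zono M (real i + l) (real j)"
        unfolding l(1) P_def ri by (rule zono_affine_left[OF l(2,3), symmetric])
      moreover have "on x (real i + l) (real j)" unfolding on_def bji using False l by simp
      ultimately show ?thesis by blast
    qed
  qed
  have good: "0 \<le> s" "s \<le> t" "t \<le> real M" "s \<in> \<nat> \<or> s + 1 \<le> t" if x: "x \<in> Idx" and o: "on x s t" for x s t
  proof -
    obtain b j i where bji: "x = (b, j, i)" by (cases x)
    have "0 \<le> s \<and> s \<le> t \<and> t \<le> real M \<and> (s \<in> \<nat> \<or> s + 1 \<le> t)"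
    proof (cases b)
      case True
      then have A: "(j, i) \<in> A" using x unfolding Idx_def bji by simp
      have "s = real i" "real (j - 1) \<le> t" "t \<le> real j" using o True unfolding on_def bji by auto
      moreover have "real i \<le> real (j - 1)" "real j \<le> real M" using AD[OF A] by auto
      ultimately show ?thesis by auto
    next
      case False
      then have A': "(j, i) \<in> A'" using x unfolding Idx_def bji by simp
      have "real i \<le> s" "s \<le> real i + 1" "t = real j" using o False unfolding on_def bji by auto
      moreover have "real i + 2 \<le> real j" "real j \<le> real M" using A'D[OF A'] AD(2) by auto
      moreover have "0 \<le> real i" by simp
      ultimately show ?thesis by (intro conjI disjI2) linarith+
    qed
    then show "0 \<le> s" "s \<le> t" "t \<le> real M" "s \<in> \<nat> \<or> s + 1 \<le> t" by auto
  qed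
  have endp: "zono M s t \<in> ed x" if o: "on x s t" and st: "s \<in> \<nat>" "t \<in> \<nat>" for x s t
  proof -
    obtain b j i where bji: "x = (b, j, i)" by (cases x)
    from st obtain p q where pq: "s = real p" "t = real q" by (auto elim!: Nats_cases)
    show ?thesis
    proof (cases b)
      case True
      then have "p = i" "j - 1 \<le> q" "q \<le> j" using o unfolding on_def bji pq by auto
      then have "p = i" "q = j \<or> q = j - 1" by auto
      then show ?thesis unfolding pq ed_def bji P_def[symmetric] using True by auto
    next
      case False
      then have "i \<le> p" "p \<le> Suc i" "q = j" using o unfolding on_def bji pq by auto
      then have "p = i \<or> p = Suc i" "q = j" by auto
      then show ?thesis unfolding pq ed_def bji P_def[symmetric] using False by auto
    qed
  qed
  have degenerate: "s \<in> \<nat> \<and> t \<in> \<nat>" if "x \<in> Idx" "on x s t" "s = t" for x s t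
    using good[OF that(1,2)] that(3) by auto
  have common: "s \<in> \<nat> \<and> t \<in> \<nat>" if "on x s t" "on y s t" "x \<noteq> y" "x \<in> Idx" "y \<in> Idx" for x y s t
  proof -
    obtain b j i where x: "x = (b, j, i)" by (cases x)
    obtain b' j' i' where y: "y = (b', j', i')" by (cases y)
    consider "b" "b'" | "\<not> b" "\<not> b'" | "b" "\<not> b'" | "\<not> b" "b'" by blast
    then show ?thesis
    proof cases
      case 1
      then have eq: "s = real i" "i' = i" and t: "real (j - 1) \<le> t" "t \<le> real j" "real (j' - 1) \<le> t" "t \<le> real j'"
        using that(1,2) unfolding on_def x y by auto
      have "j \<noteq> j'" using that(3) 1 eq unfolding x y by auto
      then have "j \<le> j' - 1 \<or> j' \<le> j - 1" by linarith
      then have "t = real j \<or> t = real j'" using t by (metis of_nat_le_iff order_antisym order_trans)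
      then show ?thesis using eq(1) by auto
    next
      case 2
      then have eq: "t = real j" "j' = j" and s: "real i \<le> s" "s \<le> real (Suc i)" "real i' \<le> s" "s \<le> real (Suc i')"
        using that(1,2) unfolding on_def x y by auto
      have "i \<noteq> i'" using that(3) 2 eq unfolding x y by auto
      then have "Suc i \<le> i' \<or> Suc i' \<le> i" by linarith
      then have "s = real i \<or> s = real i'" using s by (metis of_nat_le_iff order_antisym order_trans)
      then show ?thesis using eq(1) by auto
    next
      case 3
      then show ?thesis using that(1,2) unfolding on_def x y by auto
    next
      case 4
      then show ?thesis using that(1,2) unfolding on_def x y by auto
    qed
  qed
  have meet: "z \<in> ed x \<and> z \<in> ed y"
    if x: "x \<in> Idx" "z \<in> convex hull (ed x)" and y: "y \<in> Idx" "z \<in> convex hull (ed y)" and ne: "x \<noteq> y" for x y z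
  proof -
    obtain s t where st: "on x s t" "z = zono M s t" using cov[OF x] by blast
    obtain s' t' where st': "on y s' t'" "z = zono M s' t'" using cov[OF y] by blast
    have "zono M s t = zono M s' t'" using st st' by simp
    from zono_inj[OF good[OF x(1) st(1)] good[OF y(1) st'(1)] this]
    have "s \<in> \<nat> \<and> t \<in> \<nat> \<and> s' \<in> \<nat> \<and> t' \<in> \<nat>"
    proof
      assume "s = s' \<and> t = t'"
      then show ?thesis using common[OF st(1) _ ne x(1) y(1)] st'(1) by simp
    next
      assume "s = t \<and> s' = t'"
      then show ?thesis using degenerate[OF x(1) st(1)] degenerate[OF y(1) st'(1)] by blast
    qed
    then show ?thesis using endp[OF st(1)] endp[OF st'(1)] st(2) st'(2) by simp
  qed
  have vert: "w \<in> ed x" if x: "x \<in> Idx" "w \<in> convex hull (ed x)" and w: "w \<in> V" for x w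
  proof -
    obtain s t where st: "on x s t" "w = zono M s t" using cov[OF x] by blast
    obtain i j where ij: "i \<le> j" "j \<le> M" "w = P i j" using VP[OF w] by blast
    have "zono M s t = zono M (real i) (real j)" using st ij unfolding P_def by simp
    from zono_inj[OF good[OF x(1) st(1)] _ _ _ _ this]
    have "s = real i \<and> t = real j \<or> s = t \<and> real i = real j" using ij by simp
    then have "s \<in> \<nat> \<and> t \<in> \<nat>" using degenerate[OF x(1) st(1)] by auto
    then show ?thesis using endp[OF st(1)] st(2) by simp
  qed
  have simple: "simple_graph V E"
    unfolding simple_graph_def
  proof
    show "finite V" unfolding V_def using finA by simp
    show "\<forall>e\<in>E. \<exists>u\<in>V. \<exists>v\<in>V. u \<noteq> v \<and> e = {u, v}"
    proof
      fix e assume "e \<in> E"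
      then obtain x where x: "x \<in> Idx" "e = ed x" unfolding E_def by blast
      obtain a b where ab: "e = {a, b}" "a \<in> V" "b \<in> V" "dist a b = 1"
        unfolding x(2) using ends[OF x(1)] by blast
      moreover have "a \<noteq> b" using ab(4) by auto
      ultimately show "\<exists>u\<in>V. \<exists>v\<in>V. u \<noteq> v \<and> e = {u, v}" by blast
    qed
  qed
  have unit: "dist u v = 1" if "{u, v} \<in> E" for u v
  proof -
    obtain x where x: "x \<in> Idx" "{u, v} = ed x" using \<open>{u, v} \<in> E\<close> unfolding E_def by blast
    obtain a b where ab: "{u, v} = {a, b}" "dist a b = 1" unfolding x(2) using ends[OF x(1)] by blast
    then show ?thesis by (auto simp: doubleton_eq_iff dist_commute)
  qed
  have match: "matchstick_graph V E"
    unfolding matchstick_graph_def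
  proof (intro conjI simple)
    show "\<forall>u v. {u, v} \<in> E \<longrightarrow> dist u v = 1" using unit by blast
    show "\<forall>e\<in>E. \<forall>w\<in>V. w \<in> convex hull e \<longrightarrow> w \<in> e" unfolding E_def using vert by blast
    show "\<forall>e\<in>E. \<forall>f\<in>E. e \<noteq> f \<longrightarrow> convex hull e \<inter> convex hull f \<subseteq> e \<inter> f"
    proof (intro ballI impI subsetI)
      fix e f z assume "e \<in> E" "f \<in> E" "e \<noteq> f" "z \<in> convex hull e \<inter> convex hull f"
      moreover then obtain x y where "x \<in> Idx" "e = ed x" "y \<in> Idx" "f = ed y" unfolding E_def by blast
      ultimately show "z \<in> e \<inter> f" using meet[of x z y] by auto
    qed
  qed
  \<comment> \<open>the difference \<open>j - i\<close>, as a function of the vertex\<close>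
  define lv where "lv p = (SOME l. \<exists>i j. i \<le> j \<and> j \<le> M \<and> p = P i j \<and> l = j - i)" for p
  have lv: "lv (P i j) = j - i" if ij: "i \<le> j" "j \<le> M" for i j
  proof -
    have "\<exists>i' j'. i' \<le> j' \<and> j' \<le> M \<and> P i j = P i' j' \<and> lv (P i j) = j' - i'"
      unfolding lv_def by (rule someI_ex) (use ij in blast)
    then obtain i' j' where ij': "i' \<le> j'" "j' \<le> M" "P i j = P i' j'" "lv (P i j) = j' - i'" by blast
    have "real i = real i' \<and> real j = real j' \<or> real i = real j \<and> real i' = real j'"
      by (rule zono_inj[of _ _ M]) (use ij ij' in \<open>simp_all add: P_def\<close>)
    then show ?thesis using ij'(4) by auto
  qed
  have level: "lv a = Suc (lv b) \<or> lv b = Suc (lv a)" if "{a, b} \<in> E" for a b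
  proof -
    obtain x where x: "x \<in> Idx" "{a, b} = ed x" using \<open>{a, b} \<in> E\<close> unfolding E_def by blast
    obtain a' b' i j i' j' where *: "{a, b} = {a', b'}" "a' = P i j" "b' = P i' j'" "i \<le> j" "j \<le> M" "i' \<le> j'" "j' \<le> M"
        "j - i = Suc (j' - i')" unfolding x(2) using ends[OF x(1)] by blast
    then have "lv a' = Suc (lv b')" using lv by simp
    then show ?thesis using *(1) by (auto simp: doubleton_eq_iff)
  qed
  have tf: "triangle_free E" unfolding triangle_free_def
  proof (rule notI, elim exE conjE)
    fix a b c assume "{a, b} \<in> E" "{b, c} \<in> E" "{a, c} \<in> E"
    then show False using level[of a b] level[of b c] level[of a c] by presburger
  qed
  have nonzero: "P i j \<noteq> P i' j'" if "(j, i) \<in> A" "i' \<le> j'" "j' \<le> M" "(i, j) \<noteq> (i', j')" for i j i' j'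
  proof
    assume eq: "P i j = P i' j'"
    have "real i = real i' \<and> real j = real j' \<or> real i = real j \<and> real i' = real j'"
      by (rule zono_inj[of _ _ M]) (use eq AD[OF that(1)] that(2,3) in \<open>simp_all add: P_def\<close>)
    then show False using that(4) AD[OF that(1)] by auto
  qed
  have "inj_on (\<lambda>(j, i). P i j) A"
  proof (rule inj_onI)
    fix x y assume "x \<in> A" "y \<in> A" "(\<lambda>(j, i). P i j) x = (\<lambda>(j, i). P i j) y"
    then show "x = y" using nonzero[of "fst x" "snd x" "snd y" "fst y"] AD[of "fst y" "snd y"]
      by (cases x; cases y) auto
  qed
  moreover have "0 \<notin> (\<lambda>(j, i). P i j) ` A"
  proof
    assume "0 \<in> (\<lambda>(j, i). P i j) ` A"
    then obtain j i where ji: "(j, i) \<in> A" "P i j = P 0 0" using P0[of 0] by auto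
    then show False using nonzero[OF ji(1), of 0 0] AD(1)[OF ji(1)] by auto
  qed
  ultimately have cardV: "card V = Suc (card A)" unfolding V_def using finA by (simp add: card_image)
  have "inj_on ed Idx"
  proof (rule inj_onI, rule ccontr)
    fix x y assume x: "x \<in> Idx" and y: "y \<in> Idx" and eq: "ed x = ed y" and ne: "x \<noteq> y"
    obtain a b where ab: "ed x = {a, b}" "dist a b = 1" using ends[OF x] by blast
    have "midpoint a b \<in> convex hull (ed x)" unfolding ab by (simp flip: segment_convex_hull)
    then have "midpoint a b \<in> ed x" using meet[OF x _ y _ ne, of "midpoint a b"] eq by simp
    then have "midpoint a b = a \<or> midpoint a b = b" unfolding ab by simp
    then have "a = b" by (auto simp: midpoint_eq_endpoint)
    then show False using ab(2) by simp
  qed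
  then have "card E = card Idx" unfolding E_def by (rule card_image)
  also have "\<dots> = card ({True} \<times> A) + card ({False} \<times> A')"
    unfolding Idx_def using finA by (intro card_Un_disjoint) auto
  also have "\<dots> = card A + card A'" by (simp add: card_cartesian_product)
  finally have "card E = card A + card A'" .
  then show ?thesis using match tf cardV cardA by metis
qed

lemma triangular_decomposition: "\<exists>m r. q = (\<Sum>j\<le>m. j) + r \<and> r \<le> (m :: nat)"
proof (induction q)
  case 0
  show ?case by (intro exI[of _ 0]) simp
next
  case (Suc q)
  then obtain m r where mr: "q = (\<Sum>j\<le>m. j) + r" "r \<le> m" by blast
  show ?case
  proof (cases "r = m")
    case True
    then have "Suc q = (\<Sum>j\<le>Suc m. j) + 0" using mr by simp
    then show ?thesis by blast
  next
    case False
    then have "Suc q = (\<Sum>j\<le>m. j) + Suc r" "Suc r \<le> m" using mr by simp_all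
    then show ?thesis by blast
  qed
qed

text \<open>Take the \<open>m\<close> full rows of the tiling that fit and \<open>r\<close> vertices of the next row. In each of the at most
  \<open>m + 1\<close> nonempty rows there is one vertex that contributes a single edge, and \<open>m\<^sup>2 \<le> 2n\<close>.\<close>

lemma max_edges_lower:
  assumes n: "n \<ge> 1"
  shows "2 * real n - sqrt 2 * sqrt (real n) - 4 \<le> real (max_edges n)"
proof -
  obtain m r where mr: "n - 1 = (\<Sum>j\<le>m. j) + r" "r \<le> m" using triangular_decomposition by blast
  define C where "C j = (if j \<le> m then {..<j} else if j = Suc m then {Suc m - r..<Suc m} else {})" for j
  have "\<exists>V E. matchstick_graph V E \<and> triangle_free E \<and> card V = Suc (\<Sum>j\<le>Suc m. card (C j)) \<and>
    card E = (\<Sum>j\<le>Suc m. card (C j)) + (\<Sum>j\<le>Suc m. card (C j - {j - 1}))"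
  proof (rule zonogon_matchstick_graph)
    show "i < j \<and> j \<le> Suc m" if "i \<in> C j" for i j using that unfolding C_def by (auto split: if_splits)
    show "Suc i \<in> C j" if "i \<in> C j" "Suc i < j" for i j using that unfolding C_def by (auto split: if_splits)
    show "i \<in> C (j - 1)" if "i \<in> C j" "Suc i < j" for i j using that unfolding C_def by (auto split: if_splits)
  qed
  then obtain V E where VE: "matchstick_graph V E" "triangle_free E" "card V = Suc (\<Sum>j\<le>Suc m. card (C j))"
    "card E = (\<Sum>j\<le>Suc m. card (C j)) + (\<Sum>j\<le>Suc m. card (C j - {j - 1}))" by blast
  have "(\<Sum>j\<le>m. card (C j)) = (\<Sum>j\<le>m. j)" by (rule sum.cong) (auto simp: C_def)
  moreover have "card (C (Suc m)) = r" using mr(2) by (simp add: C_def)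
  ultimately have sumC: "(\<Sum>j\<le>Suc m. card (C j)) = n - 1" using mr(1) by simp
  have "(\<Sum>j\<le>Suc m. card (C j)) \<le> (\<Sum>j\<le>Suc m. card (C j - {j - 1}) + 1)"
    by (rule sum_mono) (auto simp: card_Diff_singleton_if)
  also have "\<dots> = (\<Sum>j\<le>Suc m. card (C j - {j - 1})) + (m + 2)"
    unfolding sum.distrib by simp
  finally have "2 * (n - 1) \<le> card E + (m + 2)" using sumC VE(4) by simp
  then have E: "2 * real n - real m - 4 \<le> real (card E)" using n by linarith
  have "card V = n" using VE(3) sumC n by simp
  then have "card E \<in> edge_counts n" unfolding edge_counts_def using VE(1,2) by blast
  then have "card E \<le> max_edges n" unfolding max_edges_def by (rule Max_ge[OF finite_edge_counts])
  moreover have "real m \<le> sqrt 2 * sqrt (real n)"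
  proof -
    have "k * k \<le> 2 * (\<Sum>j\<le>k. j)" for k :: nat by (induction k) auto
    then have "m * m \<le> 2 * (\<Sum>j\<le>m. j)" .
    also have "\<dots> \<le> 2 * n" using mr(1) by simp
    finally have "real (m * m) \<le> real (2 * n)" by (simp only: of_nat_le_iff)
    then have "(real m)\<^sup>2 \<le> 2 * real n" by (simp add: power2_eq_square)
    then have "real m \<le> sqrt (2 * real n)" by (rule real_le_rsqrt)
    then show ?thesis by (simp add: real_sqrt_mult)
  qed
  ultimately show ?thesis using E by linarith
qed

theorem theorem1:
  shows "(\<forall>n::nat. n \<ge> 1 \<longrightarrow>
            real (max_edges n) \<le> 2 * real n - sqrt 2 / 5 * sqrt (real n)) \<and>
         (\<exists>K::real. \<forall>n::nat. n \<ge> 1 \<longrightarrow>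
            real (max_edges n) \<ge> 2 * real n - sqrt 2 * sqrt (real n) - K)"
  using max_edges_upper max_edges_lower by blast

end
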